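(* Suppose that the seed $\Sigma=(\mathbf x,\mathbf y,B)$ is acyclic and has principal coefficients. Then the cluster algebra $A=A(\Sigma)$ over $K$ is factorial (a unique factorization domain).
   Context: The base ring $K$ is either $\mathbb Z$ or a field of characteristic $0$; $[a,b]$ denotes the set of integers between $a$ and $b$. An exchange matrix is an $(n+m)\times n$ integer matrix $B=(b_{ij})$ ($n,m\ge 0$) whose principal part (the top $n\times n$ submatrix) is skew-symmetrizable, i.e. there are positive integers $d_1,\ldots,d_n$ with $d_ib_{ij}=-d_jb_{ji}$ for all $i,j\in[1,n]$. A seed is a triple $\Sigma=(\mathbf x,\mathbf y,B)$ with $\mathbf x=(x_1,\ldots,x_n)$ (exchangeable variables) and $\mathbf y=(x_{n+1},\ldots,x_{n+m})$ (frozen variables) together algebraically independent over $K$, and $B$ an $(n+m)\times n$ exchange matrix; its ambient field is $\mathcal F=\mathbf q(K)(x_1,\ldots,x_{n+m})$, where $\mathbf q$ denotes the quotient field. For $i\in[1,n]$ the exchange polynomial is $f_i=\prod_{j:\,b_{ji}>0}x_j^{b_{ji}}+\prod_{j:\,b_{ji}<0}x_j^{-b_{ji}}$, with $j$ ranging over $[1,n+m]$. The mutation $\mu_i(\Sigma)$ is the seed obtained by replacing $x_i$ by $x_i'=f_i/x_i\in\mathcal F$, keeping $\mathbf y$ and the other $x_j$, and replacing $B$ by $B'=(b'_{kl})$, where $b'_{kl}=-b_{kl}$ if $k=i$ or $l=i$, and $b'_{kl}=b_{kl}+\tfrac12(|b_{ki}|b_{il}+b_{ki}|b_{il}|)$ otherwise.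 Let $\mathcal X$ be the set of all exchangeable variables of seeds obtained from $\Sigma$ by finite sequences of mutations (the cluster variables). The cluster algebra (with all frozen variables invertible) is $A(\Sigma)=K[x,\,y,\,y^{-1}\mid x\in\mathcal X,\ y\in\mathbf y]\subseteq\mathcal F$. The seed is acyclic if the directed graph on $[1,n]$ with an edge $i\to j$ whenever $b_{ij}>0$ ($i,j\in[1,n]$) has no oriented cycle. The seed has principal coefficients if $m=n$ and the $n\times n$ submatrix of $B$ formed by the last $n$ rows is the identity matrix. *)

theory Defs
  imports "HOL-Algebra.Algebra" "HOL-Algebra.Ring_Divisibility" "HOL-Library.FuncSet"
begin

text \<open>
  The ambient field is a field \<open>F\<close> in the sense of HOL-Algebra, and the base ring \<open>K\<close> is a
  subset of its carrier.  In the case \<open>K = \<int>\<close> it is the canonical copy of the integers in \<open>F\<close>;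
  the injectivity condition says that the characteristic is \<open>0\<close>.
\<close>

definition base_ring :: "('a, 'b) ring_scheme \<Rightarrow> 'a set \<Rightarrow> bool" where
  "base_ring F K \<longleftrightarrow>
     inj (\<lambda>z::int. [z] \<cdot>\<^bsub>F\<^esub> \<one>\<^bsub>F\<^esub>) \<and>
     (K = range (\<lambda>z::int. [z] \<cdot>\<^bsub>F\<^esub> \<one>\<^bsub>F\<^esub>) \<or> subfield K F)"

text \<open>
  A polynomial in the indeterminates indexed by \<open>I\<close> is given by a finite set \<open>S\<close> of exponent
  vectors and a coefficient function \<open>c\<close>.  Exponent vectors are taken in \<open>I \<rightarrow>\<^sub>E UNIV\<close> so that
  distinct members of \<open>S\<close> are distinct monomials.
\<close>

definition alg_independent ::
  "('a, 'b) ring_scheme \<Rightarrow> 'a set \<Rightarrow> 'i set \<Rightarrow> ('i \<Rightarrow> 'a) \<Rightarrow> bool" where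
  "alg_independent F K I x \<longleftrightarrow>
     (\<forall>S c. finite S \<longrightarrow> S \<subseteq> (I \<rightarrow>\<^sub>E (UNIV :: nat set)) \<longrightarrow> c \<in> S \<rightarrow> K \<longrightarrow>
        (\<Oplus>\<^bsub>F\<^esub>\<alpha>\<in>S. c \<alpha> \<otimes>\<^bsub>F\<^esub> (\<Otimes>\<^bsub>F\<^esub>i\<in>I. x i [^]\<^bsub>F\<^esub> \<alpha> i)) = \<zero>\<^bsub>F\<^esub> \<longrightarrow>
        (\<forall>\<alpha>\<in>S. c \<alpha> = \<zero>\<^bsub>F\<^esub>))"

text \<open>
  With \<open>n = n_exch\<close> and \<open>m = n_frozen\<close>, the exchangeable variables are \<open>xvar i\<close> for \<open>i \<in> {1..n}\<close>,
  the frozen ones are \<open>xvar i\<close> for \<open>i \<in> {n+1..n+m}\<close>, and \<open>bmat k l\<close> is the matrix entry in row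
  \<open>k \<in> {1..n+m}\<close> and column \<open>l \<in> {1..n}\<close>.  Values of \<open>xvar\<close> and \<open>bmat\<close> outside these ranges are
  irrelevant: nothing below depends on them.
\<close>

record 'a seed =
  n_exch :: nat
  n_frozen :: nat
  xvar :: "nat \<Rightarrow> 'a"
  bmat :: "nat \<Rightarrow> nat \<Rightarrow> int"

definition exch_idx :: "'a seed \<Rightarrow> nat set" where
  "exch_idx \<Sigma> = {1..n_exch \<Sigma>}"

definition frozen_idx :: "'a seed \<Rightarrow> nat set" where
  "frozen_idx \<Sigma> = {n_exch \<Sigma> + 1..n_exch \<Sigma> + n_frozen \<Sigma>}"

definition all_idx :: "'a seed \<Rightarrow> nat set" where
  "all_idx \<Sigma> = {1..n_exch \<Sigma> + n_frozen \<Sigma>}"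

definition skew_symmetrizable :: "nat \<Rightarrow> (nat \<Rightarrow> nat \<Rightarrow> int) \<Rightarrow> bool" where
  "skew_symmetrizable n b \<longleftrightarrow>
     (\<exists>d :: nat \<Rightarrow> int. (\<forall>i\<in>{1..n}. d i > 0) \<and>
        (\<forall>i\<in>{1..n}. \<forall>j\<in>{1..n}. d i * b i j = - (d j * b j i)))"

definition is_seed :: "('a, 'b) ring_scheme \<Rightarrow> 'a set \<Rightarrow> 'a seed \<Rightarrow> bool" where
  "is_seed F K \<Sigma> \<longleftrightarrow>
     xvar \<Sigma> \<in> all_idx \<Sigma> \<rightarrow> carrier F \<and>
     alg_independent F K (all_idx \<Sigma>) (xvar \<Sigma>) \<and>
     skew_symmetrizable (n_exch \<Sigma>) (bmat \<Sigma>)"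

text \<open>\<open>F\<close> is the field of rational functions \<open>q(K)(x\<^sub>1, \<dots>, x\<^bsub>n+m\<^esub>)\<close>.\<close>

definition ambient_field :: "('a, 'b) ring_scheme \<Rightarrow> 'a set \<Rightarrow> 'a seed \<Rightarrow> bool" where
  "ambient_field F K \<Sigma> \<longleftrightarrow> carrier F = generate_field F (K \<union> xvar \<Sigma> ` all_idx \<Sigma>)"

definition exchange_poly :: "('a, 'b) ring_scheme \<Rightarrow> 'a seed \<Rightarrow> nat \<Rightarrow> 'a" where
  "exchange_poly F \<Sigma> i =
     (\<Otimes>\<^bsub>F\<^esub>j\<in>{j \<in> all_idx \<Sigma>. bmat \<Sigma> j i > 0}. xvar \<Sigma> j [^]\<^bsub>F\<^esub> nat (bmat \<Sigma> j i)) \<oplus>\<^bsub>F\<^esub>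
     (\<Otimes>\<^bsub>F\<^esub>j\<in>{j \<in> all_idx \<Sigma>. bmat \<Sigma> j i < 0}. xvar \<Sigma> j [^]\<^bsub>F\<^esub> nat (- bmat \<Sigma> j i))"

text \<open>The integer division by \<open>2\<close> is exact: \<open>\<bar>a\<bar> * c + a * \<bar>c\<bar>\<close> is \<open>0\<close>, \<open>2 * a * c\<close> or \<open>- 2 * a * c\<close>.\<close>

definition mutate_mat :: "nat \<Rightarrow> (nat \<Rightarrow> nat \<Rightarrow> int) \<Rightarrow> (nat \<Rightarrow> nat \<Rightarrow> int)" where
  "mutate_mat i b = (\<lambda>k l.
     if k = i \<or> l = i then - b k l
     else b k l + (\<bar>b k i\<bar> * b i l + b k i * \<bar>b i l\<bar>) div 2)"

definition mutate :: "('a, 'b) ring_scheme \<Rightarrow> nat \<Rightarrow> 'a seed \<Rightarrow> 'a seed" where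
  "mutate F i \<Sigma> = \<Sigma>\<lparr>
     xvar := (xvar \<Sigma>)(i := exchange_poly F \<Sigma> i \<otimes>\<^bsub>F\<^esub> inv\<^bsub>F\<^esub> (xvar \<Sigma> i)),
     bmat := mutate_mat i (bmat \<Sigma>)\<rparr>"

inductive_set mutation_class :: "('a, 'b) ring_scheme \<Rightarrow> 'a seed \<Rightarrow> 'a seed set"
  for F and \<Sigma> where
  initial: "\<Sigma> \<in> mutation_class F \<Sigma>"
| mutation: "\<Sigma>' \<in> mutation_class F \<Sigma> \<Longrightarrow> i \<in> exch_idx \<Sigma>' \<Longrightarrow> mutate F i \<Sigma>' \<in> mutation_class F \<Sigma>"

definition cluster_variables :: "('a, 'b) ring_scheme \<Rightarrow> 'a seed \<Rightarrow> 'a set" where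
  "cluster_variables F \<Sigma> = (\<Union>\<Sigma>'\<in>mutation_class F \<Sigma>. xvar \<Sigma>' ` exch_idx \<Sigma>')"

definition frozen_variables :: "'a seed \<Rightarrow> 'a set" where
  "frozen_variables \<Sigma> = xvar \<Sigma> ` frozen_idx \<Sigma>"

definition cluster_algebra ::
  "('a, 'b) ring_scheme \<Rightarrow> 'a set \<Rightarrow> 'a seed \<Rightarrow> ('a, 'b) ring_scheme" where
  "cluster_algebra F K \<Sigma> = F\<lparr>carrier := generate_ring F
     (K \<union> cluster_variables F \<Sigma> \<union> frozen_variables \<Sigma> \<union>
      (\<lambda>y. inv\<^bsub>F\<^esub> y) ` frozen_variables \<Sigma>)\<rparr>"

definition acyclic_seed :: "'a seed \<Rightarrow> bool" where
  "acyclic_seed \<Sigma> \<longleftrightarrow>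
     acyclic {(i, j). i \<in> exch_idx \<Sigma> \<and> j \<in> exch_idx \<Sigma> \<and> bmat \<Sigma> i j > 0}"

definition principal_coefficients :: "'a seed \<Rightarrow> bool" where
  "principal_coefficients \<Sigma> \<longleftrightarrow>
     n_frozen \<Sigma> = n_exch \<Sigma> \<and>
     (\<forall>i\<in>{1..n_exch \<Sigma>}. \<forall>j\<in>{1..n_exch \<Sigma>}.
        bmat \<Sigma> (n_exch \<Sigma> + i) j = (if i = j then 1 else 0))"

end

theory Submission
  imports Defs
begin

text \<open>
  Let \<open>C\<^sub>j\<close> be the Laurent polynomial ring over \<open>K\<close> in all variables of a seed but \<open>x\<^sub>j\<close>, and let the
  upper bound \<open>U\<close> of the seed be the intersection of the rings \<open>C\<^sub>j[x\<^sub>j, f\<^sub>j/x\<^sub>j]\<close>, \<open>j\<close> exchangeable.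
  Principal coefficients make the columns of \<open>B\<close> linearly independent, a property preserved by mutation.
  It makes the exchange polynomials coprime, so that the upper bound of a mutated seed is contained
  in \<open>U\<close>; hence so are all cluster variables, and \<open>A \<subseteq> U\<close>.

  Conversely, \<open>U\<close> is generated by the frozen variables, their inverses, the \<open>x\<^sub>i\<close> and the \<open>x\<^sub>i' = f\<^sub>i/x\<^sub>i\<close>,
  which gives \<open>A = U\<close>. This goes by induction on the number of directions in which inverses are not allowed.
  Acyclicity provides a direction \<open>i\<close> with no incoming edge. If \<open>i\<close> has a neighbour \<open>j\<close>, the relation \<open>x\<^sub>i x\<^sub>i' = f\<^sub>i\<close>
  shows that \<open>x\<^sub>i\<close> and \<open>x\<^sub>j\<close> are comaximal, so it suffices to invert each of them separately. If not, \<open>f\<^sub>i\<close>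
  is linear in the frozen variable \<open>x\<^sub>n\<^sub>+\<^sub>i\<close>, which occurs in no other exchange polynomial.

  Since \<open>f\<^sub>j\<close> is linear in \<open>x\<^sub>n\<^sub>+\<^sub>j\<close>, it is prime in \<open>C\<^sub>j\<close>, whence \<open>x\<^sub>j\<close> is prime in \<open>C\<^sub>j[x\<^sub>j, f\<^sub>j/x\<^sub>j]\<close>. Imposing the
  conditions \<open>C\<^sub>j[x\<^sub>j, f\<^sub>j/x\<^sub>j]\<close> one at a time, Nagata's criterion with the prime \<open>x\<^sub>j\<close> lifts factoriality from
  the full Laurent polynomial ring to \<open>U\<close>.
\<close>

text \<open>All rings are subsets of one field: mutation compares Laurent rings in different
  variables, and inside the field they can be intersected and included without embeddings.
  Polynomials in \<open>t\<close> over \<open>A\<close> form \<open>simple_extension\<close>, whose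
  induction principle is Horner's scheme \<open>q \<otimes> t \<oplus> r\<close>; transcendence of
  \<open>t\<close> amounts to uniqueness of this form, and most proofs about polynomials are
  inductions along it. For cluster variables to stay in U, one inclusion between the upper bounds of
  neighbouring seeds suffices. Under mutation in direction i the ring of i itself does not change;
  the others are compared one direction j at a time. If b_ij = 0, the polynomial of j is unchanged,
  but the new variable brings in the polynomial of i, and a common factor of the two would destroy
  the comparison: this is where independent columns enter. If b_ij is not 0, the polynomial of j
  changes; but modulo x_j the new variable is a unit divided by the old one, and the rule of matrix
  mutation says that the new polynomial is the old one after this substitution, up to a
  unit.\<close>

lemma (in ring) subring_closed:
  assumes "subring A R"
  shows "\<And>x. x \<in> A \<Longrightarrow> x \<in> carrier R" "\<zero> \<in> A" "\<one> \<in> A"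
    and "\<And>x y. x \<in> A \<Longrightarrow> y \<in> A \<Longrightarrow> x \<otimes> y \<in> A"
    and "\<And>x y. x \<in> A \<Longrightarrow> y \<in> A \<Longrightarrow> x \<oplus> y \<in> A"
    and "\<And>x y. x \<in> A \<Longrightarrow> y \<in> A \<Longrightarrow> x \<ominus> y \<in> A"
    and "\<And>x. x \<in> A \<Longrightarrow> \<ominus> x \<in> A"
    and "\<And>x n. x \<in> A \<Longrightarrow> x [^] (n::nat) \<in> A"
proof -
  show *: "\<And>x. x \<in> A \<Longrightarrow> x \<in> carrier R" "\<zero> \<in> A" "\<one> \<in> A"
    "\<And>x y. x \<in> A \<Longrightarrow> y \<in> A \<Longrightarrow> x \<otimes> y \<in> A"
    "\<And>x y. x \<in> A \<Longrightarrow> y \<in> A \<Longrightarrow> x \<oplus> y \<in> A"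
    "\<And>x. x \<in> A \<Longrightarrow> \<ominus> x \<in> A"
    using subringE[OF assms] by auto
  show "x \<ominus> y \<in> A" if "x \<in> A" "y \<in> A" for x y
    using * that by (simp add: a_minus_def)
  show "x [^] n \<in> A" if "x \<in> A" for x and n :: nat
    using * that by (induct n) auto
qed

context field
begin

lemma inv_nonzero:
  assumes "t \<in> carrier R" "t \<noteq> \<zero>"
  shows "inv t \<in> carrier R" "t \<otimes> inv t = \<one>" "inv t \<otimes> t = \<one>" "inv t \<noteq> \<zero>" "inv (inv t) = t"
proof -
  have u: "t \<in> Units R" using assms field_Units by auto
  show "inv t \<in> carrier R" "t \<otimes> inv t = \<one>" "inv t \<otimes> t = \<one>" "inv (inv t) = t"
    using u by auto
  then show "inv t \<noteq> \<zero>" using assms by auto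
qed

lemma pow_nonzero: "t \<in> carrier R \<Longrightarrow> t \<noteq> \<zero> \<Longrightarrow> t [^] (n::nat) \<noteq> \<zero>"
  by (induct n) (auto simp: integral_iff)

lemma cancel_nonzero:
  assumes "t \<in> carrier R" "t \<noteq> \<zero>" "a \<in> carrier R" "b \<in> carrier R" "a \<otimes> t = b \<otimes> t"
  shows "a = b"
  using assms m_rcancel by blast

subsection \<open>Polynomial and Laurent polynomial subrings\<close>

abbreviation adj where "adj \<equiv> simple_extension"

text \<open>Defined by clearing denominators instead of by generators: each element comes with a
  power of \<open>t\<close> that turns it into a polynomial, to which Horner induction applies.
  \<open>laur_least\<close> recovers the generators.\<close>

definition laur :: "'a set \<Rightarrow> 'a \<Rightarrow> 'a set" where
  "laur A t = {z \<in> carrier R. \<exists>n::nat. z \<otimes> t [^] n \<in> adj A t}"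

text \<open>Since \<open>t \<noteq> \<zero>\<close>, it suffices to ask for the vanishing of the constant term of a relation: dividing
  by \<open>t\<close> and repeating gives that of all coefficients.\<close>

definition trans :: "'a set \<Rightarrow> 'a \<Rightarrow> bool" where
  "trans A t \<longleftrightarrow> t \<in> carrier R \<and> t \<noteq> \<zero> \<and>
     (\<forall>r\<in>A. \<forall>p\<in>adj A t. p \<otimes> t \<oplus> r = \<zero> \<longrightarrow> r = \<zero>)"

lemma transD: "trans A t \<Longrightarrow> t \<in> carrier R" "trans A t \<Longrightarrow> t \<noteq> \<zero>"
  "trans A t \<Longrightarrow> r \<in> A \<Longrightarrow> p \<in> adj A t \<Longrightarrow> p \<otimes> t \<oplus> r = \<zero> \<Longrightarrow> r = \<zero>"
  unfolding trans_def by auto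

lemma trans_mono: "trans B t \<Longrightarrow> A \<subseteq> B \<Longrightarrow> trans A t"
  using mono_simple_extension[of A B t] unfolding trans_def by blast

lemma adj_cases:
  assumes "subring A R" "t \<in> carrier R" "p \<in> adj A t"
  obtains q r where "q \<in> adj A t" "r \<in> A" "p = q \<otimes> t \<oplus> r"
  using assms(3)
proof (cases rule: simple_extension.cases)
  case zero
  then show ?thesis using that[of \<zero> \<zero>] assms subring_closed(2)[OF assms(1)] by auto
next
  case (lin k1 k2)
  then show ?thesis using that by auto
qed

lemma adj_subring: "subring A R \<Longrightarrow> t \<in> carrier R \<Longrightarrow> subring (adj A t) R"
  using simple_extension_is_subring by blast

lemma adj_incl: "subring A R \<Longrightarrow> t \<in> carrier R \<Longrightarrow> a \<in> A \<Longrightarrow> a \<in> adj A t"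
  using simple_extension_incl[of A t] subring_closed(1) by blast

lemma adj_mem: "subring A R \<Longrightarrow> t \<in> carrier R \<Longrightarrow> t \<in> adj A t"
  using simple_extension_mem by blast

lemma adj_lin: "subring A R \<Longrightarrow> t \<in> carrier R \<Longrightarrow> q \<in> adj A t \<Longrightarrow> q \<otimes> t \<in> adj A t"
  using adj_subring adj_mem subring_closed(4) by meson

lemma adj_least: "subring B R \<Longrightarrow> A \<subseteq> B \<Longrightarrow> t \<in> B \<Longrightarrow> adj A t \<subseteq> B"
  using simple_extension_subring_incl by blast

lemma adj_mono: "A \<subseteq> B \<Longrightarrow> adj A t \<subseteq> adj B t"
  using mono_simple_extension by blast

lemma adj_adj_commute:
  assumes "subring A R" "s \<in> carrier R" "t \<in> carrier R"
  shows "adj (adj A s) t = adj (adj A t) s"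
proof -
  have "adj (adj A s) t \<subseteq> adj (adj A t) s" if "s \<in> carrier R" "t \<in> carrier R" for s t
  proof -
    note S = adj_subring[OF adj_subring[OF assms(1) that(2)] that(1)]
    have "A \<subseteq> adj (adj A t) s" using adj_incl that assms(1) adj_subring by blast
    moreover have "s \<in> adj (adj A t) s" "t \<in> adj (adj A t) s"
      using adj_incl adj_mem that assms(1) adj_subring by blast+
    ultimately show ?thesis using adj_least[OF S] by blast
  qed
  then show ?thesis using assms by blast
qed

text \<open>The difference of both sides has constant term \<open>r \<ominus> s\<close>, which
  \<open>trans\<close> forces to vanish; what remains is a multiple of \<open>t\<close>, and
  \<open>t\<close> cancels. Comparison of coefficients always means this lemma.\<close>

lemma trans_unique:
  assumes "subring A R" "trans A t" "p \<in> adj A t" "q \<in> adj A t" "r \<in> A" "s \<in> A"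
    and "p \<otimes> t \<oplus> r = q \<otimes> t \<oplus> s"
  shows "p = q" "r = s"
proof -
  note t = transD(1,2)[OF assms(2)]
  note S = subring_closed[OF adj_subring[OF assms(1) t(1)]] and A = subring_closed[OF assms(1)]
  note c = S(1)[OF assms(3)] S(1)[OF assms(4)] A(1)[OF assms(5)] A(1)[OF assms(6)]
  have "(p \<ominus> q) \<otimes> t \<oplus> (r \<ominus> s) = (p \<otimes> t \<oplus> r) \<ominus> (q \<otimes> t \<oplus> s)"
    using c t by algebra
  also have "\<dots> = \<zero>" using assms(7) c t by algebra
  finally have e: "(p \<ominus> q) \<otimes> t \<oplus> (r \<ominus> s) = \<zero>" .
  have d: "r \<ominus> s = \<zero>"
    using transD(3)[OF assms(2) A(6) S(6) e] assms by blast
  have "(p \<ominus> q) \<otimes> t = \<zero>" using e[unfolded d] c t by simp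
  then show "p = q" using c t by (simp add: integral_iff r_right_minus_eq)
  show "r = s" using d c by (simp add: r_right_minus_eq)
qed

lemma trans_zero:
  assumes "subring A R" "trans A t" "p \<in> adj A t" "r \<in> A" "p \<otimes> t \<oplus> r = \<zero>"
  shows "p = \<zero>" "r = \<zero>"
proof -
  note t = transD(1,2)[OF assms(2)]
  have z: "\<zero> \<in> adj A t" "\<zero> \<in> A"
    using subring_closed(2)[OF adj_subring[OF assms(1) t(1)]] subring_closed(2)[OF assms(1)] by auto
  show "p = \<zero>" "r = \<zero>"
    using trans_unique[OF assms(1-3) z(1) assms(4) z(2)] assms(5) t(1) by auto
qed

lemma laurI: "z \<in> carrier R \<Longrightarrow> z \<otimes> t [^] (n::nat) \<in> adj A t \<Longrightarrow> z \<in> laur A t"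
  unfolding laur_def by auto

lemma adj_pow_raise:
  assumes "subring A R" "t \<in> carrier R" "z \<in> carrier R" "z \<otimes> t [^] (n::nat) \<in> adj A t" "n \<le> m"
  shows "z \<otimes> t [^] m \<in> adj A t"
proof -
  obtain k where m: "m = n + k" using assms(5) le_Suc_ex by blast
  have "z \<otimes> t [^] m = (z \<otimes> t [^] n) \<otimes> t [^] k"
    using assms by (simp add: m nat_pow_mult[symmetric] m_assoc)
  then show ?thesis
    using assms subring_closed[OF adj_subring[OF assms(1,2)]] adj_mem by metis
qed

lemma laur_subring:
  assumes "subring A R" "t \<in> carrier R"
  shows "subring (laur A t) R"
proof (rule subringI)
  note S = subring_closed[OF adj_subring[OF assms]]
  show "laur A t \<subseteq> carrier R" unfolding laur_def by auto
  show "\<one> \<in> laur A t" using S assms by (intro laurI[of _ _ 0]) auto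
  show "\<ominus> h \<in> laur A t" if h: "h \<in> laur A t" for h
  proof -
    obtain n :: nat where "h \<in> carrier R" "h \<otimes> t [^] n \<in> adj A t" using h unfolding laur_def by auto
    then show ?thesis using S assms by (intro laurI[of _ _ n]) (auto simp: l_minus)
  qed
  fix h g assume h: "h \<in> laur A t" and g: "g \<in> laur A t"
  obtain n :: nat where n: "h \<in> carrier R" "h \<otimes> t [^] n \<in> adj A t" using h unfolding laur_def by auto
  obtain m :: nat where m: "g \<in> carrier R" "g \<otimes> t [^] m \<in> adj A t" using g unfolding laur_def by auto
  have "(h \<otimes> g) \<otimes> t [^] (n + m) = (h \<otimes> t [^] n) \<otimes> (g \<otimes> t [^] m)"
    using n m assms by (simp add: nat_pow_mult[symmetric] m_ac)
  then show "h \<otimes> g \<in> laur A t" using n m S by (intro laurI[of _ _ "n + m"]) auto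
  have "h \<otimes> t [^] (n + m) \<in> adj A t" "g \<otimes> t [^] (n + m) \<in> adj A t"
    using adj_pow_raise assms n m by auto
  then show "h \<oplus> g \<in> laur A t" using n m S assms
    by (intro laurI[of _ _ "n + m"]) (auto simp: l_distr)
qed

lemma adj_in_laur: "subring A R \<Longrightarrow> t \<in> carrier R \<Longrightarrow> adj A t \<subseteq> laur A t"
  using subring_closed(1)[OF adj_subring] by (auto intro!: laurI[of _ _ 0])

lemma laur_mem:
  assumes "subring A R" "t \<in> carrier R" "t \<noteq> \<zero>"
  shows "t \<in> laur A t" "inv t \<in> laur A t" "A \<subseteq> laur A t"
proof -
  show "t \<in> laur A t" using adj_in_laur assms adj_mem by blast
  show "A \<subseteq> laur A t" using adj_in_laur assms adj_incl by blast
  show "inv t \<in> laur A t" using inv_nonzero assms subring_closed(3)[OF adj_subring]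
    by (intro laurI[of _ _ 1]) auto
qed

lemma inv_pow:
  assumes "t \<in> carrier R" "t \<noteq> \<zero>"
  shows "t [^] (n::nat) \<otimes> inv t [^] n = \<one>"
  using inv_nonzero[OF assms] assms nat_pow_distrib[of t "inv t" n] nat_pow_one by simp

lemma laur_least:
  assumes "subring B R" "A \<subseteq> B" "t \<in> B" "inv t \<in> B" "t \<noteq> \<zero>"
  shows "laur A t \<subseteq> B"
proof
  fix z assume "z \<in> laur A t"
  then obtain n :: nat where z: "z \<in> carrier R" "z \<otimes> t [^] n \<in> adj A t" unfolding laur_def by auto
  have t: "t \<in> carrier R" using assms subring_closed by blast
  have "z = (z \<otimes> t [^] n) \<otimes> inv t [^] n"
    using z inv_nonzero[OF t assms(5)] inv_pow[OF t assms(5)] t by (simp add: m_assoc)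
  moreover have "z \<otimes> t [^] n \<in> B" using z adj_least[OF assms(1-3)] by auto
  ultimately show "z \<in> B" using subring_closed[OF assms(1)] assms by metis
qed

lemma laur_mono: "A \<subseteq> B \<Longrightarrow> laur A t \<subseteq> laur B t"
  using adj_mono unfolding laur_def by blast

lemma laur_carrier: "z \<in> laur A t \<Longrightarrow> z \<in> carrier R"
  unfolding laur_def by auto

lemma laurE:
  assumes "z \<in> laur A t"
  obtains n :: nat where "z \<in> carrier R" "z \<otimes> t [^] n \<in> adj A t"
  using assms unfolding laur_def by auto

subsection \<open>The rings \<open>A[t, f/t]\<close>\<close>

definition exring :: "'a set \<Rightarrow> 'a \<Rightarrow> 'a \<Rightarrow> 'a set" where
  "exring A t f = adj (adj A t) (f \<otimes> inv t)"

text \<open>\<open>gd A t f n\<close> consists of the \<open>\<Sum> c\<^sub>i t\<^sup>i\<close> with \<open>f\<^bsup>n - i\<^esup>\<close> dividing \<open>c\<^sub>i\<close> for \<open>i < n\<close>; these are the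
  elements \<open>z t\<^sup>n\<close> with \<open>z \<in> A[t, f/t]\<close> that are polynomials in \<open>t\<close>.\<close>

fun gd :: "'a set \<Rightarrow> 'a \<Rightarrow> 'a \<Rightarrow> nat \<Rightarrow> 'a set" where
  "gd A t f 0 = adj A t"
| "gd A t f (Suc n) = {w \<otimes> t \<oplus> f [^] Suc n \<otimes> g | w g. w \<in> gd A t f n \<and> g \<in> A}"

lemma exring_subring:
  assumes "subring A R" "t \<in> carrier R" "t \<noteq> \<zero>" "f \<in> A"
  shows "subring (exring A t f) R"
  unfolding exring_def using assms inv_nonzero adj_subring subring_closed(1) by simp

lemma exring_mem:
  assumes "subring A R" "t \<in> carrier R" "t \<noteq> \<zero>" "f \<in> A"
  shows "adj A t \<subseteq> exring A t f" "A \<subseteq> exring A t f" "t \<in> exring A t f" "f \<otimes> inv t \<in> exring A t f"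
proof -
  have c: "f \<otimes> inv t \<in> carrier R" using assms inv_nonzero subring_closed(1) by simp
  note S = adj_subring[OF assms(1,2)]
  show *: "adj A t \<subseteq> exring A t f" unfolding exring_def using adj_incl[OF S c] by blast
  show "f \<otimes> inv t \<in> exring A t f" unfolding exring_def using adj_mem[OF S c] by blast
  show "A \<subseteq> exring A t f" "t \<in> exring A t f"
    using * adj_mem[OF assms(1,2)] adj_incl[OF assms(1,2)] by blast+
qed

lemma exring_least:
  assumes "subring B R" "A \<subseteq> B" "t \<in> B" "f \<otimes> inv t \<in> B"
  shows "exring A t f \<subseteq> B"
  unfolding exring_def using adj_least[OF assms(1) _ assms(4)] adj_least[OF assms(1-3)] by blast

lemma inv_quot:
  assumes "f \<in> carrier R" "f \<noteq> \<zero>" "t \<in> carrier R" "t \<noteq> \<zero>"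
  shows "f \<otimes> inv t \<in> carrier R" "f \<otimes> inv t \<noteq> \<zero>" "f \<otimes> inv (f \<otimes> inv t) = t" "f \<otimes> inv t \<otimes> t = f"
proof -
  note i = inv_nonzero[OF assms(3,4)]
  show u: "f \<otimes> inv t \<in> carrier R" "f \<otimes> inv t \<noteq> \<zero>" using i assms by (auto simp: integral_iff)
  show ft: "f \<otimes> inv t \<otimes> t = f" using i assms by (simp add: m_assoc)
  note j = inv_nonzero[OF u]
  have "f \<otimes> inv (f \<otimes> inv t) = (f \<otimes> inv t \<otimes> t) \<otimes> inv (f \<otimes> inv t)" using ft by simp
  also have "\<dots> = t \<otimes> ((f \<otimes> inv t) \<otimes> inv (f \<otimes> inv t))" using u j(1) assms(3) by algebra
  also have "\<dots> = t" using j assms by simp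
  finally show "f \<otimes> inv (f \<otimes> inv t) = t" .
qed

text \<open>Dividing \<open>f\<close> by \<open>f/t\<close> returns \<open>t\<close>, so both
  generators play the same role. Mutation in the direction of \<open>t\<close> therefore leaves the
  ring unchanged.\<close>

lemma exring_swap:
  assumes "subring A R" "t \<in> carrier R" "t \<noteq> \<zero>" "f \<in> A" "f \<noteq> \<zero>"
  shows "exring A (f \<otimes> inv t) f = exring A t f"
proof -
  have f: "f \<in> carrier R" using assms subring_closed by blast
  note u = inv_quot[OF f assms(5,2,3)]
  show ?thesis unfolding exring_def u(3) using adj_adj_commute assms u by blast
qed

text \<open>Allows exchange polynomials to be normalized to 1 plus a Laurent monomial.\<close>

lemma exring_unit:
  assumes "subring A R" "t \<in> carrier R" "t \<noteq> \<zero>" "f \<in> A" "v \<in> A" "w \<in> A" "v \<otimes> w = \<one>"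
  shows "exring A t (v \<otimes> f) = exring A t f"
proof -
  have *: "exring A t (v \<otimes> f) \<subseteq> exring A t f" if "v \<in> A" "f \<in> A" for v f
  proof (rule exring_least[OF exring_subring])
    note m = exring_mem[OF assms(1-3) that(2)] and S = subring_closed[OF exring_subring[OF assms(1-3) that(2)]]
    have c: "v \<in> carrier R" "f \<in> carrier R" using that subring_closed assms by blast+
    show "v \<otimes> f \<otimes> inv t \<in> exring A t f"
      using m that S(4)[of v "f \<otimes> inv t"] c inv_nonzero(1)[OF assms(2,3)] m_assoc by auto
    show "A \<subseteq> exring A t f" "t \<in> exring A t f" using m by auto
  qed (use assms that in auto)
  have c: "v \<in> carrier R" "w \<in> carrier R" "f \<in> carrier R" using assms subring_closed by blast+
  have "w \<otimes> (v \<otimes> f) = f" using assms(7) c by algebra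
  then show ?thesis using *[OF assms(5,4)] *[OF assms(6), of "v \<otimes> f"] assms subring_closed(4) by auto
qed

lemma gd_subset:
  assumes "subring A R" "t \<in> carrier R" "f \<in> A"
  shows "gd A t f n \<subseteq> adj A t"
proof (induct n)
  case (Suc n)
  show ?case
  proof
    fix x assume "x \<in> gd A t f (Suc n)"
    then obtain w g where x: "x = w \<otimes> t \<oplus> f [^] Suc n \<otimes> g" "w \<in> gd A t f n" "g \<in> A" by auto
    have "f [^] Suc n \<otimes> g \<in> A"
      using x(3) assms subring_closed(4)[OF assms(1)] subring_closed(8)[OF assms(1)] by blast
    then show "x \<in> adj A t"
      using simple_extension.lin[of w A t] x Suc by auto
  qed
qed simp

lemma gd_add:
  assumes "subring A R" "t \<in> carrier R" "f \<in> A"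
  shows "a \<in> gd A t f n \<Longrightarrow> b \<in> gd A t f n \<Longrightarrow> a \<oplus> b \<in> gd A t f n"
proof (induct n arbitrary: a b)
  case 0
  then show ?case using subring_closed[OF adj_subring[OF assms(1,2)]] by auto
next
  case (Suc n)
  obtain w g where a: "a = w \<otimes> t \<oplus> f [^] Suc n \<otimes> g" "w \<in> gd A t f n" "g \<in> A" using Suc by auto
  obtain v h where b: "b = v \<otimes> t \<oplus> f [^] Suc n \<otimes> h" "v \<in> gd A t f n" "h \<in> A" using Suc by auto
  have c: "w \<in> carrier R" "v \<in> carrier R" "g \<in> carrier R" "h \<in> carrier R" "f [^] Suc n \<in> carrier R"
    using a b gd_subset[OF assms] subring_closed(1)[OF adj_subring[OF assms(1,2)]]
      subring_closed(1)[OF assms(1)] assms by blast+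
  have "a \<oplus> b = (w \<oplus> v) \<otimes> t \<oplus> f [^] Suc n \<otimes> (g \<oplus> h)"
    unfolding a(1) b(1) using c assms(2) by algebra
  then show ?case using Suc(1)[OF a(2) b(2)] subring_closed(5)[OF assms(1) a(3) b(3)] by auto
qed

lemma gd_raise:
  assumes "subring A R" "t \<in> carrier R" "f \<in> A" "a \<in> gd A t f n"
  shows "a \<otimes> t \<in> gd A t f (Suc n)"
proof -
  have "a \<in> carrier R" "f \<in> carrier R"
    using assms gd_subset[OF assms(1-3)] subring_closed(1)[OF adj_subring[OF assms(1,2)]]
      subring_closed(1)[OF assms(1)] by blast+
  then have "a \<otimes> t = a \<otimes> t \<oplus> f [^] Suc n \<otimes> \<zero>" using assms by simp
  then show ?thesis using assms(4) subring_closed(2)[OF assms(1)] by auto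
qed

text \<open>Multiplication by \<open>f\<close> raises every required power of \<open>f\<close> by
  one and supplies the first factor for the coefficient of degree \<open>n\<close>, which was free
  before.\<close>

lemma gd_mult:
  assumes "subring A R" "t \<in> carrier R" "f \<in> A"
  shows "a \<in> gd A t f n \<Longrightarrow> f \<otimes> a \<in> gd A t f (Suc n)"
proof (induct n arbitrary: a)
  case 0
  then obtain q r where a: "q \<in> adj A t" "r \<in> A" "a = q \<otimes> t \<oplus> r"
    using adj_cases[OF assms(1,2)] by auto
  have c: "q \<in> carrier R" "r \<in> carrier R" "f \<in> carrier R"
    using a subring_closed(1)[OF adj_subring[OF assms(1,2)]] subring_closed(1)[OF assms(1)] assms by blast+
  have "f \<otimes> a = (f \<otimes> q) \<otimes> t \<oplus> f [^] Suc 0 \<otimes> r"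
    unfolding a(3) using c assms(2) by (simp add: r_distr m_assoc)
  moreover have "f \<otimes> q \<in> gd A t f 0"
    using a(1) assms adj_incl[OF assms] subring_closed(4)[OF adj_subring[OF assms(1,2)]] by auto
  ultimately show ?case using a(2) unfolding gd.simps(2) by blast
next
  case (Suc n)
  obtain w g where a: "a = w \<otimes> t \<oplus> f [^] Suc n \<otimes> g" "w \<in> gd A t f n" "g \<in> A" using Suc by auto
  have c: "w \<in> carrier R" "g \<in> carrier R" "f \<in> carrier R"
    using a gd_subset[OF assms] subring_closed(1)[OF adj_subring[OF assms(1,2)]]
      subring_closed(1)[OF assms(1)] assms by blast+
  have "f \<otimes> a = (f \<otimes> w) \<otimes> t \<oplus> (f \<otimes> f [^] Suc n) \<otimes> g"
    unfolding a(1) using c assms(2) nat_pow_closed[OF c(3), of "Suc n"] by algebra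
  also have "f \<otimes> f [^] Suc n = f [^] Suc (Suc n)" using c by (simp add: m_ac)
  finally show ?case using Suc(1)[OF a(2)] a(3) by (subst gd.simps(2)) blast
qed

lemma gd_pow:
  assumes "subring A R" "t \<in> carrier R" "f \<in> A" "a \<in> adj A t"
  shows "a \<otimes> t [^] n \<in> gd A t f n"
proof (induct n)
  case 0
  then show ?case using assms subring_closed(1)[OF adj_subring[OF assms(1,2)]] by simp
next
  case (Suc n)
  have "a \<in> carrier R" using assms subring_closed(1)[OF adj_subring[OF assms(1,2)]] by simp
  then have "a \<otimes> t [^] Suc n = (a \<otimes> t [^] n) \<otimes> t" using assms by (simp add: m_assoc)
  then show ?case using gd_raise[OF assms(1-3) Suc] by simp
qed

lemma exring_gd:
  assumes "subring A R" "t \<in> carrier R" "t \<noteq> \<zero>" "f \<in> A" "z \<in> exring A t f"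
  shows "\<exists>n. z \<otimes> t [^] n \<in> gd A t f n"
  using assms(5) unfolding exring_def
proof (induct rule: simple_extension.induct)
  case zero
  show ?case using subring_closed(2)[OF adj_subring[OF assms(1,2)]] by (intro exI[of _ 0]) simp
next
  case (lin k1 k2)
  then obtain n where n: "k1 \<otimes> t [^] n \<in> gd A t f n" by auto
  have f: "f \<in> carrier R" using assms subring_closed by blast
  note i = inv_nonzero[OF assms(2,3)]
  have u: "f \<otimes> inv t \<in> carrier R" using f i by simp
  have "subring (adj (adj A t) (f \<otimes> inv t)) R" using adj_subring assms(1,2) u by blast
  then have c: "k1 \<in> carrier R" "k2 \<in> carrier R"
    using lin subring_closed(1) adj_subring[OF assms(1,2)] by blast+
  have "(k1 \<otimes> (f \<otimes> inv t) \<oplus> k2) \<otimes> (t [^] n \<otimes> t) = f \<otimes> (k1 \<otimes> t [^] n) \<otimes> (inv t \<otimes> t) \<oplus> k2 \<otimes> (t [^] n \<otimes> t)"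
    using c f i(1) assms(2) nat_pow_closed[OF assms(2), of n] by algebra
  also have "\<dots> = f \<otimes> (k1 \<otimes> t [^] n) \<oplus> k2 \<otimes> t [^] Suc n" using c f i assms by simp
  also have "\<dots> \<in> gd A t f (Suc n)"
    using gd_add gd_mult[OF assms(1,2,4) n] gd_pow lin(3) assms by blast
  finally show ?case by (intro exI[of _ "Suc n"]) simp
qed

text \<open>\<open>exring_gd\<close> yields the divisibility for some exponent only. Raising the
  exponent is multiplication by \<open>t\<close>; lowering it is division by \<open>t\<close>,
  harmless as long as the quotient is a polynomial, by uniqueness of the Horner form.\<close>

lemma exring_gd_exact:
  assumes "subring A R" "trans A t" "f \<in> A" "z \<in> exring A t f" "z \<otimes> t [^] n \<in> adj A t"
  shows "z \<otimes> t [^] n \<in> gd A t f n"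
proof -
  note t = transD(1,2)[OF assms(2)]
  have z: "z \<in> carrier R" using exring_subring[OF assms(1) t assms(3)] assms(4) subring_closed by blast
  obtain m where m: "z \<otimes> t [^] m \<in> gd A t f m" using exring_gd assms t by blast
  have step: "z \<otimes> t [^] Suc k = (z \<otimes> t [^] k) \<otimes> t" for k using z t by (simp add: m_assoc)
  have up: "z \<otimes> t [^] (m + k) \<in> gd A t f (m + k)" for k
    by (induct k) (use m gd_raise[OF assms(1) t(1) assms(3)] step in \<open>auto simp del: gd.simps nat_pow_Suc\<close>)
  have down: "z \<otimes> t [^] k \<in> gd A t f k" if zk: "z \<otimes> t [^] Suc k \<in> gd A t f (Suc k)" "n \<le> k" for k
  proof -
    obtain w g where w: "z \<otimes> t [^] Suc k = w \<otimes> t \<oplus> f [^] Suc k \<otimes> g" "w \<in> gd A t f k" "g \<in> A"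
      using zk(1) unfolding gd.simps(2) by blast
    have 1: "z \<otimes> t [^] k \<in> adj A t" using adj_pow_raise assms(1,5) t z zk(2) by blast
    have 2: "w \<in> adj A t" using w gd_subset assms t by blast
    have 3: "f [^] Suc k \<otimes> g \<in> A" by (rule subring_closed(4)[OF assms(1) subring_closed(8)[OF assms(1,3)] w(3)])
    have "(z \<otimes> t [^] k) \<otimes> t \<oplus> \<zero> = w \<otimes> t \<oplus> f [^] Suc k \<otimes> g"
      unfolding w(1)[symmetric] step using z t by (intro r_zero) auto
    from trans_unique(1)[OF assms(1,2) 1 2 subring_closed(2)[OF assms(1)] 3 this]
    show ?thesis using w(2) by simp
  qed
  have lower: "n \<le> k \<Longrightarrow> z \<otimes> t [^] k \<in> gd A t f k \<Longrightarrow> z \<otimes> t [^] n \<in> gd A t f n" for k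
  proof (induct k)
    case (Suc k)
    then show ?case using down[of k] le_Suc_eq by metis
  qed simp
  show ?thesis using up[of "n - m"] lower[OF _ m] by (cases "m \<le> n") simp_all
qed

text \<open>A pole of order \<open>n\<close> at \<open>t\<close> has to be paid for by a factor
  \<open>f^n\<close> in the lowest coefficient, the constant term of an element of
  \<open>gd\<close>. This is how membership in \<open>A[t, f/t]\<close> is exploited.\<close>

lemma exring_const:
  assumes "subring A R" "trans A t" "f \<in> A" "z \<in> exring A t f" "z \<otimes> t [^] (n::nat) = q \<otimes> t \<oplus> r"
    and "q \<in> adj A t" "r \<in> A"
  shows "\<exists>g\<in>A. r = f [^] n \<otimes> g"
proof (cases n)
  case 0
  have "r = f [^] n \<otimes> r" using 0 subring_closed(1)[OF assms(1,7)] by simp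
  then show ?thesis using assms(7) by blast
next
  case (Suc k)
  have "z \<otimes> t [^] n \<in> gd A t f n"
    using exring_gd_exact[OF assms(1-4)] assms simple_extension.lin by metis
  then obtain w g where w: "z \<otimes> t [^] n = w \<otimes> t \<oplus> f [^] n \<otimes> g" "w \<in> gd A t f k" "g \<in> A"
    unfolding Suc by auto
  have 2: "w \<in> adj A t" using w gd_subset assms transD(1) by blast
  have 3: "f [^] n \<otimes> g \<in> A" by (rule subring_closed(4)[OF assms(1) subring_closed(8)[OF assms(1,3)] w(3)])
  have "r = f [^] n \<otimes> g"
    using trans_unique(2)[OF assms(1,2,6) 2 assms(7) 3] assms(5) w(1) by simp
  then show ?thesis using w by blast
qed

text \<open>Induction on the pole order at \<open>q\<close>. The lowest coefficient is
  \<open>f^n g\<close> with \<open>g\<close> in \<open>A\<close>, and \<open>div\<close> puts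
  \<open>g\<close> into the smaller ring \<open>S\<close>; subtracting \<open>g (f/q)^n\<close>,
  which lies in both rings, lowers the pole order.\<close>

lemma exring_restrict:
  assumes "subring S R" "subring A R" "S \<subseteq> A" "trans A q" "f \<in> S"
    and div: "\<And>n g. g \<in> A \<Longrightarrow> f [^] (n::nat) \<otimes> g \<in> S \<Longrightarrow> g \<in> S"
  shows "z \<in> exring A q f \<Longrightarrow> z \<otimes> q [^] (n::nat) \<in> adj S q \<Longrightarrow> z \<in> exring S q f"
proof (induct n arbitrary: z)
  case 0
  note q = transD(1,2)[OF assms(4)]
  have "z \<in> carrier R" using exring_subring[OF assms(2) q] assms 0(1) subring_closed by blast
  then show ?case using 0 exring_mem(1)[OF assms(1) q assms(5)] by auto
next
  case (Suc n)
  note q = transD(1,2)[OF assms(4)]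
  have fA: "f \<in> A" using assms by blast
  note D = exring_subring[OF assms(2) q fA] exring_subring[OF assms(1) q assms(5)]
  note SD = subring_closed[OF D(1)]
  have z: "z \<in> carrier R" using SD Suc by blast
  obtain w c where w: "w \<in> adj S q" "c \<in> S" "z \<otimes> q [^] Suc n = w \<otimes> q \<oplus> c"
    using adj_cases[OF assms(1) q(1) Suc(3)] by blast
  then obtain g where g: "g \<in> A" "c = f [^] Suc n \<otimes> g"
    using exring_const[OF assms(2,4) fA Suc(2)] adj_mono[OF assms(3)] assms(3) by blast
  then have gS: "g \<in> S" using div w by blast
  define u where "u = f \<otimes> inv q"
  have f: "f \<in> carrier R" and c: "g \<in> carrier R" "w \<in> carrier R"
    using subring_closed(1)[OF assms(2)] fA g(1) subring_closed(1)[OF adj_subring[OF assms(1) q(1)]] w(1)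
    by blast+
  have u: "u \<in> carrier R" "u \<otimes> q = f" unfolding u_def using inv_nonzero[OF q] f q by (auto simp: m_assoc)
  have uD: "u \<in> exring A q f" "u \<in> exring S q f" unfolding u_def
    using exring_mem(4) assms q fA by blast+
  define z1 where "z1 = z \<ominus> g \<otimes> u [^] Suc n"
  have gD: "g \<in> exring A q f" "g \<in> exring S q f" using exring_mem(2) g gS assms q fA by blast+
  have z1D: "z1 \<in> exring A q f" unfolding z1_def using SD(6)[OF Suc(2) SD(4)[OF gD(1) SD(8)[OF uD(1)]]] .
  have z1: "z1 \<in> carrier R" using SD z1D by blast
  have p: "u [^] Suc n \<otimes> q [^] Suc n = f [^] Suc n"
    using nat_pow_distrib[OF u(1) q(1)] u by metis
  have pc: "u [^] Suc n \<in> carrier R" "q [^] Suc n \<in> carrier R" using u q by auto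
  have "z1 \<otimes> q [^] Suc n = z \<otimes> q [^] Suc n \<ominus> g \<otimes> (u [^] Suc n \<otimes> q [^] Suc n)"
    unfolding z1_def using z c pc by algebra
  also have "\<dots> = w \<otimes> q \<oplus> f [^] Suc n \<otimes> g \<ominus> g \<otimes> f [^] Suc n" using w g p by simp
  also have "\<dots> = w \<otimes> q" using c q nat_pow_closed[OF f, of "Suc n"] by algebra
  finally have "(z1 \<otimes> q [^] n) \<otimes> q = w \<otimes> q" using z1 q by (simp add: m_assoc)
  then have "z1 \<otimes> q [^] n = w" using cancel_nonzero[OF q] z1 q c by auto
  then have z1S: "z1 \<in> exring S q f" using Suc(1)[OF z1D] w by simp
  have "z = z1 \<oplus> g \<otimes> u [^] Suc n" unfolding z1_def using z c pc by algebra
  then show ?case using z1S gD uD subring_closed[OF D(2)] by metis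
qed

subsection \<open>Unique factorization\<close>

text \<open>Divisibility inside a subring of the field; in particular \<open>dv A u \<one>\<close>
  says that \<open>u\<close> is a unit of \<open>A\<close>.\<close>

definition dv :: "'a set \<Rightarrow> 'a \<Rightarrow> 'a \<Rightarrow> bool" where
  "dv A a b \<longleftrightarrow> (\<exists>c\<in>A. b = a \<otimes> c)"

definition prm :: "'a set \<Rightarrow> 'a \<Rightarrow> bool" where
  "prm A p \<longleftrightarrow> p \<in> A \<and> p \<noteq> \<zero> \<and> \<not> dv A p \<one> \<and>
     (\<forall>a\<in>A. \<forall>b\<in>A. dv A p (a \<otimes> b) \<longrightarrow> dv A p a \<or> dv A p b)"

abbreviation prd :: "'a list \<Rightarrow> 'a" where
  "prd xs \<equiv> foldr (\<otimes>) xs \<one>"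

text \<open>With primes in place of irreducibles, existence of factorizations entails their
  uniqueness; see \<open>ufd_imp_factorial\<close>.\<close>

definition ufd :: "'a set \<Rightarrow> bool" where
  "ufd A \<longleftrightarrow> subring A R \<and>
     (\<forall>a\<in>A. a \<noteq> \<zero> \<longrightarrow> (\<exists>u ps. u \<in> A \<and> dv A u \<one> \<and> (\<forall>p\<in>set ps. prm A p) \<and> a = u \<otimes> prd ps))"

lemma prmD:
  assumes "prm A p"
  shows "p \<in> A" "p \<noteq> \<zero>" "\<not> dv A p \<one>"
    and "\<And>a b. a \<in> A \<Longrightarrow> b \<in> A \<Longrightarrow> dv A p (a \<otimes> b) \<Longrightarrow> dv A p a \<or> dv A p b"
  using assms unfolding prm_def by auto

lemma dvI: "c \<in> A \<Longrightarrow> b = a \<otimes> c \<Longrightarrow> dv A a b"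
  unfolding dv_def by blast

lemma dv_mult:
  assumes "subring A R" "a \<in> A" "b \<in> A" "c \<in> A" "dv A a b"
  shows "dv A a (b \<otimes> c)" "dv A a (c \<otimes> b)"
proof -
  obtain d where d: "d \<in> A" "b = a \<otimes> d" using assms(5) unfolding dv_def by auto
  have c: "a \<in> carrier R" "d \<in> carrier R" "c \<in> carrier R"
    using assms(2,4) d subring_closed(1)[OF assms(1)] by auto
  have 1: "b \<otimes> c = a \<otimes> (d \<otimes> c)" using d c by (simp add: m_assoc)
  then show "dv A a (b \<otimes> c)" using subring_closed(4)[OF assms(1) d(1) assms(4)] dvI by blast
  moreover have "c \<otimes> b = b \<otimes> c" using c d by (simp add: m_comm)
  ultimately show "dv A a (c \<otimes> b)" by simp
qed

lemma dv_trans: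
  assumes "subring A R" "a \<in> A" "dv A a b" "dv A b c"
  shows "dv A a c"
proof -
  obtain d where d: "d \<in> A" "b = a \<otimes> d" using assms(3) unfolding dv_def by auto
  obtain e where e: "e \<in> A" "c = b \<otimes> e" using assms(4) unfolding dv_def by auto
  have "c = a \<otimes> (d \<otimes> e)" using d e subring_closed(1)[OF assms(1)] assms(2) by (simp add: m_assoc)
  then show ?thesis using subring_closed(4)[OF assms(1) d(1) e(1)] dvI by blast
qed

lemma prd_closed: "subring A R \<Longrightarrow> set xs \<subseteq> A \<Longrightarrow> prd xs \<in> A"
  by (induct xs) (auto simp: subring_closed)

lemma prd_append: "set xs \<subseteq> carrier R \<Longrightarrow> set ys \<subseteq> carrier R \<Longrightarrow> prd (xs @ ys) = prd xs \<otimes> prd ys"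
proof (induct xs)
  case Nil
  then show ?case using prd_closed[OF carrier_is_subring] by simp
next
  case (Cons a xs)
  then show ?case using prd_closed[OF carrier_is_subring] by (simp add: m_assoc)
qed

lemma prm_dv_prd:
  assumes "subring A R" "prm A p" "dv A p (prd ps)" "set ps \<subseteq> A"
  shows "\<exists>q\<in>set ps. dv A p q"
  using assms(3,4)
proof (induct ps)
  case Nil
  then show ?case using prmD(3)[OF assms(2)] by simp
next
  case (Cons a ps)
  then have "dv A p a \<or> dv A p (prd ps)"
    using prmD(4)[OF assms(2), of a "prd ps"] prd_closed[OF assms(1), of ps] by auto
  then show ?case using Cons by auto
qed

lemma unit_mult:
  assumes "subring A R" "u \<in> A" "v \<in> A" "dv A u \<one>" "dv A v \<one>"
  shows "dv A (u \<otimes> v) \<one>"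
proof -
  obtain d where d: "d \<in> A" "\<one> = u \<otimes> d" using assms(4) unfolding dv_def by auto
  obtain e where e: "e \<in> A" "\<one> = v \<otimes> e" using assms(5) unfolding dv_def by auto
  have c: "u \<in> carrier R" "v \<in> carrier R" "d \<in> carrier R" "e \<in> carrier R"
    using assms d e subring_closed(1)[OF assms(1)] by auto
  have "(u \<otimes> v) \<otimes> (d \<otimes> e) = (u \<otimes> d) \<otimes> (v \<otimes> e)" using c by (simp add: m_ac)
  also have "\<dots> = \<one>" using d(2)[symmetric] e(2)[symmetric] by simp
  finally show ?thesis using subring_closed(4)[OF assms(1) d(1) e(1)] dvI by metis
qed

lemma unit_cancel_dv:
  assumes "subring A R" "u \<in> A" "dv A u \<one>" "p \<in> A" "a \<in> carrier R" "dv A p (u \<otimes> a)"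
  shows "dv A p a"
proof -
  obtain d where d: "d \<in> A" "\<one> = u \<otimes> d" using assms(3) unfolding dv_def by auto
  obtain e where e: "e \<in> A" "u \<otimes> a = p \<otimes> e" using assms(6) unfolding dv_def by auto
  have c: "u \<in> carrier R" "p \<in> carrier R" "d \<in> carrier R" "e \<in> carrier R"
    using assms d e subring_closed(1)[OF assms(1)] by auto
  have "a = (u \<otimes> d) \<otimes> a" using d(2)[symmetric] assms(5) by simp
  also have "\<dots> = d \<otimes> (u \<otimes> a)" using c assms(5) by (simp add: m_ac)
  also have "\<dots> = p \<otimes> (d \<otimes> e)" unfolding e(2) using c by (simp add: m_ac)
  finally show ?thesis using subring_closed(4)[OF assms(1) d(1) e(1)] dvI by blast
qed

lemma prm_assoc:
  assumes "subring A R" "prm A p" "u \<in> A" "dv A u \<one>"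
  shows "prm A (u \<otimes> p)"
proof -
  obtain d where d: "d \<in> A" "\<one> = u \<otimes> d" using assms(4) unfolding dv_def by auto
  have c: "u \<in> carrier R" "p \<in> carrier R" "d \<in> carrier R"
    using assms(3) d prmD(1)[OF assms(2)] subring_closed(1)[OF assms(1)] by auto
  have "(u \<otimes> p) \<otimes> d = (u \<otimes> d) \<otimes> p" using c by (simp add: m_ac)
  then have p: "p = (u \<otimes> p) \<otimes> d" using d(2)[symmetric] c by simp
  have up: "u \<otimes> p \<in> A" using subring_closed(4)[OF assms(1,3)] prmD(1)[OF assms(2)] .
  have eq: "dv A (u \<otimes> p) a \<longleftrightarrow> dv A p a" for a
  proof
    assume "dv A (u \<otimes> p) a"
    then show "dv A p a"
      using dv_trans[OF assms(1) prmD(1)[OF assms(2)] dvI[OF assms(3), of "u \<otimes> p" p]] c by (simp add: m_comm)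
  next
    assume "dv A p a"
    then show "dv A (u \<otimes> p) a" using dv_trans[OF assms(1) up dvI[OF d(1) p]] by blast
  qed
  have "u \<otimes> p \<noteq> \<zero>" using p prmD(2)[OF assms(2)] c by auto
  then show ?thesis using up assms(2) unfolding prm_def eq by blast
qed

text \<open>The first prime \<open>s\<close> of \<open>ss\<close> divides some \<open>p\<close> in
  \<open>ps\<close>, and the two are associated; cancelling them leaves a shorter instance with
  another unit in place of \<open>u\<close>. The bound feeds the finiteness condition of Nagata's
  criterion.\<close>

lemma prd_length_bound:
  assumes "subring A R"
  shows "\<lbrakk>\<forall>s\<in>set ss. prm A s; \<forall>p\<in>set ps. prm A p; u \<in> A; dv A u \<one>; dv A (prd ss) (u \<otimes> prd ps)\<rbrakk>
    \<Longrightarrow> length ss \<le> length ps"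
proof (induct ss arbitrary: ps u)
  case (Cons s ss)
  have s: "prm A s" and sA: "s \<in> A" "s \<in> carrier R"
    using Cons(2) prmD(1) subring_closed(1)[OF assms] by auto
  have ss: "prd ss \<in> A" using Cons(2) prmD(1) by (intro prd_closed[OF assms]) auto
  have psA: "set ps \<subseteq> A" using Cons(3) prmD(1) by auto
  have u: "u \<in> carrier R" using Cons(4) subring_closed(1)[OF assms] by auto
  have psc: "prd ps \<in> A" "prd ps \<in> carrier R"
    using prd_closed[OF assms psA] subring_closed(1)[OF assms] by auto
  have "dv A s (prd (s # ss))" using ss dvI by auto
  then have "dv A s (u \<otimes> prd ps)" using dv_trans[OF assms sA(1)] Cons(6) by blast
  then have "dv A s (prd ps)" using unit_cancel_dv[OF assms Cons(4,5) sA(1) psc(2)] by blast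
  then obtain p where p: "p \<in> set ps" "dv A s p" using prm_dv_prd[OF assms s _ psA] by blast
  have pA: "prm A p" "p \<in> A" "p \<in> carrier R"
    using Cons(3) p prmD(1) subring_closed(1)[OF assms] by auto
  obtain v where v: "v \<in> A" "p = s \<otimes> v" using p unfolding dv_def by auto
  have vc: "v \<in> carrier R" using v subring_closed(1)[OF assms] by auto
  have "dv A p (s \<otimes> v)" using v(2) pA(3) subring_closed(3)[OF assms] by (intro dvI[of \<one>]) auto
  \<comment> \<open>Since \<open>p = s \<otimes> v\<close>, the prime \<open>s\<close> would
    otherwise be a unit.\<close>
  moreover have "\<not> dv A p v"
  proof
    assume "dv A p v"
    then obtain w where w: "w \<in> A" "v = p \<otimes> w" unfolding dv_def by auto
    have wc: "w \<in> carrier R" using w subring_closed(1)[OF assms] by auto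
    have "\<one> \<otimes> p = (s \<otimes> w) \<otimes> p" using v(2) w(2) sA wc pA by (simp add: m_ac)
    then have "\<one> = s \<otimes> w" using cancel_nonzero[OF pA(3) prmD(2)[OF pA(1)]] sA wc by auto
    then show False using prmD(3)[OF s] w dvI by blast
  qed
  ultimately have "dv A p s" using prmD(4)[OF pA(1) sA(1) v(1)] by blast
  then obtain w where w: "w \<in> A" "s = p \<otimes> w" unfolding dv_def by auto
  have wc: "w \<in> carrier R" using w subring_closed(1)[OF assms] by auto
  have "(v \<otimes> w) \<otimes> s = (s \<otimes> v) \<otimes> w" using sA vc wc by (simp add: m_ac)
  also have "\<dots> = \<one> \<otimes> s" using v(2)[symmetric] w(2)[symmetric] sA by simp
  finally have vw: "\<one> = v \<otimes> w" using cancel_nonzero[OF sA(2) prmD(2)[OF s]] vc wc by fastforce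
  obtain l r where lr: "ps = l @ p # r" using p split_list by metis
  have lrA: "set l \<subseteq> A" "set r \<subseteq> A" "set l \<subseteq> carrier R" "set r \<subseteq> carrier R"
    using psA lr subring_closed(1)[OF assms] by auto
  note lrc = prd_closed[OF carrier_is_subring lrA(3)] prd_closed[OF carrier_is_subring lrA(4)]
  obtain e where e: "e \<in> A" "u \<otimes> prd ps = prd (s # ss) \<otimes> e" using Cons(6) unfolding dv_def by auto
  have ec: "e \<in> carrier R" using e subring_closed(1)[OF assms] by auto
  have ssc: "prd ss \<in> carrier R" using ss subring_closed(1)[OF assms] by auto
  have "u \<otimes> prd ps = ((u \<otimes> v) \<otimes> prd (l @ r)) \<otimes> s"
    unfolding lr using lrA lrc pA u vc v(2) sA by (simp add: prd_append m_ac del: foldr_append)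
  moreover have "prd (s # ss) \<otimes> e = (prd ss \<otimes> e) \<otimes> s" using ssc ec sA by (simp add: m_ac)
  ultimately have "(u \<otimes> v) \<otimes> prd (l @ r) = prd ss \<otimes> e"
    using e cancel_nonzero[OF sA(2) prmD(2)[OF s]] u vc ec ssc lrA lrc by (simp add: prd_append del: foldr_append)
  then have "dv A (prd ss) ((u \<otimes> v) \<otimes> prd (l @ r))" using e dvI by blast
  moreover have "dv A (u \<otimes> v) \<one>" using unit_mult[OF assms Cons(4) v(1) Cons(5) dvI[OF w(1) vw]] .
  moreover have "u \<otimes> v \<in> A" using subring_closed(4)[OF assms Cons(4) v(1)] .
  ultimately have "length ss \<le> length (l @ r)" using Cons(1)[of "l @ r" "u \<otimes> v"] Cons(2,3) lr by auto
  then show ?case unfolding lr by simp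
qed simp

lemma ufd_length_bound:
  assumes "ufd A" "a \<in> A" "a \<noteq> \<zero>"
  shows "\<exists>N. \<forall>ss. (\<forall>s\<in>set ss. prm A s) \<and> dv A (prd ss) a \<longrightarrow> length ss \<le> N"
proof -
  have A: "subring A R" using assms unfolding ufd_def by auto
  obtain u ps where "u \<in> A" "dv A u \<one>" "\<forall>p\<in>set ps. prm A p" "a = u \<otimes> prd ps"
    using assms unfolding ufd_def by blast
  then show ?thesis using prd_length_bound[OF A] by blast
qed

text \<open>Nagata's criterion, with the localization at \<open>S\<close> given as an overring \<open>B\<close>.\<close>

context
  fixes A B S :: "'a set"
  assumes A: "subring A R" and B: "subring B R" and AB: "A \<subseteq> B"
    and S: "\<And>s. s \<in> S \<Longrightarrow> prm A s" and SB: "\<And>s. s \<in> S \<Longrightarrow> dv B s \<one>"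
    and loc: "\<And>b. b \<in> B \<Longrightarrow> \<exists>ss. set ss \<subseteq> S \<and> prd ss \<otimes> b \<in> A"
    and fin: "\<And>a. a \<in> A \<Longrightarrow> a \<noteq> \<zero> \<Longrightarrow> \<exists>N::nat. \<forall>ss. set ss \<subseteq> S \<and> dv A (prd ss) a \<longrightarrow> length ss \<le> N"
begin

lemma nagata_carrier: "b \<in> B \<Longrightarrow> b \<in> carrier R" "a \<in> A \<Longrightarrow> a \<in> carrier R" "s \<in> S \<Longrightarrow> s \<in> A" "s \<in> S \<Longrightarrow> s \<in> carrier R"
  using subring_closed(1)[OF A] subring_closed(1)[OF B] prmD(1)[OF S] by auto

lemma nagata_prd_closed:
  assumes "set ss \<subseteq> S"
  shows "prd ss \<in> A" "prd ss \<in> B"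
proof -
  have "set ss \<subseteq> A" using assms nagata_carrier(3) by blast
  then show "prd ss \<in> A" by (rule prd_closed[OF A])
  then show "prd ss \<in> B" using AB by blast
qed

text \<open>Elements without a factor in \<open>S\<close> create no denominators: a prime
  \<open>s\<close> of the denominator divides \<open>a \<otimes> c\<close> but not \<open>a\<close>,
  so it divides the numerator \<open>c\<close> and cancels. The transfer of units and primes from
  \<open>B\<close> to \<open>A\<close> rests on this.\<close>

lemma nagata_star:
  assumes "a \<in> A" "\<And>s. s \<in> S \<Longrightarrow> \<not> dv A s a" "b \<in> B" "a \<otimes> b \<in> A"
  shows "b \<in> A"
proof -
  obtain ss where "set ss \<subseteq> S" "prd ss \<otimes> b \<in> A" using loc assms by blast
  then show ?thesis
  proof (induct ss)
    case Nil
    then show ?case using nagata_carrier assms by simp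
  next
    case (Cons s ss)
    have sA: "s \<in> S" "s \<in> A" "s \<in> carrier R" using Cons nagata_carrier by auto
    have ssA: "prd ss \<in> A" using Cons nagata_prd_closed(1) by simp
    have c: "a \<in> carrier R" "b \<in> carrier R" "prd ss \<in> carrier R" using assms ssA nagata_carrier by auto
    define c where "c = prd (s # ss) \<otimes> b"
    have cA: "c \<in> A" unfolding c_def using Cons by blast
    have "a \<otimes> c = s \<otimes> (prd ss \<otimes> (a \<otimes> b))" unfolding c_def using c sA by (simp add: m_ac)
    then have "dv A s (a \<otimes> c)" using subring_closed(4)[OF A ssA assms(4)] dvI by blast
    then have "dv A s c" using prmD(4)[OF S[OF sA(1)] assms(1) cA] assms(2)[OF sA(1)] by blast
    then obtain d where d: "d \<in> A" "c = s \<otimes> d" unfolding dv_def by auto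
    have dc: "d \<in> carrier R" using d nagata_carrier by auto
    have "(prd ss \<otimes> b) \<otimes> s = d \<otimes> s" using d(2) dc unfolding c_def using c sA by (simp add: m_ac)
    then have "prd ss \<otimes> b = d" using cancel_nonzero[OF sA(3) prmD(2)[OF S[OF sA(1)]]] c dc by auto
    then show ?case using Cons d by auto
  qed
qed

lemma nagata_decomp:
  assumes "a \<in> A" "a \<noteq> \<zero>"
  obtains ss b where "set ss \<subseteq> S" "b \<in> A" "\<And>s. s \<in> S \<Longrightarrow> \<not> dv A s b" "a = prd ss \<otimes> b"
proof -
  obtain N where N: "\<And>ss. set ss \<subseteq> S \<and> dv A (prd ss) a \<Longrightarrow> length ss \<le> N" using fin[OF assms] by blast
  let ?P = "\<lambda>ss. set ss \<subseteq> S \<and> dv A (prd ss) a"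
  have "?P []" using assms nagata_carrier by (auto intro: dvI)
  \<comment> \<open>A longest product of elements of \<open>S\<close> is split off, so that none of
    them divides the rest. The greatest element principle wants a strict bound, hence
    \<open>Suc N\<close>.\<close>
  then have "\<exists>ss. ?P ss \<and> (\<forall>ts. ?P ts \<longrightarrow> length ts \<le> length ss)"
    using N by (intro ex_has_greatest_nat[of ?P "[]" length "Suc N"]) (auto simp: less_Suc_eq_le)
  then obtain ss where ss: "?P ss" "\<And>ts. ?P ts \<Longrightarrow> length ts \<le> length ss" by blast
  obtain b where b: "b \<in> A" "a = prd ss \<otimes> b" using ss unfolding dv_def by auto
  have "\<not> dv A s b" if s: "s \<in> S" for s
  proof
    assume "dv A s b"
    then obtain d where d: "d \<in> A" "b = s \<otimes> d" unfolding dv_def by auto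
    have c: "s \<in> carrier R" "d \<in> carrier R" "prd ss \<in> carrier R"
      using s d ss nagata_carrier nagata_prd_closed(1)[of ss] by auto
    have "a = prd (s # ss) \<otimes> d" unfolding b(2) d(2) using c by (simp add: m_ac)
    then have "?P (s # ss)" using s ss d by (auto intro: dvI)
    then show False using ss(2) by fastforce
  qed
  then show thesis using that ss b by blast
qed

lemma nagata_unit:
  assumes "a \<in> A" "\<And>s. s \<in> S \<Longrightarrow> \<not> dv A s a" "dv B a \<one>"
  shows "dv A a \<one>"
proof -
  obtain d where d: "d \<in> B" "\<one> = a \<otimes> d" using assms unfolding dv_def by auto
  then have "d \<in> A" using nagata_star[OF assms(1,2) d(1)] subring_closed(3)[OF A] by auto
  then show ?thesis using d dvI by blast
qed

lemma nagata_prime: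
  assumes "a \<in> A" "\<And>s. s \<in> S \<Longrightarrow> \<not> dv A s a" "prm B a"
  shows "prm A a"
proof -
  have *: "dv A a b" if "dv B a b" "b \<in> A" for b
  proof -
    obtain c where c: "c \<in> B" "b = a \<otimes> c" using \<open>dv B a b\<close> unfolding dv_def by auto
    have "c \<in> A" using nagata_star[OF assms(1,2) c(1)] c(2) that(2) by auto
    then show ?thesis using c dvI by blast
  qed
  have AB': "dv A a b \<Longrightarrow> dv B a b" for b using AB unfolding dv_def by blast
  show ?thesis unfolding prm_def
  proof (intro conjI ballI impI)
    show "\<not> dv A a \<one>" using prmD(3)[OF assms(3)] AB' by blast
    fix b c assume bc: "b \<in> A" "c \<in> A" "dv A a (b \<otimes> c)"
    then have "dv B a b \<or> dv B a c" using prmD(4)[OF assms(3)] AB AB' by blast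
    then show "dv A a b \<or> dv A a c" using * bc by blast
  qed (use assms prmD(2)[OF assms(3)] in auto)
qed

lemma nagata_prd_unit: "set ss \<subseteq> S \<Longrightarrow> dv B (prd ss) \<one>"
proof (induct ss)
  case Nil
  then show ?case using subring_closed(3)[OF B] by (auto intro!: dvI)
next
  case (Cons s ss)
  have "s \<in> B" "prd ss \<in> B" using Cons nagata_carrier(3) AB nagata_prd_closed[of ss] by auto
  then show ?case using unit_mult[OF B] SB Cons by simp
qed

text \<open>A prime of \<open>B\<close> lies in \<open>A\<close> after multiplication by elements of
  \<open>S\<close>; splitting off its factors in \<open>S\<close> then makes it prime in
  \<open>A\<close>. Both changes are by units of \<open>B\<close>, gathered in
  \<open>w\<close>.\<close>

lemma nagata_prime_list:
  "\<forall>p\<in>set ps. prm B p \<Longrightarrow> \<exists>w qs. w \<in> B \<and> dv B w \<one> \<and> prd ps = w \<otimes> prd qs \<and>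
     (\<forall>q\<in>set qs. q \<in> A \<and> (\<forall>s\<in>S. \<not> dv A s q) \<and> prm A q)"
proof (induct ps)
  case Nil
  show ?case using subring_closed(3)[OF B] by (intro exI[of _ \<one>] exI[of _ "[]"]) (auto intro!: dvI)
next
  case (Cons p ps)
  then obtain w qs where w: "w \<in> B" "dv B w \<one>" "prd ps = w \<otimes> prd qs"
    and qs: "\<forall>q\<in>set qs. q \<in> A \<and> (\<forall>s\<in>S. \<not> dv A s q) \<and> prm A q" by auto
  have p: "prm B p" "p \<in> B" "p \<in> carrier R" using Cons prmD(1) nagata_carrier by auto
  obtain ss where ss: "set ss \<subseteq> S" "prd ss \<otimes> p \<in> A" using loc p by blast
  note uS = nagata_prd_unit[OF ss(1)]
  note ssB = nagata_prd_closed(2)[OF ss(1)]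
  have pr: "prm B (prd ss \<otimes> p)" using prm_assoc[OF B p(1) ssB uS] .
  obtain ts q where q: "set ts \<subseteq> S" "q \<in> A" "\<And>s. s \<in> S \<Longrightarrow> \<not> dv A s q" "prd ss \<otimes> p = prd ts \<otimes> q"
    using nagata_decomp[OF ss(2) prmD(2)[OF pr]] by blast
  note uT = nagata_prd_unit[OF q(1)]
  note ttB = nagata_prd_closed(2)[OF q(1)]
  obtain s' where s': "s' \<in> B" "\<one> = prd ss \<otimes> s'" using uS unfolding dv_def by auto
  obtain t' where t': "t' \<in> B" "\<one> = prd ts \<otimes> t'" using uT unfolding dv_def by auto
  have c: "prd ss \<in> carrier R" "prd ts \<in> carrier R" "s' \<in> carrier R" "t' \<in> carrier R" "q \<in> carrier R" "w \<in> carrier R"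
    using ssB ttB s' t' q w nagata_carrier by auto
  have qq: "q = t' \<otimes> (prd ss \<otimes> p)"
  proof -
    have "q = (prd ts \<otimes> t') \<otimes> q" using t'(2)[symmetric] c by simp
    then show ?thesis unfolding q(4) using c by (simp add: m_ac)
  qed
  have tu: "dv B t' \<one>" using ttB t'(2) c by (intro dvI[of "prd ts"]) (auto simp: m_comm)
  have "prm B q" unfolding qq using prm_assoc[OF B pr t'(1) tu] .
  then have qA: "prm A q" using nagata_prime q by blast
  have "p = (prd ss \<otimes> s') \<otimes> p" using s'(2)[symmetric] p by simp
  also have "\<dots> = s' \<otimes> (prd ss \<otimes> p)" using c p by (simp add: m_ac)
  finally have pp: "p = (s' \<otimes> prd ts) \<otimes> q" unfolding q(4) using c by (simp add: m_assoc)
  have qsc: "prd qs \<in> carrier R" using qs nagata_carrier by (intro prd_closed[OF carrier_is_subring]) auto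
  have "dv B s' \<one>" using ssB s'(2) c by (intro dvI[of "prd ss"]) (auto simp: m_comm)
  then have 1: "dv B (s' \<otimes> prd ts) \<one>" using unit_mult[OF B s'(1) ttB _ uT] by blast
  have 2: "s' \<otimes> prd ts \<in> B" using subring_closed(4)[OF B s'(1) ttB] .
  have "prd (p # ps) = ((s' \<otimes> prd ts) \<otimes> q) \<otimes> (w \<otimes> prd qs)" using w(3) pp by simp
  also have "\<dots> = ((s' \<otimes> prd ts) \<otimes> w) \<otimes> prd (q # qs)" using c qsc by (simp add: m_ac)
  finally have "prd (p # ps) = ((s' \<otimes> prd ts) \<otimes> w) \<otimes> prd (q # qs)" .
  then show ?case using unit_mult[OF B 2 w(1) 1 w(2)] subring_closed(4)[OF B 2 w(1)] q qA qs
    by (intro exI[of _ "(s' \<otimes> prd ts) \<otimes> w"] exI[of _ "q # qs"]) auto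
qed

lemma nagata:
  assumes "ufd B"
  shows "ufd A"
  unfolding ufd_def
proof (intro conjI A ballI impI)
  fix a assume a: "a \<in> A" "a \<noteq> \<zero>"
  obtain ss b where b: "set ss \<subseteq> S" "b \<in> A" "\<And>s. s \<in> S \<Longrightarrow> \<not> dv A s b" "a = prd ss \<otimes> b"
    using nagata_decomp[OF a] by blast
  note ssA = nagata_prd_closed(1)[OF b(1)]
  have bc: "b \<in> carrier R" "prd ss \<in> carrier R" using b ssA nagata_carrier by auto
  have "b \<noteq> \<zero>" using a b(4) bc by auto
  then obtain u ps where u: "u \<in> B" "dv B u \<one>" "\<forall>p\<in>set ps. prm B p" "b = u \<otimes> prd ps"
    using assms b AB unfolding ufd_def by blast
  obtain w qs where w: "w \<in> B" "dv B w \<one>" "prd ps = w \<otimes> prd qs"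
    and qs: "\<forall>q\<in>set qs. q \<in> A \<and> (\<forall>s\<in>S. \<not> dv A s q) \<and> prm A q"
    using nagata_prime_list[OF u(3)] by blast
  have qsA: "prd qs \<in> A" "set qs \<subseteq> A" using qs by (auto intro!: prd_closed[OF A])
  have c: "u \<in> carrier R" "w \<in> carrier R" "prd qs \<in> carrier R" using u w qsA nagata_carrier by auto
  have free: "\<not> dv A s (prd qs)" if "s \<in> S" for s
    using prm_dv_prd[OF A S[OF that] _ qsA(2)] qs that by blast
  have uwB: "u \<otimes> w \<in> B" using subring_closed(4)[OF B u(1) w(1)] .
  have bq: "b = prd qs \<otimes> (u \<otimes> w)" using u w c by (simp add: m_ac)
  \<comment> \<open>The unit of \<open>B\<close> that is left over has neither a denominator nor a
    factor in \<open>S\<close>, so it is a unit of \<open>A\<close>.\<close>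
  then have uwA: "u \<otimes> w \<in> A" using nagata_star[OF qsA(1) free uwB] b by auto
  have "\<not> dv A s (u \<otimes> w)" if "s \<in> S" for s
    using dv_mult(2)[OF A _ uwA qsA(1), of s] nagata_carrier(3)[OF that] b(3)[OF that] bq by auto
  then have uw1: "dv A (u \<otimes> w) \<one>" using nagata_unit[OF uwA] unit_mult[OF B u(1) w(1) u(2) w(2)] by blast
  have "set ss \<subseteq> carrier R" "set qs \<subseteq> carrier R" using b(1) qsA nagata_carrier by auto
  then have "a = (u \<otimes> w) \<otimes> prd (ss @ qs)" unfolding b(4) bq using c bc by (simp add: prd_append m_ac del: foldr_append)
  moreover have "\<forall>p\<in>set (ss @ qs). prm A p" using b(1) S qs by auto
  ultimately show "\<exists>u ps. u \<in> A \<and> dv A u \<one> \<and> (\<forall>p\<in>set ps. prm A p) \<and> a = u \<otimes> prd ps"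
    using uwA uw1 by blast
qed

end

section \<open>Divisibility by constants in polynomial rings\<close>

text \<open>By uniqueness of the Horner form, divisibility by a constant is a condition on each
  coefficient. This takes the place of contents of polynomials.\<close>

lemma dv_adj_iff:
  assumes "subring A R" "trans A t" "f \<in> A" "q \<in> adj A t" "r \<in> A"
  shows "dv (adj A t) f (q \<otimes> t \<oplus> r) \<longleftrightarrow> dv (adj A t) f q \<and> dv A f r"
proof
  note t = transD(1,2)[OF assms(2)]
  note P = adj_subring[OF assms(1) t(1)]
  have c: "f \<in> carrier R" "q \<in> carrier R" "r \<in> carrier R"
    using assms subring_closed(1)[OF P] subring_closed(1)[OF assms(1)] by auto
  {
    assume "dv (adj A t) f (q \<otimes> t \<oplus> r)"
    then obtain p where p: "p \<in> adj A t" "q \<otimes> t \<oplus> r = f \<otimes> p" unfolding dv_def by auto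
    obtain v s where v: "v \<in> adj A t" "s \<in> A" "p = v \<otimes> t \<oplus> s" using adj_cases[OF assms(1) t(1) p(1)] by blast
    have vc: "v \<in> carrier R" "s \<in> carrier R" using v subring_closed(1)[OF P] subring_closed(1)[OF assms(1)] by auto
    have fA: "f \<in> adj A t" using adj_incl[OF assms(1) t(1) assms(3)] .
    have "q \<otimes> t \<oplus> r = (f \<otimes> v) \<otimes> t \<oplus> f \<otimes> s" unfolding p(2) v(3) using vc c t by algebra
    from trans_unique[OF assms(1,2,4) subring_closed(4)[OF P fA v(1)] assms(5) subring_closed(4)[OF assms(1,3) v(2)] this]
    show "dv (adj A t) f q \<and> dv A f r" using v dvI by blast
  }
  {
    assume "dv (adj A t) f q \<and> dv A f r"
    then obtain v s where v: "v \<in> adj A t" "q = f \<otimes> v" "s \<in> A" "r = f \<otimes> s" unfolding dv_def by auto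
    have vc: "v \<in> carrier R" "s \<in> carrier R" using v subring_closed(1)[OF P] subring_closed(1)[OF assms(1)] by auto
    have "q \<otimes> t \<oplus> r = f \<otimes> (v \<otimes> t \<oplus> s)" using v vc c t by algebra
    then show "dv (adj A t) f (q \<otimes> t \<oplus> r)" using dvI simple_extension.lin[OF v(1,3)] by blast
  }
qed

lemma dv_adj_base:
  assumes "subring A R" "trans A t" "f \<in> A" "r \<in> A"
  shows "dv (adj A t) f r \<longleftrightarrow> dv A f r"
proof -
  note t = transD(1,2)[OF assms(2)]
  have z: "\<zero> \<in> adj A t" and f: "f \<in> carrier R" "r \<in> carrier R"
    using assms subring_closed(1)[OF assms(1)] by auto
  have "dv (adj A t) f \<zero>" using z f by (intro dvI[OF z]) simp
  then show ?thesis using dv_adj_iff[OF assms(1-3) z assms(4)] t f by simp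
qed

lemma dv_adj_shift:
  assumes "subring A R" "trans A t" "f \<in> A" "q \<in> adj A t"
  shows "dv (adj A t) f (q \<otimes> t) \<longleftrightarrow> dv (adj A t) f q"
proof -
  note t = transD(1,2)[OF assms(2)]
  have c: "f \<in> carrier R" "q \<in> carrier R"
    using assms subring_closed(1)[OF assms(1)] subring_closed(1)[OF adj_subring[OF assms(1) t(1)]] by auto
  have z: "\<zero> \<in> A" using subring_closed(2)[OF assms(1)] .
  have "dv A f \<zero>" using c by (intro dvI[OF z]) simp
  then show ?thesis using dv_adj_iff[OF assms z] t c by simp
qed

lemma dv_add:
  assumes "subring A R" "f \<in> A" "dv A f a" "dv A f b"
  shows "dv A f (a \<oplus> b)" "dv A f (a \<ominus> b)"
proof -
  obtain c d where c: "c \<in> A" "a = f \<otimes> c" "d \<in> A" "b = f \<otimes> d" using assms unfolding dv_def by auto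
  have cc: "c \<in> carrier R" "d \<in> carrier R" "f \<in> carrier R" using c assms subring_closed(1) by auto
  have "a \<oplus> b = f \<otimes> (c \<oplus> d)" "a \<ominus> b = f \<otimes> (c \<ominus> d)" unfolding c using cc by algebra+
  then show "dv A f (a \<oplus> b)" "dv A f (a \<ominus> b)"
    using subring_closed(5,6)[OF assms(1) c(1,3)] dvI by auto
qed

text \<open>Gauss's argument on lowest coefficients. If \<open>f\<close> divides the constant term
  of the first factor, that term is subtracted and \<open>t\<close> cancelled. If not, induction
  over the second factor shows that \<open>f\<close> divides all coefficients of the latter.\<close>

lemma prm_adj:
  assumes "subring A R" "trans A t" "prm A f"
  shows "prm (adj A t) f"
proof -
  note t = transD(1,2)[OF assms(2)] and f = prmD[OF assms(3)]
  note P = adj_subring[OF assms(1) t(1)]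
  have fA: "f \<in> adj A t" using adj_incl[OF assms(1) t(1) f(1)] .
  have pr: "dv (adj A t) f a \<or> dv (adj A t) f b"
    if "a \<in> adj A t" "b \<in> adj A t" "dv (adj A t) f (a \<otimes> b)" for a b
    using that
  proof (induct arbitrary: b rule: simple_extension.induct)
    case zero
    have "\<zero> = f \<otimes> \<zero>" using subring_closed(1)[OF P fA] by simp
    then show ?case using dvI[OF simple_extension.zero] by metis
  next
    case (lin q r)
    have c: "q \<in> carrier R" "r \<in> carrier R" "b \<in> carrier R"
      using lin subring_closed(1)[OF P] subring_closed(1)[OF assms(1)] by auto
    have rP: "r \<in> adj A t" using adj_incl[OF assms(1) t(1)] lin by blast
    show ?case
    proof (cases "dv A f r")
      case True
      then have "dv (adj A t) f r" using dv_adj_base[OF assms(1,2) f(1)] lin by blast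
      then have "dv (adj A t) f (r \<otimes> b)" using dv_mult[OF P fA rP lin(4)] by blast
      then have "dv (adj A t) f ((q \<otimes> t \<oplus> r) \<otimes> b \<ominus> r \<otimes> b)" using dv_add[OF P fA lin(5)] by blast
      moreover have "(q \<otimes> t \<oplus> r) \<otimes> b \<ominus> r \<otimes> b = (q \<otimes> b) \<otimes> t" using c t by algebra
      ultimately have "dv (adj A t) f (q \<otimes> b)"
        using dv_adj_shift[OF assms(1,2) f(1) subring_closed(4)[OF P lin(1,4)]] by simp
      then have "dv (adj A t) f q \<or> dv (adj A t) f b" using lin by blast
      then show ?thesis using dv_adj_iff[OF assms(1,2) f(1) lin(1,3)] True by blast
    next
      case False
      have "dv (adj A t) f b" using lin(4,5)
      proof (induct rule: simple_extension.induct)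
        case zero
        have "\<zero> = f \<otimes> \<zero>" using subring_closed(1)[OF P fA] by simp
        then show ?case using dvI[OF simple_extension.zero] by metis
      next
        case (lin q' r')
        have c': "q' \<in> carrier R" "r' \<in> carrier R"
          using lin subring_closed(1)[OF P] subring_closed(1)[OF assms(1)] by auto
        have r'P: "r' \<in> adj A t" using adj_incl[OF assms(1) t(1)] lin by blast
        have aP: "q \<otimes> t \<oplus> r \<in> adj A t" using simple_extension.lin \<open>q \<in> adj A t\<close> \<open>r \<in> A\<close> by blast
        define w where "w = (q \<otimes> t \<oplus> r) \<otimes> q' \<oplus> q \<otimes> r'"
        have w: "w \<in> adj A t" unfolding w_def
          using subring_closed(5)[OF P subring_closed(4)[OF P aP lin(1)] subring_closed(4)[OF P \<open>q \<in> adj A t\<close> r'P]] .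
        have "(q \<otimes> t \<oplus> r) \<otimes> (q' \<otimes> t \<oplus> r') = w \<otimes> t \<oplus> r \<otimes> r'" unfolding w_def using c c' t by algebra
        then have "dv A f (r \<otimes> r')"
          using dv_adj_iff[OF assms(1,2) f(1) w subring_closed(4)[OF assms(1) \<open>r \<in> A\<close> lin(3)]] lin(4) by simp
        then have r': "dv A f r'" using f(4) \<open>r \<in> A\<close> lin(3) False by blast
        then have "dv (adj A t) f r'" using dv_adj_base[OF assms(1,2) f(1)] lin by blast
        then have "dv (adj A t) f ((q \<otimes> t \<oplus> r) \<otimes> r')" using dv_mult[OF P fA r'P aP] by blast
        then have "dv (adj A t) f ((q \<otimes> t \<oplus> r) \<otimes> (q' \<otimes> t \<oplus> r') \<ominus> (q \<otimes> t \<oplus> r) \<otimes> r')"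
          using dv_add[OF P fA lin(4)] by blast
        moreover have "(q \<otimes> t \<oplus> r) \<otimes> (q' \<otimes> t \<oplus> r') \<ominus> (q \<otimes> t \<oplus> r) \<otimes> r' = ((q \<otimes> t \<oplus> r) \<otimes> q') \<otimes> t"
          using c c' t by algebra
        ultimately have "dv (adj A t) f ((q \<otimes> t \<oplus> r) \<otimes> q')"
          using dv_adj_shift[OF assms(1,2) f(1) subring_closed(4)[OF P aP lin(1)]] by simp
        then have "dv (adj A t) f q'" using lin(2) by blast
        then show ?case using dv_adj_iff[OF assms(1,2) f(1) lin(1,3)] r' by blast
      qed
      then show ?thesis by blast
    qed
  qed
  have "\<not> dv (adj A t) f \<one>"
    using dv_adj_base[OF assms(1,2) f(1) subring_closed(3)[OF assms(1)]] f(3) by blast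
  then show ?thesis unfolding prm_def using fA f(2) pr by blast
qed

section \<open>Base cases of factoriality\<close>

text \<open>Serves for the integers and for polynomials in one variable over a field: both are
  images of a principal domain under an injective homomorphism, along which divisibility, units and
  primes correspond.\<close>

lemma principal_image_ufd:
  fixes U (structure)
  assumes "principal_domain U" "h \<in> ring_hom U R" "inj_on h (carrier U)"
  shows "ufd (h ` carrier U)"
proof -
  interpret U: principal_domain U by fact
  interpret h: ring_hom_ring U R h
    by (rule ring_hom_ringI2) (use assms U.ring_axioms ring_axioms in auto)
  let ?A = "h ` carrier U"
  have A: "subring ?A R" using h.img_is_subring[OF U.carrier_is_subring] .
  have dv: "dv ?A (h a) (h b) \<longleftrightarrow> a divides\<^bsub>U\<^esub> b" if ab: "a \<in> carrier U" "b \<in> carrier U" for a b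
  proof
    assume "dv ?A (h a) (h b)"
    then obtain c where "c \<in> carrier U" "h b = h (a \<otimes>\<^bsub>U\<^esub> c)" unfolding dv_def using ab by auto
    then show "a divides\<^bsub>U\<^esub> b" using assms(3) ab unfolding inj_on_def factor_def by blast
  next
    assume "a divides\<^bsub>U\<^esub> b"
    then show "dv ?A (h a) (h b)" using ab unfolding dv_def factor_def by auto
  qed
  have h0: "h a = \<zero> \<longleftrightarrow> a = \<zero>\<^bsub>U\<^esub>" if "a \<in> carrier U" for a
    using inj_onD[OF assms(3), of a "\<zero>\<^bsub>U\<^esub>"] that h.hom_zero by auto
  have unit: "dv ?A (h a) \<one> \<longleftrightarrow> a \<in> Units U" if "a \<in> carrier U" for a
    using dv[OF that U.one_closed] U.divides_one[OF that] by simp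
  have prm: "prm ?A (h p)" if p: "p \<in> carrier U" "p \<noteq> \<zero>\<^bsub>U\<^esub>" "irreducible (mult_of U) p" for p
  proof -
    have "ring_prime\<^bsub>U\<^esub> p" using U.primeness_condition[OF p(1)] U.ring_irreducibleI' p by blast
    then have pr: "prime U p" unfolding ring_prime_def by blast
    show ?thesis unfolding prm_def
    proof (intro conjI ballI impI)
      show "h p \<noteq> \<zero>" using h0 p by blast
      show "\<not> dv ?A (h p) \<one>" using unit[OF p(1)] pr unfolding prime_def by blast
      fix a b assume ab: "a \<in> ?A" "b \<in> ?A" "dv ?A (h p) (a \<otimes> b)"
      then obtain a' b' where ab': "a' \<in> carrier U" "b' \<in> carrier U" "a = h a'" "b = h b'" by auto
      then have "dv ?A (h p) (h (a' \<otimes>\<^bsub>U\<^esub> b'))" using ab by simp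
      then have "p divides\<^bsub>U\<^esub> (a' \<otimes>\<^bsub>U\<^esub> b')" using dv[OF p(1) U.m_closed[OF ab'(1,2)]] by blast
      then show "dv ?A (h p) a \<or> dv ?A (h p) b" using pr dv p(1) ab' unfolding prime_def by blast
    qed (use p in blast)
  qed
  show ?thesis unfolding ufd_def
  proof (intro conjI A ballI impI)
    fix x assume x: "x \<in> ?A" "x \<noteq> \<zero>"
    then obtain a where a: "a \<in> carrier U" "x = h a" by blast
    have a0: "a \<noteq> \<zero>\<^bsub>U\<^esub>" using h0[OF a(1)] x(2) a(2) by blast
    show "\<exists>u ps. u \<in> ?A \<and> dv ?A u \<one> \<and> (\<forall>p\<in>set ps. prm ?A p) \<and> x = u \<otimes> prd ps"
    proof (cases "a \<in> Units U")
      case True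
      then have "dv ?A x \<one>" using unit[OF a(1)] a(2) by blast
      then show ?thesis using x(1) h.hom_closed[OF a(1)] a(2)
        by (intro exI[of _ x] exI[of _ "[]"]) simp
    next
      case False
      obtain fs where fs: "set fs \<subseteq> carrier (mult_of U)" "wfactors (mult_of U) fs a"
        using U.factorization_property[of a] a a0 False by blast
      have fsc: "set fs \<subseteq> carrier U" using fs by auto
      have hp2: "set gs \<subseteq> carrier U \<Longrightarrow> foldr (\<otimes>\<^bsub>U\<^esub>) gs \<one>\<^bsub>U\<^esub> \<in> carrier U" for gs
        by (induct gs) simp_all
      have hp1: "set gs \<subseteq> carrier U \<Longrightarrow> h (foldr (\<otimes>\<^bsub>U\<^esub>) gs \<one>\<^bsub>U\<^esub>) = prd (map h gs)" for gs
        by (induct gs) (simp_all add: hp2)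
      define f where "f = foldr (\<otimes>\<^bsub>U\<^esub>) fs \<one>\<^bsub>U\<^esub>"
      have fc: "f \<in> carrier U" unfolding f_def using hp2[OF fsc] .
      have "f \<sim>\<^bsub>mult_of U\<^esub> a" using fs(2) unfolding wfactors_def f_def by simp
      then have "f \<sim>\<^bsub>U\<^esub> a" using U.assoc_iff_assoc_mult[OF fc a(1)] by blast
      then have "a \<sim>\<^bsub>U\<^esub> f" unfolding associated_def by blast
      then obtain u where u: "u \<in> Units U" "a = u \<otimes>\<^bsub>U\<^esub> f"
        using U.ring_associated_iff[OF a(1) fc] by blast
      have uc: "u \<in> carrier U" using u by blast
      have "x = h u \<otimes> prd (map h fs)"
        unfolding a(2) u(2) using h.hom_mult[OF uc fc] hp1[OF fsc] by (simp add: f_def)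
      moreover have "\<forall>p\<in>set (map h fs). prm ?A p" using prm fs unfolding wfactors_def by auto
      moreover have "h u \<in> ?A" using uc by blast
      moreover have "dv ?A (h u) \<one>" using unit[OF uc] u by blast
      ultimately show ?thesis by blast
    qed
  qed
qed

lemma field_ufd:
  assumes "subfield K R"
  shows "ufd K"
  unfolding ufd_def
proof (intro conjI ballI impI)
  show "subring K R" using subfieldE(1)[OF assms] .
  fix a assume a: "a \<in> K" "a \<noteq> \<zero>"
  then have "dv K a \<one>" using subfield_m_inv[OF assms, of a] by (intro dvI[of "inv a"]) auto
  moreover have "a = a \<otimes> prd []" using a subfieldE(3)[OF assms] by auto
  ultimately show "\<exists>u ps. u \<in> K \<and> dv K u \<one> \<and> (\<forall>p\<in>set ps. prm K p) \<and> a = u \<otimes> prd ps"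
    using a by (intro exI[of _ a] exI[of _ "[]"]) auto
qed

lemma field_adj_ufd:
  assumes "subfield K R" "trans K t"
  shows "ufd (adj K t)"
proof -
  note t = transD(1,2)[OF assms(2)] and K = subfieldE(1)[OF assms(1)]
  have Kc: "K \<subseteq> carrier R" using subfieldE(3)[OF assms(1)] .
  have ev: "adj K t = (\<lambda>p. eval p t) ` carrier (K[X])"
    using simple_extension_as_eval_img[OF Kc t(1)] .
  interpret h: ring_hom_ring "K[X]" R "\<lambda>p. eval p t" using eval_ring_hom[OF K t(1)] .
  have "p = []" if "p \<in> carrier (K[X])" "eval p t = \<zero>" for p
  proof (rule ccontr)
    assume "p \<noteq> []"
    then have "\<not> (\<exists>p. polynomial K p \<and> eval p t = \<zero> \<and> p \<noteq> []) \<Longrightarrow> False" using that univ_poly_carrier by blast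
    moreover have "eval q t \<noteq> \<zero>" if "polynomial K q" "q \<noteq> []" for q
      using that
    \<comment> \<open>Polynomials are lists headed by the leading coefficient, so induction from the
      end follows Horner's scheme, the last entry being the constant term.\<close>
    proof (induct q rule: rev_induct)
      case (snoc r q)
      have qr: "set (q @ [r]) \<subseteq> K" using polynomial_incl[OF snoc(2)] .
      have rc: "r \<in> K" "r \<in> carrier R" "set q \<subseteq> carrier R" using qr Kc by auto
      have e: "eval (q @ [r]) t = eval q t \<otimes> t \<oplus> r" using eval_append_aux[OF rc(3,2) t(1)] .
      show ?case
      proof (cases "q = []")
        case True
        then show ?thesis using snoc(2) rc e t by (auto simp: polynomial_def)
      next
        case False
        have qp: "polynomial K q" using snoc(2) qr False unfolding polynomial_def by auto
        then have "eval q t \<in> adj K t" unfolding ev using univ_poly_carrier by blast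
        then show ?thesis using trans_zero(1)[OF K assms(2) _ rc(1)] e snoc(1)[OF qp False] by auto
      qed
    qed simp
    ultimately show False by blast
  qed
  moreover have "[] \<in> carrier (K[X])" using h.R.zero_closed by (simp add: univ_poly_zero)
  ultimately have "a_kernel (K[X]) R (\<lambda>p. eval p t) = {\<zero>\<^bsub>K[X]\<^esub>}"
    unfolding a_kernel_def' univ_poly_zero by auto
  then have "inj_on (\<lambda>p. eval p t) (carrier (K[X]))" using h.trivial_ker_imp_inj by blast
  then show ?thesis unfolding ev
    using principal_image_ufd[OF univ_poly_is_principal[OF assms(1)]] h.homh by blast
qed

section \<open>Fraction fields; polynomial and Laurent rings over factorial rings\<close>

definition frac :: "'a set \<Rightarrow> 'a set" where
  "frac A = {z \<in> carrier R. \<exists>b\<in>A. b \<noteq> \<zero> \<and> z \<otimes> b \<in> A}"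

lemma frac_subset: "subring A R \<Longrightarrow> A \<subseteq> frac A"
  unfolding frac_def using subring_closed[of A] by (auto intro!: bexI[of _ \<one>])

lemma frac_subfield:
  assumes "subring A R"
  shows "subfield (frac A) R"
proof (rule subfieldI')
  note A = subring_closed[OF assms]
  show "subring (frac A) R"
  proof (rule subringI)
    show "frac A \<subseteq> carrier R" unfolding frac_def by auto
    show "\<one> \<in> frac A" using frac_subset[OF assms] A(3) by auto
    show "\<ominus> h \<in> frac A" if h: "h \<in> frac A" for h
    proof -
      obtain b where b: "h \<in> carrier R" "b \<in> A" "b \<noteq> \<zero>" "h \<otimes> b \<in> A" using h unfolding frac_def by auto
      then have "\<ominus> h \<otimes> b \<in> A" using A(7)[OF b(4)] A(1)[OF b(2)] by (simp add: l_minus)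
      then show ?thesis using b unfolding frac_def by auto
    qed
    fix g h assume gh: "g \<in> frac A" "h \<in> frac A"
    obtain b where b: "g \<in> carrier R" "b \<in> A" "b \<noteq> \<zero>" "g \<otimes> b \<in> A" using gh unfolding frac_def by auto
    obtain d where d: "h \<in> carrier R" "d \<in> A" "d \<noteq> \<zero>" "h \<otimes> d \<in> A" using gh unfolding frac_def by auto
    have c: "b \<in> carrier R" "d \<in> carrier R" using b d A(1) by auto
    have bd: "b \<otimes> d \<in> A" "b \<otimes> d \<noteq> \<zero>" using A(4) b d c by (auto simp: integral_iff)
    have "(g \<otimes> h) \<otimes> (b \<otimes> d) = (g \<otimes> b) \<otimes> (h \<otimes> d)" using b d c by (simp add: m_ac)
    then have "(g \<otimes> h) \<otimes> (b \<otimes> d) \<in> A" using A(4)[OF b(4) d(4)] by simp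
    then show "g \<otimes> h \<in> frac A" using bd b d unfolding frac_def by blast
    have "(g \<oplus> h) \<otimes> (b \<otimes> d) = (g \<otimes> b) \<otimes> d \<oplus> (h \<otimes> d) \<otimes> b" using b d c by algebra
    then have "(g \<oplus> h) \<otimes> (b \<otimes> d) \<in> A" using A(5)[OF A(4)[OF b(4) d(2)] A(4)[OF d(4) b(2)]] by simp
    then show "g \<oplus> h \<in> frac A" using bd b d unfolding frac_def by blast
  qed
  show "inv k \<in> frac A" if k: "k \<in> frac A - {\<zero>}" for k
  proof -
    obtain b where b: "k \<in> carrier R" "b \<in> A" "b \<noteq> \<zero>" "k \<otimes> b \<in> A" using k unfolding frac_def by auto
    have bc: "b \<in> carrier R" using b A(1) by auto
    note i = inv_nonzero[of k]
    have "inv k \<otimes> (k \<otimes> b) = b" using i k b bc by (simp add: m_assoc[symmetric])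
    then show ?thesis using b k i bc unfolding frac_def by (auto intro!: bexI[of _ "k \<otimes> b"] simp: integral_iff)
  qed
qed

lemma adj_frac_clear:
  assumes "subring A R" "t \<in> carrier R" "b \<in> adj (frac A) t"
  shows "\<exists>d\<in>A. d \<noteq> \<zero> \<and> b \<otimes> d \<in> adj A t"
  using assms(3)
proof (induct rule: simple_extension.induct)
  case zero
  show ?case using subring_closed(3)[OF assms(1)] by (intro bexI[of _ \<one>]) auto
next
  case (lin q r)
  note A = subring_closed[OF assms(1)] and P = subring_closed[OF adj_subring[OF assms(1,2)]]
  obtain d where d: "d \<in> A" "d \<noteq> \<zero>" "q \<otimes> d \<in> adj A t" using lin by auto
  obtain e where e: "r \<in> carrier R" "e \<in> A" "e \<noteq> \<zero>" "r \<otimes> e \<in> A" using lin unfolding frac_def by auto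
  have c: "d \<in> carrier R" "e \<in> carrier R" "q \<in> carrier R"
    using d e A(1) lin(1) subring_closed(1)[OF adj_subring[OF subfieldE(1)[OF frac_subfield[OF assms(1)]] assms(2)]] by auto
  have "(q \<otimes> t \<oplus> r) \<otimes> (d \<otimes> e) = ((q \<otimes> d) \<otimes> e) \<otimes> t \<oplus> (r \<otimes> e) \<otimes> d" using c e assms(2) by algebra
  also have "\<dots> \<in> adj A t"
    using simple_extension.lin[OF P(4)[OF d(3) adj_incl[OF assms(1,2) e(2)]] A(4)[OF e(4) d(1)]] .
  finally show ?case using A(4)[OF d(1) e(2)] d e c by (intro bexI[of _ "d \<otimes> e"]) (auto simp: integral_iff)
qed

text \<open>A common denominator turns a relation over the fraction field into one over
  \<open>A\<close>. Since Laurent rings lie in fraction fields, this also yields transcendence over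
  them.\<close>

lemma trans_frac:
  assumes "subring A R" "trans A t"
  shows "trans (frac A) t"
  unfolding trans_def
proof (intro conjI ballI impI)
  note t = transD(1,2)[OF assms(2)]
  show "t \<in> carrier R" "t \<noteq> \<zero>" using t by auto
  note A = subring_closed[OF assms(1)] and P = subring_closed[OF adj_subring[OF assms(1) t(1)]]
  fix r p assume rp: "r \<in> frac A" "p \<in> adj (frac A) t" "p \<otimes> t \<oplus> r = \<zero>"
  obtain d where d: "d \<in> A" "d \<noteq> \<zero>" "p \<otimes> d \<in> adj A t" using adj_frac_clear[OF assms(1) t(1) rp(2)] by auto
  obtain e where e: "r \<in> carrier R" "e \<in> A" "e \<noteq> \<zero>" "r \<otimes> e \<in> A" using rp unfolding frac_def by auto
  have c: "d \<in> carrier R" "e \<in> carrier R" "p \<in> carrier R"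
    using d e A(1) rp(2) subring_closed(1)[OF adj_subring[OF subfieldE(1)[OF frac_subfield[OF assms(1)]] t(1)]] by auto
  have "((p \<otimes> d) \<otimes> e) \<otimes> t \<oplus> (r \<otimes> e) \<otimes> d = (p \<otimes> t \<oplus> r) \<otimes> (d \<otimes> e)" using c e t by algebra
  also have "\<dots> = \<zero>" using rp c by simp
  finally have "(r \<otimes> e) \<otimes> d = \<zero>"
    using transD(3)[OF assms(2) A(4)[OF e(4) d(1)] P(4)[OF d(3) adj_incl[OF assms(1) t(1) e(2)]]] by blast
  then show "r = \<zero>" using c d e by (auto simp: integral_iff)
qed

text \<open>Any nonzero coefficient of \<open>a\<close> serves as \<open>c\<close>. It reduces
  bounds on the constant factors of a polynomial to bounds in \<open>A\<close>.\<close>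

lemma adj_nonzero_coeff:
  assumes "subring A R" "trans A t"
  shows "a \<in> adj A t \<Longrightarrow> a \<noteq> \<zero> \<Longrightarrow> \<exists>c\<in>A. c \<noteq> \<zero> \<and> (\<forall>f\<in>A. dv (adj A t) f a \<longrightarrow> dv A f c)"
proof (induct rule: simple_extension.induct)
  case (lin q r)
  show ?case
  proof (cases "r = \<zero>")
    case False
    then show ?thesis using lin dv_adj_iff[OF assms] by blast
  next
    case True
    have "q \<noteq> \<zero>" using lin True transD(1)[OF assms(2)] by auto
    then show ?thesis using lin dv_adj_iff[OF assms] by blast
  qed
qed simp

text \<open>Nagata's criterion with all primes of \<open>A\<close> inverted: they stay prime by
  \<open>prm_adj\<close>, and the localization is the polynomial ring over the fraction field,
  factorial by \<open>field_adj_ufd\<close>.\<close>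

lemma gauss_ufd:
  assumes "ufd A" "trans A t"
  shows "ufd (adj A t)"
proof -
  have A: "subring A R" using assms unfolding ufd_def by auto
  note t = transD(1,2)[OF assms(2)]
  note P = adj_subring[OF A t(1)]
  note Q = frac_subfield[OF A]
  note B = adj_subring[OF subfieldE(1)[OF Q] t(1)]
  show ?thesis
  proof (rule nagata[OF P B, of "{p. prm A p}"])
    show "adj A t \<subseteq> adj (frac A) t" using adj_mono[OF frac_subset[OF A]] .
    show "prm (adj A t) s" if "s \<in> {p. prm A p}" for s using prm_adj[OF A assms(2)] that by blast
    show "dv (adj (frac A) t) s \<one>" if "s \<in> {p. prm A p}" for s
    proof -
      have s: "s \<in> A" "s \<noteq> \<zero>" using prmD(1,2) that by auto
      then have "inv s \<in> frac A" using subfield_m_inv(1)[OF Q] frac_subset[OF A] by blast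
      then have "inv s \<in> adj (frac A) t" using adj_incl[OF subfieldE(1)[OF Q] t(1)] by blast
      then show ?thesis using s inv_nonzero(2) subring_closed(1)[OF A] by (intro dvI) auto
    qed
    show "\<exists>ss. set ss \<subseteq> {p. prm A p} \<and> prd ss \<otimes> b \<in> adj A t" if b: "b \<in> adj (frac A) t" for b
    proof -
      obtain d where d: "d \<in> A" "d \<noteq> \<zero>" "b \<otimes> d \<in> adj A t" using adj_frac_clear[OF A t(1) b] by auto
      obtain u ps where u: "u \<in> A" "dv A u \<one>" "\<forall>p\<in>set ps. prm A p" "d = u \<otimes> prd ps"
        using assms(1) d unfolding ufd_def by blast
      obtain v where v: "v \<in> A" "\<one> = u \<otimes> v" using u unfolding dv_def by auto
      have psA: "prd ps \<in> A" using u prmD(1) by (intro prd_closed[OF A]) auto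
      have c: "u \<in> carrier R" "v \<in> carrier R" "prd ps \<in> carrier R" "b \<in> carrier R"
        using u v psA subring_closed(1)[OF A] subring_closed(1)[OF B b] by auto
      have "v \<otimes> (b \<otimes> d) = (u \<otimes> v) \<otimes> (prd ps \<otimes> b)" unfolding u(4) using c by (simp add: m_ac)
      also have "\<dots> = prd ps \<otimes> b" using v(2)[symmetric] c by simp
      finally have "prd ps \<otimes> b \<in> adj A t"
        using subring_closed(4)[OF P adj_incl[OF A t(1) v(1)] d(3)] by simp
      then show ?thesis using u by blast
    qed
    show "\<exists>N::nat. \<forall>ss. set ss \<subseteq> {p. prm A p} \<and> dv (adj A t) (prd ss) a \<longrightarrow> length ss \<le> N"
      if a: "a \<in> adj A t" "a \<noteq> \<zero>" for a
    proof -
      obtain c where c: "c \<in> A" "c \<noteq> \<zero>" "\<forall>f\<in>A. dv (adj A t) f a \<longrightarrow> dv A f c"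
        using adj_nonzero_coeff[OF A assms(2) a] by blast
      obtain N where N: "\<And>ss. (\<forall>s\<in>set ss. prm A s) \<and> dv A (prd ss) c \<Longrightarrow> length ss \<le> N"
        using ufd_length_bound[OF assms(1) c(1,2)] by blast
      have "length ss \<le> N" if ss: "set ss \<subseteq> {p. prm A p}" "dv (adj A t) (prd ss) a" for ss
      proof -
        have "set ss \<subseteq> A" using ss prmD(1) by auto
        then have "prd ss \<in> A" by (rule prd_closed[OF A])
        then show ?thesis using N[of ss] c(3) ss by blast
      qed
      then show ?thesis by blast
    qed
    show "ufd (adj (frac A) t)" using field_adj_ufd[OF Q trans_frac[OF A assms(2)]] .
  qed
qed

text \<open>Powers of \<open>t\<close> are units of the Laurent ring and can be cleared, so a prime
  of the polynomial ring either becomes a unit or stays prime.\<close>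

lemma laur_ufd:
  assumes "subring A R" "t \<in> carrier R" "t \<noteq> \<zero>" "ufd (adj A t)"
  shows "ufd (laur A t)"
  unfolding ufd_def
proof (intro conjI ballI impI)
  let ?A = "adj A t" let ?B = "laur A t"
  note A = adj_subring[OF assms(1,2)]
  show B: "subring ?B R" using laur_subring[OF assms(1,2)] .
  note AB = adj_in_laur[OF assms(1,2)] and m = laur_mem[OF assms(1-3)]
  have tn: "t [^] n \<in> ?B" "inv t [^] n \<in> ?B" "t [^] n \<otimes> inv t [^] n = \<one>" "t [^] n \<in> ?A"
    "t [^] n \<in> carrier R" "inv t [^] n \<in> carrier R" for n :: nat
    using subring_closed(8)[OF B] subring_closed(8)[OF A] m adj_mem assms inv_pow inv_nonzero(1) by auto
  have prime: "prm ?B p" if p: "prm ?A p" "\<not> dv ?B p \<one>" for p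
    unfolding prm_def
  proof (intro conjI ballI impI)
    have pA: "p \<in> ?A" "p \<in> carrier R" using prmD(1)[OF p(1)] subring_closed(1)[OF A] by auto
    then show "p \<in> ?B" using AB by auto
    show "p \<noteq> \<zero>" using prmD(2)[OF p(1)] .
    show "\<not> dv ?B p \<one>" using p(2) .
    have descend: "dv ?B p a" if ad: "dv ?A p (a \<otimes> t [^] (n::nat))" "a \<in> carrier R" for a n
    proof -
      obtain d where d: "d \<in> ?A" "a \<otimes> t [^] n = p \<otimes> d" using ad(1) unfolding dv_def by auto
      have dc: "d \<in> carrier R" using d subring_closed(1)[OF A] by auto
      have "a = (a \<otimes> t [^] n) \<otimes> inv t [^] n" using ad tn by (simp add: m_assoc)
      also have "\<dots> = p \<otimes> (d \<otimes> inv t [^] n)" unfolding d(2) using dc tn pA by (simp add: m_assoc)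
      finally show ?thesis using d AB tn subring_closed(4)[OF B] by (intro dvI) auto
    qed
    fix a b assume ab: "a \<in> ?B" "b \<in> ?B" "dv ?B p (a \<otimes> b)"
    obtain c where c: "c \<in> ?B" "a \<otimes> b = p \<otimes> c" using ab unfolding dv_def by auto
    obtain i :: nat where i: "a \<in> carrier R" "a \<otimes> t [^] i \<in> ?A" using ab(1) laurE by blast
    obtain j :: nat where j: "b \<in> carrier R" "b \<otimes> t [^] j \<in> ?A" using ab(2) laurE by blast
    obtain k :: nat where k: "c \<in> carrier R" "c \<otimes> t [^] k \<in> ?A" using c(1) laurE by blast
    have ik: "a \<otimes> t [^] (i + k) \<in> ?A" using adj_pow_raise[OF assms(1,2) i] by simp
    have "(a \<otimes> t [^] (i + k)) \<otimes> (b \<otimes> t [^] j) = (a \<otimes> b) \<otimes> t [^] (k + (i + j))"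
      using i j assms(2) by (simp add: nat_pow_mult[symmetric] m_ac)
    also have "\<dots> = p \<otimes> (c \<otimes> t [^] (k + (i + j)))" unfolding c(2) using k pA assms(2) by (simp add: m_assoc)
    finally have "dv ?A p ((a \<otimes> t [^] (i + k)) \<otimes> (b \<otimes> t [^] j))"
      using adj_pow_raise[OF assms(1,2) k] by (intro dvI) auto
    then have "dv ?A p (a \<otimes> t [^] (i + k)) \<or> dv ?A p (b \<otimes> t [^] j)" using prmD(4)[OF p(1) ik j(2)] by blast
    then show "dv ?B p a \<or> dv ?B p b" using descend i j by blast
  qed
  have primes: "\<forall>p\<in>set ps. prm ?A p \<Longrightarrow>
    \<exists>w qs. w \<in> ?B \<and> dv ?B w \<one> \<and> (\<forall>q\<in>set qs. prm ?B q) \<and> prd ps = w \<otimes> prd qs" for ps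
  proof (induct ps)
    case Nil
    show ?case using subring_closed(3)[OF B] by (intro exI[of _ \<one>] exI[of _ "[]"]) (auto intro!: dvI)
  next
    case (Cons p ps)
    then obtain w qs where w: "w \<in> ?B" "dv ?B w \<one>" "\<forall>q\<in>set qs. prm ?B q" "prd ps = w \<otimes> prd qs" by auto
    have p: "prm ?A p" "p \<in> ?B" using Cons prmD(1) AB by auto
    have "set qs \<subseteq> ?B" using w prmD(1) by auto
    then have "prd qs \<in> ?B" by (rule prd_closed[OF B])
    then have c: "prd qs \<in> carrier R" "w \<in> carrier R" "p \<in> carrier R" using w p laur_carrier by auto
    show ?case
    proof (cases "dv ?B p \<one>")
      case True
      have "prd (p # ps) = (p \<otimes> w) \<otimes> prd qs" using w c by (simp add: m_ac)
      then show ?thesis using w unit_mult[OF B p(2) w(1) True w(2)] subring_closed(4)[OF B p(2) w(1)] by blast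
    next
      case False
      have "prd (p # ps) = w \<otimes> prd (p # qs)" using w c by (simp add: m_ac)
      then show ?thesis using w prime[OF p(1) False] by (intro exI[of _ w] exI[of _ "p # qs"]) auto
    qed
  qed
  fix z assume z: "z \<in> ?B" "z \<noteq> \<zero>"
  obtain n :: nat where n: "z \<in> carrier R" "z \<otimes> t [^] n \<in> ?A" using z(1) laurE by blast
  have "z \<otimes> t [^] n \<noteq> \<zero>" using z n pow_nonzero[OF assms(2,3)] assms(2) by (simp add: integral_iff)
  then obtain u ps where u: "u \<in> ?A" "dv ?A u \<one>" "\<forall>p\<in>set ps. prm ?A p" "z \<otimes> t [^] n = u \<otimes> prd ps"
    using assms(4) n unfolding ufd_def by blast
  obtain w qs where w: "w \<in> ?B" "dv ?B w \<one>" "\<forall>q\<in>set qs. prm ?B q" "prd ps = w \<otimes> prd qs"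
    using primes[OF u(3)] by auto
  have "set qs \<subseteq> ?B" using w prmD(1) by auto
  then have "prd qs \<in> ?B" by (rule prd_closed[OF B])
  then have c: "prd qs \<in> carrier R" "w \<in> carrier R" "u \<in> carrier R"
    using w u laur_carrier subring_closed(1)[OF A] by auto
  have uB: "u \<in> ?B" "dv ?B u \<one>" using u AB unfolding dv_def by blast+
  have iu: "dv ?B (inv t [^] n) \<one>" using tn by (intro dvI[of "t [^] n"]) (auto simp: m_comm)
  have x: "u \<otimes> w \<in> ?B" "dv ?B (u \<otimes> w) \<one>"
    using unit_mult[OF B uB(1) w(1) uB(2) w(2)] subring_closed(4)[OF B uB(1) w(1)] by auto
  have "z = (z \<otimes> t [^] n) \<otimes> inv t [^] n" using n tn by (simp add: m_assoc)
  also have "\<dots> = ((u \<otimes> w) \<otimes> inv t [^] n) \<otimes> prd qs" unfolding u(4) w(4) using c tn by (simp add: m_ac)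
  finally show "\<exists>u ps. u \<in> ?B \<and> dv ?B u \<one> \<and> (\<forall>p\<in>set ps. prm ?B p) \<and> z = u \<otimes> prd ps"
    using w(3) unit_mult[OF B x(1) tn(2) x(2) iu] subring_closed(4)[OF B x(1) tn(2)] by blast
qed

lemma int_image_ufd:
  assumes "inj (\<lambda>z::int. [z] \<cdot> \<one>)"
  shows "ufd (range (\<lambda>z::int. [z] \<cdot> \<one>))"
proof -
  interpret Z: euclidean_domain \<Z> "nat \<circ> abs"
  proof (rule domain.euclidean_domainI[OF int.domain_axioms])
    fix a b assume "a \<in> carrier \<Z> - {\<zero>\<^bsub>\<Z>\<^esub>}" "b \<in> carrier \<Z> - {\<zero>\<^bsub>\<Z>\<^esub>}"
    then have b: "b \<noteq> 0" by simp
    show "\<exists>q r. q \<in> carrier \<Z> \<and> r \<in> carrier \<Z> \<and> a = b \<otimes>\<^bsub>\<Z>\<^esub> q \<oplus>\<^bsub>\<Z>\<^esub> r \<and>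
      (r = \<zero>\<^bsub>\<Z>\<^esub> \<or> (nat \<circ> abs) r < (nat \<circ> abs) b)"
      using b abs_mod_less[of b a] by (intro exI[of _ "a div b"] exI[of _ "a mod b"]) auto
  qed
  have "(\<lambda>z::int. [z] \<cdot> \<one>) \<in> ring_hom \<Z> R"
  proof (rule ring_hom_memI)
    fix x y :: int
    show "[x] \<cdot> \<one> \<in> carrier R" by simp
    show "[(x \<oplus>\<^bsub>\<Z>\<^esub> y)] \<cdot> \<one> = [x] \<cdot> \<one> \<oplus> [y] \<cdot> \<one>" by (simp add: add.int_pow_mult)
    have "[x] \<cdot> \<one> \<otimes> [y] \<cdot> \<one> = [x] \<cdot> ([y] \<cdot> \<one>)" using add_pow_ldistr_int[of \<one> "[y] \<cdot> \<one>" x] by simp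
    also have "\<dots> = [(y * x)] \<cdot> \<one>" using add.int_pow_pow[of \<one> x y] by (simp add: mult.commute)
    finally show "[(x \<otimes>\<^bsub>\<Z>\<^esub> y)] \<cdot> \<one> = [x] \<cdot> \<one> \<otimes> [y] \<cdot> \<one>" by (simp add: mult.commute)
  qed simp
  from principal_image_ufd[OF Z.principal_domain_axioms this] assms
  show ?thesis by simp
qed

text \<open>An irreducible element has a prime factor by the given factorization, hence is
  associated to it and prime itself. This primeness condition makes factorizations unique.\<close>

lemma ufd_imp_factorial:
  assumes "ufd A"
  shows "factorial_domain (R\<lparr>carrier := A\<rparr>)"
proof -
  have A: "subring A R" using assms unfolding ufd_def by auto
  let ?D = "R\<lparr>carrier := A\<rparr>"
  interpret D: domain ?D using subring_is_domain[OF A] .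
  let ?G = "mult_of ?D"
  have dvG: "a divides\<^bsub>?G\<^esub> b \<longleftrightarrow> dv A a b" if "a \<in> A" "b \<in> A" "b \<noteq> \<zero>" for a b
    using that unfolding factor_def dv_def using subring_closed(1)[OF A] by auto
  have unitG: "a \<in> Units ?G \<longleftrightarrow> dv A a \<one>" if a: "a \<in> A" "a \<noteq> \<zero>" for a
  proof -
    have "a \<in> Units ?G \<longleftrightarrow> a \<in> Units ?D" using D.Units_mult_eq_Units by simp
    also have "\<dots> \<longleftrightarrow> a divides\<^bsub>?D\<^esub> \<one>" using D.divides_one[of a] a by simp
    also have "\<dots> \<longleftrightarrow> dv A a \<one>" unfolding factor_def dv_def by simp
    finally show ?thesis .
  qed
  have primeG: "prime ?G p" if p: "prm A p" for p
    unfolding prime_def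
  proof (intro conjI ballI impI)
    note q = prmD[OF p]
    show "p \<notin> Units ?G" using unitG q by blast
    fix a b assume ab: "a \<in> carrier ?G" "b \<in> carrier ?G" "p divides\<^bsub>?G\<^esub> a \<otimes>\<^bsub>?G\<^esub> b"
    then have "a \<in> A" "b \<in> A" "a \<noteq> \<zero>" "b \<noteq> \<zero>" by auto
    moreover have "a \<otimes> b \<in> A" "a \<otimes> b \<noteq> \<zero>"
      using subring_closed(1,4)[OF A] calculation by (auto simp: integral_iff)
    ultimately show "p divides\<^bsub>?G\<^esub> a \<or> p divides\<^bsub>?G\<^esub> b" using ab(3) dvG q by auto
  qed
  have irr: "irreducible ?G p" if p: "prm A p" for p
    using D.mult_of.prime_irreducible[OF primeG[OF p]] prmD(1,2)[OF p] by simp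
  have wf: "\<exists>fs u. set fs \<subseteq> carrier ?G \<and> wfactors ?G fs a \<and> (\<forall>f\<in>set fs. prm A f)
     \<and> u \<in> A \<and> dv A u \<one> \<and> a = u \<otimes> prd fs" if a: "a \<in> carrier ?G" for a
  proof -
    obtain u ps where u: "u \<in> A" "dv A u \<one>" "\<forall>p\<in>set ps. prm A p" "a = u \<otimes> prd ps"
      using assms a unfolding ufd_def by auto
    have psA: "set ps \<subseteq> A" using u(3) prmD(1) by auto
    note pA = prd_closed[OF A psA]
    have c: "u \<in> carrier R" "prd ps \<in> carrier R" using u pA subring_closed(1)[OF A] by auto
    have nz: "a \<noteq> \<zero>" "prd ps \<noteq> \<zero>" "u \<noteq> \<zero>" using a u c by auto
    have "prd ps divides\<^bsub>?G\<^esub> a" using dvG[OF pA] a u(1,4) c by (auto intro!: dvI simp: m_comm)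
    moreover have "a divides\<^bsub>?G\<^esub> prd ps"
    proof -
      obtain v where v: "v \<in> A" "\<one> = u \<otimes> v" using u unfolding dv_def by auto
      have vc: "v \<in> carrier R" using v subring_closed(1)[OF A] by auto
      have "a \<otimes> v = (u \<otimes> v) \<otimes> prd ps" unfolding u(4) using vc c by (simp add: m_ac)
      then have "prd ps = a \<otimes> v" using v(2)[symmetric] c by simp
      then show ?thesis using dvG[OF _ pA nz(2)] v(1) a dvI by auto
    qed
    ultimately have "wfactors ?G ps a" unfolding wfactors_def associated_def using irr u(3) by simp
    moreover have "set ps \<subseteq> carrier ?G" using psA u(3) prmD(2) by auto
    ultimately show ?thesis using u by blast
  qed
  have pc: "primeness_condition_monoid ?G"
  proof (intro primeness_condition_monoid.intro primeness_condition_monoid_axioms.intro)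
    show "comm_monoid_cancel ?G" by (rule D.mult_of.is_comm_monoid_cancel)
    fix a assume a: "a \<in> carrier ?G" "irreducible ?G a"
    obtain fs u where fs: "set fs \<subseteq> carrier ?G" "wfactors ?G fs a" "\<forall>f\<in>set fs. prm A f"
      and u: "u \<in> A" "dv A u \<one>" "a = u \<otimes> prd fs" using wf[OF a(1)] by blast
    have au: "a \<notin> Units ?G" using a(2) unfolding irreducible_def by blast
    have "fs \<noteq> []"
      using au unitG[of a] a(1) u subring_closed(1)[OF A] by auto
    then obtain p ps where p: "fs = p # ps" by (cases fs) auto
    have pp: "prm A p" "p \<in> carrier ?G" using fs p by auto
    have "p divides\<^bsub>?G\<^esub> a" using D.mult_of.wfactors_dividesI[OF fs(2,1) a(1)] p by simp
    moreover have "p \<notin> Units ?G" using primeG[OF pp(1)] unfolding prime_def by blast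
    ultimately have "a divides\<^bsub>?G\<^esub> p" using a(2) pp(2) unfolding irreducible_def properfactor_def by blast
    then have "p \<sim>\<^bsub>?G\<^esub> a" unfolding associated_def using \<open>p divides\<^bsub>?G\<^esub> a\<close> by blast
    then show "prime ?G a" using D.mult_of.prime_cong[OF primeG[OF pp(1)] _ pp(2) a(1)] by blast
  qed
  have "factorial_monoid ?G"
  proof (rule D.mult_of.factorial_monoidI)
    show "\<exists>fs. set fs \<subseteq> carrier ?G \<and> wfactors ?G fs a" if "a \<in> carrier ?G" for a using wf[OF that] by blast
    show "essentially_equal ?G fs fs'"
      if "a \<in> carrier ?G" "set fs \<subseteq> carrier ?G" "set fs' \<subseteq> carrier ?G" "wfactors ?G fs a" "wfactors ?G fs' a" for a fs fs'
      using primeness_condition_monoid.wfactors_unique[OF pc] that by blast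
  qed
  then show ?thesis unfolding factorial_domain_def using D.domain_axioms by blast
qed

subsection \<open>Prime elements and changes of the transcendental element\<close>

lemma exring_laur:
  assumes "subring A R" "t \<in> carrier R" "t \<noteq> \<zero>" "f \<in> A"
  shows "exring A t f \<subseteq> laur A t"
proof -
  note L = laur_subring[OF assms(1,2)] and m = laur_mem[OF assms(1-3)]
  show ?thesis
    by (rule exring_least[OF L m(3,1) subring_closed(4)[OF L subsetD[OF m(3) assms(4)] m(2)]])
qed

text \<open>A constant factor cannot remove a pole at \<open>t\<close>: the lowest coefficient of
  the polar part would be annihilated by the nonzero \<open>f\<close>.\<close>

lemma laur_const_cancel:
  assumes "subring A R" "trans A t" "f \<in> A" "f \<noteq> \<zero>" "z \<in> laur A t" "f \<otimes> z \<in> adj A t"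
  shows "z \<in> adj A t"
proof -
  note t = transD(1,2)[OF assms(2)] and A = subring_closed[OF assms(1)]
  note P = subring_closed[OF adj_subring[OF assms(1) t(1)]]
  obtain n :: nat where z: "z \<in> carrier R" "z \<otimes> t [^] n \<in> adj A t" using assms(5) laurE by blast
  have f: "f \<in> carrier R" using A assms by blast
  show ?thesis using z(2)
  proof (induct n)
    case (Suc n)
    obtain q r where q: "q \<in> adj A t" "r \<in> A" "z \<otimes> t [^] Suc n = q \<otimes> t \<oplus> r"
      using adj_cases[OF assms(1) t(1) Suc(2)] by blast
    have c: "q \<in> carrier R" "r \<in> carrier R" "t [^] n \<in> carrier R" using q A(1) P(1) t by auto
    have qf: "f \<otimes> q \<in> adj A t" using P(4)[OF adj_incl[OF assms(1) t(1) assms(3)] q(1)] .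
    have "(f \<otimes> q) \<otimes> t \<oplus> f \<otimes> r = f \<otimes> (q \<otimes> t \<oplus> r)" using c f t by algebra
    also have "\<dots> = ((f \<otimes> z) \<otimes> t [^] n) \<otimes> t \<oplus> \<zero>" unfolding q(3)[symmetric] using f z t by (simp add: m_assoc)
    finally have "(f \<otimes> q) \<otimes> t \<oplus> f \<otimes> r = ((f \<otimes> z) \<otimes> t [^] n) \<otimes> t \<oplus> \<zero>" .
    from trans_unique(2)[OF assms(1,2) qf P(4)[OF assms(6) P(8)[OF adj_mem[OF assms(1) t(1)]]]
        A(4)[OF assms(3) q(2)] A(2) this]
    have "r = \<zero>" using assms(4) f c by (simp add: integral_iff)
    then have "(z \<otimes> t [^] n) \<otimes> t = q \<otimes> t" using q(3) z t c by (simp add: m_assoc)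
    then have zq: "z \<otimes> t [^] n = q" using cancel_nonzero[OF t, of "z \<otimes> t [^] n" q] z(1) c by simp
    show ?case using q(1) by (intro Suc(1)) (simp only: zq)
  qed (use z in simp)
qed

text \<open>Modulo \<open>f/u\<close> the ring \<open>A[u, f/u]\<close> becomes
  \<open>(A/f)[u]\<close>; this is the injectivity part. If \<open>p = (f/u) d\<close>, then
  \<open>f d = p u\<close>, so \<open>d\<close> is a polynomial in \<open>u\<close>, and comparison
  of coefficients removes the factor \<open>u\<close>.\<close>

lemma exring_dv_adj:
  assumes "subring A R" "trans A u" "f \<in> A" "f \<noteq> \<zero>" "p \<in> adj A u" "dv (exring A u f) (f \<otimes> inv u) p"
  shows "dv (adj A u) f p"
proof -
  note t = transD(1,2)[OF assms(2)] and A = subring_closed[OF assms(1)]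
  note P = subring_closed[OF adj_subring[OF assms(1) t(1)]]
  have f: "f \<in> carrier R" using A assms by blast
  note i = inv_quot[OF f assms(4) t]
  obtain d where d: "d \<in> exring A u f" "p = (f \<otimes> inv u) \<otimes> d" using assms(6) unfolding dv_def by auto
  have dL: "d \<in> laur A u" using exring_laur[OF assms(1) t assms(3)] d by blast
  have dc: "d \<in> carrier R" using dL laur_carrier by blast
  have fd: "f \<otimes> d = p \<otimes> u"
  proof -
    have "p \<otimes> u = ((f \<otimes> inv u) \<otimes> u) \<otimes> d" unfolding d(2) using i(1) dc t by (simp add: m_ac)
    then show ?thesis using i(4) by simp
  qed
  then have "f \<otimes> d \<in> adj A u" using adj_lin[OF assms(1) t(1) assms(5)] by simp
  then have "d \<in> adj A u" using laur_const_cancel[OF assms(1-4) dL] by blast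
  then obtain q r where q: "q \<in> adj A u" "r \<in> A" "d = q \<otimes> u \<oplus> r" using adj_cases[OF assms(1) t(1)] by blast
  have c: "q \<in> carrier R" "r \<in> carrier R" "p \<in> carrier R" using q A(1) P(1) assms(5) by auto
  have "(f \<otimes> q) \<otimes> u \<oplus> f \<otimes> r = f \<otimes> d" unfolding q(3) using c f t by algebra
  also have "\<dots> = p \<otimes> u \<oplus> \<zero>" using fd c t by simp
  finally have e: "(f \<otimes> q) \<otimes> u \<oplus> f \<otimes> r = p \<otimes> u \<oplus> \<zero>" .
  have "f \<otimes> q = p"
    using trans_unique(1)[OF assms(1,2) P(4)[OF adj_incl[OF assms(1) t(1) assms(3)] q(1)] assms(5)
        A(4)[OF assms(3) q(2)] A(2) e] .
  then show ?thesis using q(1) dvI by blast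
qed

text \<open>The quotient by \<open>f/u\<close> is \<open>(A/f)[u]\<close>, a domain. Concretely,
  each element is a polynomial in \<open>u\<close> up to a multiple of \<open>f/u\<close>;
  \<open>exring_dv_adj\<close> moves the divisibility to \<open>adj A u\<close>, where
  \<open>prm_adj\<close> applies.\<close>

lemma prm_exring:
  assumes "subring A R" "trans A u" "prm A f"
  shows "prm (exring A u f) (f \<otimes> inv u)"
proof -
  note t = transD(1,2)[OF assms(2)] and A = subring_closed[OF assms(1)] and f = prmD[OF assms(3)]
  note PS = adj_subring[OF assms(1) t(1)] note P = subring_closed[OF PS]
  note DS = exring_subring[OF assms(1) t f(1)] note D = subring_closed[OF DS]
  note m = exring_mem[OF assms(1) t f(1)]
  have fc: "f \<in> carrier R" using A f by blast
  note i = inv_quot[OF fc f(2) t]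
  let ?t = "f \<otimes> inv u"
  note PR = prm_adj[OF assms]
  have split: "\<exists>k\<in>exring A u f. \<exists>p\<in>adj A u. z = k \<otimes> ?t \<oplus> p" if z: "z \<in> exring A u f" for z
    using adj_cases[OF PS i(1) z[unfolded exring_def]] unfolding exring_def by metis
  have fdv: "dv (exring A u f) ?t p" if p: "dv (adj A u) f p" for p
  proof -
    obtain d where d: "d \<in> adj A u" "p = f \<otimes> d" using p unfolding dv_def by auto
    have dc: "d \<in> carrier R" using d P(1) by blast
    have "?t \<otimes> (u \<otimes> d) = (?t \<otimes> u) \<otimes> d" using i(1) t dc by (simp add: m_assoc)
    then have "p = ?t \<otimes> (u \<otimes> d)" unfolding d(2) using i(4) by simp
    moreover have "u \<otimes> d \<in> exring A u f" using D(4)[OF m(3)] d m(1) by blast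
    ultimately show ?thesis using dvI by blast
  qed
  show ?thesis unfolding prm_def
  proof (intro conjI ballI impI)
    show "?t \<in> exring A u f" "?t \<noteq> \<zero>" using m i by auto
    show "\<not> dv (exring A u f) ?t \<one>"
      using exring_dv_adj[OF assms(1,2) f(1,2) P(3)] prmD(3)[OF PR] by blast
    fix z w assume zw: "z \<in> exring A u f" "w \<in> exring A u f" "dv (exring A u f) ?t (z \<otimes> w)"
    obtain k p where k: "k \<in> exring A u f" "p \<in> adj A u" "z = k \<otimes> ?t \<oplus> p" using split[OF zw(1)] by blast
    obtain l q where l: "l \<in> exring A u f" "q \<in> adj A u" "w = l \<otimes> ?t \<oplus> q" using split[OF zw(2)] by blast
    have c: "k \<in> carrier R" "l \<in> carrier R" "p \<in> carrier R" "q \<in> carrier R" "z \<in> carrier R" "w \<in> carrier R"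
      using k l zw D(1) P(1) by auto
    have kd: "dv (exring A u f) ?t (k \<otimes> ?t)" "dv (exring A u f) ?t (l \<otimes> ?t)"
      using dvI[OF k(1) m_comm[OF c(1) i(1)]] dvI[OF l(1) m_comm[OF c(2) i(1)]] by auto
    have pq: "p \<in> exring A u f" "q \<in> exring A u f" using k l m(1) by auto
    have pq': "p \<otimes> q = (z \<otimes> w \<ominus> (k \<otimes> ?t) \<otimes> w) \<ominus> (l \<otimes> ?t) \<otimes> p" unfolding k(3) l(3) using c i(1) by algebra
    have kt: "k \<otimes> ?t \<in> exring A u f" "l \<otimes> ?t \<in> exring A u f" using D(4) k l m by auto
    have "dv (exring A u f) ?t (p \<otimes> q)" unfolding pq'
      using dv_add(2)[OF DS m(4) dv_add(2)[OF DS m(4) zw(3) dv_mult(1)[OF DS m(4) kt(1) zw(2) kd(1)]]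
        dv_mult(1)[OF DS m(4) kt(2) pq(1) kd(2)]] .
    then have "dv (adj A u) f (p \<otimes> q)" using exring_dv_adj[OF assms(1,2) f(1,2) P(4)[OF k(2) l(2)]] by blast
    then have "dv (adj A u) f p \<or> dv (adj A u) f q" using prmD(4)[OF PR k(2) l(2)] by blast
    then show "dv (exring A u f) ?t z \<or> dv (exring A u f) ?t w"
      using fdv dv_add(1)[OF DS m(4) kd(1)] dv_add(1)[OF DS m(4) kd(2)] k(3) l(3) by blast
  qed
qed

section \<open>Transcendence under inversion, scaling and reordering\<close>

text \<open>Polynomials of degree at most \<open>n\<close>. A degree bound enters because replacing
  \<open>t\<close> by its inverse reverses the coefficients.\<close>

fun bdeg :: "'a set \<Rightarrow> 'a \<Rightarrow> nat \<Rightarrow> 'a set" where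
  "bdeg A t 0 = A"
| "bdeg A t (Suc n) = {w \<otimes> t \<oplus> g | w g. w \<in> bdeg A t n \<and> g \<in> A}"

lemma bdeg_subset:
  assumes "subring A R" "t \<in> carrier R"
  shows "bdeg A t n \<subseteq> adj A t"
proof (induct n)
  case 0
  then show ?case using adj_incl[OF assms] by auto
next
  case (Suc n)
  then show ?case using simple_extension.lin[of _ A t] by auto
qed

lemma bdeg_Suc:
  assumes "subring A R" "t \<in> carrier R"
  shows "a \<in> bdeg A t n \<Longrightarrow> a \<in> bdeg A t (Suc n)"
proof (induct n arbitrary: a)
  case 0
  then have "a = \<zero> \<otimes> t \<oplus> a" "a \<in> A" "\<zero> \<in> A" using subring_closed[OF assms(1)] assms(2) by auto
  then show ?case unfolding bdeg.simps by blast
next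
  case (Suc n)
  then obtain w g where "a = w \<otimes> t \<oplus> g" "w \<in> bdeg A t n" "g \<in> A" by auto
  then show ?case using Suc(1) by (subst bdeg.simps(2)) blast
qed

lemma bdeg_monom:
  assumes "subring A R" "t \<in> carrier R" "r \<in> A"
  shows "r \<otimes> t [^] n \<in> bdeg A t n"
proof (induct n)
  case 0
  then show ?case using assms subring_closed(1)[OF assms(1)] by simp
next
  case (Suc n)
  have "r \<in> carrier R" using assms subring_closed(1) by blast
  then have "r \<otimes> t [^] Suc n = (r \<otimes> t [^] n) \<otimes> t \<oplus> \<zero>" using assms by (simp add: m_assoc)
  then show ?case using Suc subring_closed(2)[OF assms(1)] unfolding bdeg.simps(2) by blast
qed

lemma bdeg_add:
  assumes "subring A R" "t \<in> carrier R"
  shows "a \<in> bdeg A t n \<Longrightarrow> b \<in> bdeg A t n \<Longrightarrow> a \<oplus> b \<in> bdeg A t n"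
proof (induct n arbitrary: a b)
  case 0
  then show ?case using subring_closed(5)[OF assms(1)] by simp
next
  case (Suc n)
  obtain w g where a: "a = w \<otimes> t \<oplus> g" "w \<in> bdeg A t n" "g \<in> A" using Suc by auto
  obtain v h where b: "b = v \<otimes> t \<oplus> h" "v \<in> bdeg A t n" "h \<in> A" using Suc by auto
  have c: "w \<in> carrier R" "v \<in> carrier R" "g \<in> carrier R" "h \<in> carrier R"
    using a(2,3) b(2,3) bdeg_subset[OF assms, of n] subring_closed(1)[OF adj_subring[OF assms]]
      subring_closed(1)[OF assms(1)] by auto
  have "a \<oplus> b = (w \<oplus> v) \<otimes> t \<oplus> (g \<oplus> h)" unfolding a b using c assms(2) by algebra
  then show ?case using Suc(1)[OF a(2) b(2)] subring_closed(5)[OF assms(1) a(3) b(3)] by auto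
qed

lemma bdeg_top:
  assumes "subring A R" "trans A t" "r \<in> A"
  shows "b \<in> bdeg A t n \<Longrightarrow> b \<oplus> r \<otimes> t [^] Suc n = \<zero> \<Longrightarrow> r = \<zero>"
proof (induct n arbitrary: b)
  case 0
  note t = transD(1,2)[OF assms(2)]
  have c: "b \<in> carrier R" "r \<in> carrier R" using 0 assms subring_closed(1)[OF assms(1)] by auto
  have "r \<otimes> t \<oplus> b = \<zero>" using 0 c t by (simp add: a_comm)
  then show ?case using trans_zero(1)[OF assms(1,2) adj_incl[OF assms(1) t(1) assms(3)]] 0(1) by simp
next
  case (Suc n)
  note t = transD(1,2)[OF assms(2)]
  obtain w g where a: "b = w \<otimes> t \<oplus> g" "w \<in> bdeg A t n" "g \<in> A" using Suc by auto
  have wA: "w \<in> adj A t" using a(2) bdeg_subset[OF assms(1) t(1)] by blast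
  note PS = adj_subring[OF assms(1) t(1)]
  have c: "w \<in> carrier R" "g \<in> carrier R" "r \<in> carrier R"
    using a(3) wA assms(3) subring_closed(1)[OF PS] subring_closed(1)[OF assms(1)] by auto
  have pA: "r \<otimes> t [^] Suc n \<in> adj A t"
    using bdeg_monom[OF assms(1) t(1) assms(3)] bdeg_subset[OF assms(1) t(1)] by blast
  have "(w \<oplus> r \<otimes> t [^] Suc n) \<otimes> t \<oplus> g = (w \<otimes> t \<oplus> g) \<oplus> r \<otimes> (t [^] Suc n \<otimes> t)"
    using c t(1) nat_pow_closed[OF t(1), of "Suc n"] by algebra
  also have "\<dots> = \<zero>" using Suc(3) a(1) by simp
  finally have "w \<oplus> r \<otimes> t [^] Suc n = \<zero>"
    using trans_zero(1)[OF assms(1,2) subring_closed(5)[OF PS wA pA] a(3)] by blast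
  then show ?case using Suc(1)[OF a(2)] by blast
qed

text \<open>A relation in the inverse of \<open>t\<close>, multiplied by a high power of
  \<open>t\<close>, becomes one in \<open>t\<close> whose leading coefficient is the former constant
  term; \<open>bdeg_top\<close> makes it vanish.\<close>

lemma trans_inv:
  assumes "subring A R" "trans A t"
  shows "trans A (inv t)"
  unfolding trans_def
proof (intro conjI ballI impI)
  note t = transD(1,2)[OF assms(2)] note i = inv_nonzero[OF t]
  show "inv t \<in> carrier R" "inv t \<noteq> \<zero>" using i by auto
  have bd: "\<exists>n. p \<otimes> t [^] n \<in> bdeg A t n" if "p \<in> adj A (inv t)" for p
    using that
  proof (induct rule: simple_extension.induct)
    case zero
    show ?case using subring_closed(2)[OF assms(1)] by (intro exI[of _ 0]) simp
  next
    case (lin k r)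
    then obtain n where n: "k \<otimes> t [^] n \<in> bdeg A t n" by blast
    have c: "k \<in> carrier R" "r \<in> carrier R"
      using lin subring_closed(1)[OF adj_subring[OF assms(1) i(1)]] subring_closed(1)[OF assms(1)] by auto
    have "(k \<otimes> inv t \<oplus> r) \<otimes> (t [^] n \<otimes> t) = (k \<otimes> t [^] n) \<otimes> (inv t \<otimes> t) \<oplus> r \<otimes> (t [^] n \<otimes> t)"
      using c i(1) t(1) nat_pow_closed[OF t(1), of n] by algebra
    then have "(k \<otimes> inv t \<oplus> r) \<otimes> t [^] Suc n = k \<otimes> t [^] n \<oplus> r \<otimes> t [^] Suc n"
      using c i(3) t by simp
    also have "\<dots> \<in> bdeg A t (Suc n)"
      using bdeg_add[OF assms(1) t(1) bdeg_Suc[OF assms(1) t(1) n] bdeg_monom[OF assms(1) t(1) lin(3)]] .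
    finally show ?case by blast
  qed
  fix r p assume rp: "r \<in> A" "p \<in> adj A (inv t)" "p \<otimes> inv t \<oplus> r = \<zero>"
  obtain n where n: "p \<otimes> t [^] n \<in> bdeg A t n" using bd[OF rp(2)] by blast
  have c: "p \<in> carrier R" "r \<in> carrier R"
    using rp subring_closed(1)[OF adj_subring[OF assms(1) i(1)]] subring_closed(1)[OF assms(1)] by auto
  have "(p \<otimes> inv t \<oplus> r) \<otimes> (t [^] n \<otimes> t) = (p \<otimes> t [^] n) \<otimes> (inv t \<otimes> t) \<oplus> r \<otimes> (t [^] n \<otimes> t)"
    using c i(1) t(1) nat_pow_closed[OF t(1), of n] by algebra
  then have "p \<otimes> t [^] n \<oplus> r \<otimes> t [^] Suc n = \<zero>" using rp(3) c i(3) t by simp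
  then show "r = \<zero>" using bdeg_top[OF assms rp(1) n] by blast
qed

lemma trans_mult:
  assumes "subring A R" "trans A t" "f \<in> A" "f \<noteq> \<zero>"
  shows "trans A (f \<otimes> t)"
  unfolding trans_def
proof (intro conjI ballI impI)
  note t = transD(1,2)[OF assms(2)]
  note PS = adj_subring[OF assms(1) t(1)]
  have f: "f \<in> carrier R" using assms subring_closed(1) by blast
  show "f \<otimes> t \<in> carrier R" "f \<otimes> t \<noteq> \<zero>" using f t assms(4) by (auto simp: integral_iff)
  have fP: "f \<in> adj A t" using adj_incl[OF assms(1) t(1) assms(3)] .
  have sub: "adj A (f \<otimes> t) \<subseteq> adj A t"
    using adj_least[OF PS] adj_incl[OF assms(1) t(1)] subring_closed(4)[OF PS fP adj_mem[OF assms(1) t(1)]] by blast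
  fix r p assume rp: "r \<in> A" "p \<in> adj A (f \<otimes> t)" "p \<otimes> (f \<otimes> t) \<oplus> r = \<zero>"
  have pP: "p \<in> adj A t" using rp sub by blast
  have "p \<in> carrier R" using pP subring_closed(1)[OF PS] by blast
  then have "(p \<otimes> f) \<otimes> t \<oplus> r = \<zero>" using rp(3) f t by (simp add: m_assoc)
  then show "r = \<zero>" using transD(3)[OF assms(2) rp(1) subring_closed(4)[OF PS pP fP]] by blast
qed

lemma trans_quot:
  assumes "subring A R" "trans A t" "f \<in> A" "f \<noteq> \<zero>"
  shows "trans A (f \<otimes> inv t)"
  using trans_mult[OF assms(1) trans_inv[OF assms(1,2)] assms(3,4)] .

text \<open>Independence does not depend on the order of adjunction. Sorting
  \<open>p \<otimes> x \<oplus> r\<close> by powers of \<open>z\<close>, transcendence of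
  \<open>z\<close> over \<open>adj A x\<close> kills each coefficient; the constant one is a
  relation for \<open>x\<close> over \<open>A\<close>, and induction over \<open>r\<close> handles
  the rest.\<close>

lemma trans_exchange:
  assumes "subring A R" "trans A x" "trans (adj A x) z"
  shows "trans (adj A z) x"
proof -
  note x = transD(1,2)[OF assms(2)] and z = transD(1,2)[OF assms(3)]
  note PS = adj_subring[OF assms(1) x(1)] and ZS = adj_subring[OF assms(1) z(1)]
  note QS = adj_subring[OF PS z(1)]
  have "r = \<zero>" if "r \<in> adj A z" "p \<in> adj (adj A x) z" "p \<otimes> x \<oplus> r = \<zero>" for r p
    using that
  proof (induct arbitrary: p rule: simple_extension.induct)
    case (lin r1 r0)
    obtain p1 p0 where p: "p1 \<in> adj (adj A x) z" "p0 \<in> adj A x" "p = p1 \<otimes> z \<oplus> p0"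
      using adj_cases[OF PS z(1) lin(4)] by blast
    have c: "p1 \<in> carrier R" "p0 \<in> carrier R" "r1 \<in> carrier R" "r0 \<in> carrier R"
      using p lin(1,3) subring_closed(1)[OF PS] subring_closed(1)[OF QS] subring_closed(1)[OF ZS]
        subring_closed(1)[OF assms(1)] by auto
    have r1Q: "r1 \<in> adj (adj A x) z"
      using adj_mono[of A "adj A x" z] adj_incl[OF assms(1) x(1)] lin(1) by blast
    have xQ: "x \<in> adj (adj A x) z" using adj_incl[OF PS z(1)] adj_mem[OF assms(1) x(1)] by blast
    have 1: "p1 \<otimes> x \<oplus> r1 \<in> adj (adj A x) z"
      using subring_closed(5)[OF QS subring_closed(4)[OF QS p(1) xQ] r1Q] .
    have 2: "p0 \<otimes> x \<oplus> r0 \<in> adj A x" using simple_extension.lin[OF p(2) lin(3)] .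
    have "(p1 \<otimes> x \<oplus> r1) \<otimes> z \<oplus> (p0 \<otimes> x \<oplus> r0) = p \<otimes> x \<oplus> (r1 \<otimes> z \<oplus> r0)"
      unfolding p(3) using c x(1) z(1) by algebra
    then have "(p1 \<otimes> x \<oplus> r1) \<otimes> z \<oplus> (p0 \<otimes> x \<oplus> r0) = \<zero>" using lin(5) by simp
    from trans_zero[OF PS assms(3) 1 2 this]
    have e: "p1 \<otimes> x \<oplus> r1 = \<zero>" "p0 \<otimes> x \<oplus> r0 = \<zero>" by auto
    have "r1 = \<zero>" using lin(2)[OF p(1) e(1)] .
    moreover have "r0 = \<zero>" using transD(3)[OF assms(2) lin(3) p(2) e(2)] .
    ultimately show ?case using z by simp
  qed simp
  then show ?thesis unfolding trans_def using x adj_adj_commute[OF assms(1) x(1) z(1)] by auto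
qed

lemma trans_laur:
  assumes "subring A R" "z \<in> carrier R" "z \<noteq> \<zero>" "trans (adj A z) x"
  shows "trans (laur A z) x"
proof -
  note PS = adj_subring[OF assms(1,2)]
  have "laur A z \<subseteq> frac (adj A z)"
  proof
    fix w assume "w \<in> laur A z"
    then obtain n :: nat where "w \<in> carrier R" "w \<otimes> z [^] n \<in> adj A z" using laurE by blast
    then show "w \<in> frac (adj A z)" unfolding frac_def
      using subring_closed(8)[OF PS adj_mem[OF assms(1,2)]] pow_nonzero[OF assms(2,3)] by blast
  qed
  then show ?thesis using trans_mono[OF trans_frac[OF PS assms(4)]] by blast
qed

text \<open>\<open>pev A s t\<close> consists of the pairs \<open>(p(s), p(t))\<close> for polynomials \<open>p\<close> over \<open>A\<close>.\<close>

inductive_set pev :: "'a set \<Rightarrow> 'a \<Rightarrow> 'a \<Rightarrow> ('a \<times> 'a) set" for A s t where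
  zero: "(\<zero>, \<zero>) \<in> pev A s t"
| lin: "(a, b) \<in> pev A s t \<Longrightarrow> r \<in> A \<Longrightarrow> (a \<otimes> s \<oplus> r, b \<otimes> t \<oplus> r) \<in> pev A s t"

lemma pev_adj: "(a, b) \<in> pev A s t \<Longrightarrow> a \<in> adj A s \<and> b \<in> adj A t"
  by (induct rule: pev.induct) (auto intro: simple_extension.lin)

lemma pev_ex: "a \<in> adj A s \<Longrightarrow> \<exists>b. (a, b) \<in> pev A s t"
  by (induct rule: simple_extension.induct) (auto intro: pev.intros)

lemma pev_sym: "(a, b) \<in> pev A s t \<Longrightarrow> (b, a) \<in> pev A t s"
  by (induct rule: pev.induct) (auto intro: pev.intros)

context
  fixes A s t
  assumes A: "subring A R" and s: "s \<in> carrier R" and t: "t \<in> carrier R"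
begin

lemma pev_carrier: "(a, b) \<in> pev A s t \<Longrightarrow> a \<in> carrier R" "(a, b) \<in> pev A s t \<Longrightarrow> b \<in> carrier R"
  using pev_adj subring_closed(1)[OF adj_subring[OF A s]] subring_closed(1)[OF adj_subring[OF A t]] by blast+

lemma pev_const:
  assumes "r \<in> A"
  shows "(r, r) \<in> pev A s t"
  using pev.lin[OF pev.zero assms, of s t] s t subring_closed(1)[OF A assms] by simp

lemma pev_shift:
  assumes "(a, b) \<in> pev A s t"
  shows "(a \<otimes> s, b \<otimes> t) \<in> pev A s t"
  using pev.lin[OF assms subring_closed(2)[OF A]] s t pev_carrier[OF assms] by simp

lemma pev_add: "(a, b) \<in> pev A s t \<Longrightarrow> (c, d) \<in> pev A s t \<Longrightarrow> (a \<oplus> c, b \<oplus> d) \<in> pev A s t"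
proof (induct arbitrary: c d rule: pev.induct)
  case zero
  then show ?case using pev_carrier[OF zero] by simp
next
  case (lin a b r)
  from lin(4) show ?case
  proof (cases rule: pev.cases)
    case zero
    then show ?thesis using pev.lin[OF lin(1,3)] pev_carrier[OF pev.lin[OF lin(1,3)]] by simp
  next
    case (lin a' b' r')
    have c: "a \<in> carrier R" "b \<in> carrier R" "a' \<in> carrier R" "b' \<in> carrier R" "r \<in> carrier R" "r' \<in> carrier R"
      using pev_carrier \<open>(a, b) \<in> pev A s t\<close> lin(3) subring_closed(1)[OF A] lin(4) \<open>r \<in> A\<close> by auto
    have "(a \<otimes> s \<oplus> r) \<oplus> c = (a \<oplus> a') \<otimes> s \<oplus> (r \<oplus> r')" "(b \<otimes> t \<oplus> r) \<oplus> d = (b \<oplus> b') \<otimes> t \<oplus> (r \<oplus> r')"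
      unfolding lin(1,2) using c s t by algebra+
    then show ?thesis
      using pev.lin[OF \<open>\<And>c d. (c, d) \<in> pev A s t \<Longrightarrow> (a \<oplus> c, b \<oplus> d) \<in> pev A s t\<close>[OF lin(3)]
          subring_closed(5)[OF A \<open>r \<in> A\<close> lin(4)]] by simp
  qed
qed

lemma pev_smult:
  assumes "r \<in> A"
  shows "(a, b) \<in> pev A s t \<Longrightarrow> (r \<otimes> a, r \<otimes> b) \<in> pev A s t"
proof (induct rule: pev.induct)
  case zero
  then show ?case using subring_closed(1)[OF A assms] by (simp add: pev.zero)
next
  case (lin a b q)
  have c: "a \<in> carrier R" "b \<in> carrier R" "q \<in> carrier R" "r \<in> carrier R"
    using pev_carrier[OF lin(1)] lin(3) assms subring_closed(1)[OF A] by auto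
  have "r \<otimes> (a \<otimes> s \<oplus> q) = (r \<otimes> a) \<otimes> s \<oplus> r \<otimes> q" "r \<otimes> (b \<otimes> t \<oplus> q) = (r \<otimes> b) \<otimes> t \<oplus> r \<otimes> q"
    using c s t by algebra+
  then show ?case using pev.lin[OF lin(2) subring_closed(4)[OF A assms lin(3)]] by simp
qed

lemma pev_mult: "(a, b) \<in> pev A s t \<Longrightarrow> (c, d) \<in> pev A s t \<Longrightarrow> (a \<otimes> c, b \<otimes> d) \<in> pev A s t"
proof (induct rule: pev.induct)
  case zero
  then show ?case using pev_carrier[OF zero] by (simp add: pev.zero)
next
  case (lin a b r)
  have c: "a \<in> carrier R" "b \<in> carrier R" "r \<in> carrier R" "c \<in> carrier R" "d \<in> carrier R"
    using pev_carrier[OF lin(1)] pev_carrier[OF lin(4)] lin(3) subring_closed(1)[OF A] by auto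
  have "(a \<otimes> s \<oplus> r) \<otimes> c = (a \<otimes> c) \<otimes> s \<oplus> r \<otimes> c" "(b \<otimes> t \<oplus> r) \<otimes> d = (b \<otimes> d) \<otimes> t \<oplus> r \<otimes> d"
    using c s t by algebra+
  then show ?case using pev_add[OF pev_shift[OF lin(2)[OF lin(4)]] pev_smult[OF lin(3,4)]] by simp
qed

lemma pev_pow: "(a, b) \<in> pev A s t \<Longrightarrow> (a [^] (n::nat), b [^] n) \<in> pev A s t"
  by (induct n) (auto intro: pev_mult pev_const subring_closed(3)[OF A])

lemma pev_var: "(s, t) \<in> pev A s t"
  using pev_shift[OF pev_const[OF subring_closed(3)[OF A]]] s t by simp

lemma pev_minus:
  assumes "(a, b) \<in> pev A s t" "(c, d) \<in> pev A s t"
  shows "(a \<ominus> c, b \<ominus> d) \<in> pev A s t"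
proof -
  have c: "a \<in> carrier R" "b \<in> carrier R" "c \<in> carrier R" "d \<in> carrier R" using pev_carrier assms by auto
  have "a \<ominus> c = a \<oplus> (\<ominus> \<one>) \<otimes> c" "b \<ominus> d = b \<oplus> (\<ominus> \<one>) \<otimes> d" using c by algebra+
  then show ?thesis
    using pev_add[OF assms(1) pev_smult[OF subring_closed(7)[OF A subring_closed(3)[OF A]] assms(2)]] by simp
qed

text \<open>A polynomial vanishing at the transcendental \<open>s\<close> has only zero
  coefficients, hence vanishes at \<open>t\<close>. This makes \<open>pev\<close> the graph of a
  function (\<open>pev_fun\<close>), the substitution of \<open>t\<close> for
  \<open>s\<close>.\<close>

lemma pev_zero:
  assumes "trans A s"
  shows "(a, b) \<in> pev A s t \<Longrightarrow> a = \<zero> \<Longrightarrow> b = \<zero>"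
proof (induct rule: pev.induct)
  case (lin a b r)
  then show ?case using trans_zero[OF A assms _ lin(3,4)] pev_adj t by auto
qed simp

lemma pev_fun:
  assumes "trans A s" "(a, b) \<in> pev A s t" "(a, c) \<in> pev A s t"
  shows "b = c"
proof -
  have c: "a \<in> carrier R" "b \<in> carrier R" "c \<in> carrier R" using pev_carrier assms by auto
  have "b \<ominus> c = \<zero>" using pev_zero[OF assms(1) pev_minus[OF assms(2,3)]] c by simp
  then show ?thesis using c by (simp add: r_right_minus_eq)
qed

text \<open>The factor theorem. It serves both to describe divisibility by a linear polynomial and
  to show that arguments congruent modulo an element have congruent values.\<close>

lemma pev_diff:
  assumes "subring B R" "A \<subseteq> B" "s \<in> B" "t \<in> B"
  shows "(a, b) \<in> pev A s t \<Longrightarrow> \<exists>d\<in>B. a = b \<oplus> (s \<ominus> t) \<otimes> d"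
proof (induct rule: pev.induct)
  case zero
  show ?case using subring_closed(2)[OF assms(1)] s t by (intro bexI[of _ \<zero>]) auto
next
  case (lin a b r)
  then obtain d where d: "d \<in> B" "a = b \<oplus> (s \<ominus> t) \<otimes> d" by blast
  have bB: "b \<in> B" using pev_adj[OF lin(1)] adj_least[OF assms(1,2,4)] by blast
  have c: "b \<in> carrier R" "d \<in> carrier R" "r \<in> carrier R" using bB d lin(3) assms(2) subring_closed(1)[OF assms(1)] by auto
  have "a \<otimes> s \<oplus> r = (b \<otimes> t \<oplus> r) \<oplus> (s \<ominus> t) \<otimes> (d \<otimes> s \<oplus> b)" unfolding d(2) using c s t by algebra
  moreover have "d \<otimes> s \<oplus> b \<in> B"
    using subring_closed(5)[OF assms(1) subring_closed(4)[OF assms(1) d(1) assms(3)] bB] .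
  ultimately show ?case by blast
qed

end

text \<open>Divisibility by \<open>y \<ominus> c\<close> means vanishing under the substitution of
  \<open>c\<close> for \<open>y\<close>, whose values lie in a field. As \<open>c\<close> is
  nonzero, powers of \<open>y\<close> do not vanish, so the argument survives inverting
  \<open>y\<close>.\<close>

lemma prm_linear:
  assumes "subring E R" "trans E y" "c \<in> E" "c \<noteq> \<zero>"
  shows "prm (laur E y) (y \<ominus> c)"
proof -
  note y = transD(1,2)[OF assms(2)]
  have c: "c \<in> carrier R" using assms subring_closed(1) by blast
  note PS = adj_subring[OF assms(1) y(1)] and LS = laur_subring[OF assms(1) y(1)]
  note P = subring_closed[OF PS] and L = subring_closed[OF LS]
  note fn = pev_fun[OF assms(1) y(1) c assms(2)]
  note pm = pev_mult[OF assms(1) y(1) c]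
  have cP: "c \<in> adj E y" "y \<in> adj E y" using adj_incl[OF assms(1) y(1) assms(3)] adj_mem[OF assms(1) y(1)] by auto
  have fP: "y \<ominus> c \<in> adj E y" using P(6) cP by blast
  have fL: "y \<ominus> c \<in> laur E y" using fP adj_in_laur[OF assms(1) y(1)] by blast
  have cc0: "c \<ominus> c = \<zero>" using c by (simp add: a_minus_def r_neg)
  have ff: "(y \<ominus> c, \<zero>) \<in> pev E y c"
    using pev_minus[OF assms(1) y(1) c pev_var[OF assms(1) y(1) c] pev_const[OF assms(1) y(1) c assms(3)]]
    unfolding cc0 .
  have adj_dv: "dv (adj E y) (y \<ominus> c) z \<longleftrightarrow> v = \<zero>" if zv: "(z, v) \<in> pev E y c" for z v
  proof
    assume "dv (adj E y) (y \<ominus> c) z"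
    then obtain d where d: "d \<in> adj E y" "z = (y \<ominus> c) \<otimes> d" unfolding dv_def by auto
    then obtain w where w: "(d, w) \<in> pev E y c" using pev_ex by blast
    have "w \<in> carrier R" using pev_carrier[OF assms(1) y(1) c w] by simp
    then show "v = \<zero>" using fn[OF zv] pm[OF ff w] d by simp
  next
    assume "v = \<zero>"
    then obtain d where d: "d \<in> adj E y" "z = \<zero> \<oplus> (y \<ominus> c) \<otimes> d"
      using pev_diff[OF assms(1) y(1) c PS _ cP(2,1) zv] adj_incl[OF assms(1) y(1)] by blast
    then have "z = (y \<ominus> c) \<otimes> d" using c y P(1) by simp
    then show "dv (adj E y) (y \<ominus> c) z" using d dvI by blast
  qed
  have laur_dv: "dv (laur E y) (y \<ominus> c) z"
    if "dv (adj E y) (y \<ominus> c) (z \<otimes> y [^] n)" "z \<in> carrier R" for z and n :: nat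
  proof -
    from that(1) obtain d where d: "d \<in> adj E y" "z \<otimes> y [^] n = (y \<ominus> c) \<otimes> d" unfolding dv_def by auto
    have i: "inv y [^] n \<in> laur E y" using L(8) laur_mem(2)[OF assms(1) y] by blast
    have cc: "d \<in> carrier R" "inv y [^] n \<in> carrier R" "y [^] n \<in> carrier R" using d(1) P(1) L(1) i y by auto
    have "z = z \<otimes> (y [^] n \<otimes> inv y [^] n)" using that(2) inv_pow[OF y] by simp
    also have "\<dots> = (z \<otimes> y [^] n) \<otimes> inv y [^] n" using that(2) cc by (simp add: m_assoc)
    also have "\<dots> = (y \<ominus> c) \<otimes> (d \<otimes> inv y [^] n)" unfolding d(2) using cc y c by (simp add: m_assoc)
    finally show ?thesis using dvI[OF L(4)[OF subsetD[OF adj_in_laur[OF assms(1) y(1)] d(1)] i]] by blast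
  qed
  have ev: "\<exists>n::nat. \<exists>v. (z \<otimes> y [^] n, v) \<in> pev E y c" if "z \<in> laur E y" for z
    using laurE[OF that] pev_ex by metis
  have ypow: "(y [^] n, c [^] n) \<in> pev E y c" for n :: nat
    using pev_pow[OF assms(1) y(1) c pev_var[OF assms(1) y(1) c]] .
  show ?thesis unfolding prm_def
  proof (intro conjI ballI impI fL)
    show "y \<ominus> c \<noteq> \<zero>"
    proof
      assume "y \<ominus> c = \<zero>"
      then have "y = c" using y c by (simp add: r_right_minus_eq)
      then have "\<one> \<otimes> y \<oplus> \<ominus> c = \<zero>" using c by (simp add: r_neg)
      then show False
        using trans_zero(1)[OF assms(1,2) P(3) subring_closed(7)[OF assms(1,3)]] by simp
    qed
    show "\<not> dv (laur E y) (y \<ominus> c) \<one>"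
    proof
      assume "dv (laur E y) (y \<ominus> c) \<one>"
      then obtain d where d: "d \<in> laur E y" "\<one> = (y \<ominus> c) \<otimes> d" unfolding dv_def by auto
      obtain n :: nat where n: "d \<in> carrier R" "d \<otimes> y [^] n \<in> adj E y" using laurE[OF d(1)] by blast
      have "y [^] n = ((y \<ominus> c) \<otimes> d) \<otimes> y [^] n" using d(2)[symmetric] y by simp
      also have "\<dots> = (y \<ominus> c) \<otimes> (d \<otimes> y [^] n)" using n y c by (simp add: m_assoc)
      finally have "dv (adj E y) (y \<ominus> c) (y [^] n)" using n dvI by blast
      then have "c [^] n = \<zero>" using adj_dv[OF ypow] by blast
      then show False using pow_nonzero[OF c assms(4)] by blast
    qed
    fix a b assume ab: "a \<in> laur E y" "b \<in> laur E y" "dv (laur E y) (y \<ominus> c) (a \<otimes> b)"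
    obtain d where d: "d \<in> laur E y" "a \<otimes> b = (y \<ominus> c) \<otimes> d" using ab unfolding dv_def by auto
    obtain i \<alpha> where i: "(a \<otimes> y [^] (i::nat), \<alpha>) \<in> pev E y c" using ev[OF ab(1)] by blast
    obtain j \<beta> where j: "(b \<otimes> y [^] (j::nat), \<beta>) \<in> pev E y c" using ev[OF ab(2)] by blast
    obtain k \<gamma> where k: "(d \<otimes> y [^] (k::nat), \<gamma>) \<in> pev E y c" using ev[OF d(1)] by blast
    have cc: "a \<in> carrier R" "b \<in> carrier R" "d \<in> carrier R" using ab d L(1) by auto
    have vc: "\<alpha> \<in> carrier R" "\<beta> \<in> carrier R" "\<gamma> \<in> carrier R"
      using pev_carrier(2)[OF assms(1) y(1) c] i j k by auto
    have "((a \<otimes> y [^] i) \<otimes> (b \<otimes> y [^] j)) \<otimes> y [^] k = (a \<otimes> b) \<otimes> (y [^] i \<otimes> (y [^] j \<otimes> y [^] k))"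
      using cc y by (simp add: m_ac)
    also have "\<dots> = (y \<ominus> c) \<otimes> ((d \<otimes> y [^] k) \<otimes> (y [^] i \<otimes> y [^] j))"
      unfolding d(2) using cc y c by (simp add: m_ac)
    finally have e: "((a \<otimes> y [^] i) \<otimes> (b \<otimes> y [^] j)) \<otimes> y [^] k
      = (y \<ominus> c) \<otimes> ((d \<otimes> y [^] k) \<otimes> (y [^] i \<otimes> y [^] j))" .
    have "(d \<otimes> y [^] k) \<otimes> (y [^] i \<otimes> y [^] j) \<in> adj E y"
      using pev_adj[OF pm[OF k pm[OF ypow[of i] ypow[of j]]]] by blast
    then have "dv (adj E y) (y \<ominus> c) (((a \<otimes> y [^] i) \<otimes> (b \<otimes> y [^] j)) \<otimes> y [^] k)" using e dvI by blast
    then have "(\<alpha> \<otimes> \<beta>) \<otimes> c [^] k = \<zero>" using adj_dv[OF pm[OF pm[OF i j] ypow[of k]]] by blast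
    then have "\<alpha> = \<zero> \<or> \<beta> = \<zero>" using vc c pow_nonzero[OF c assms(4)] by (auto simp: integral_iff)
    then show "dv (laur E y) (y \<ominus> c) a \<or> dv (laur E y) (y \<ominus> c) b"
      using adj_dv[OF i] adj_dv[OF j] laur_dv cc by blast
  qed
qed

subsection \<open>Mutation of the rings \<open>A[t, f/t]\<close>\<close>

lemma laur_unit_inv:
  assumes "subring A R" "p \<in> carrier R" "p \<noteq> \<zero>" "v \<in> A" "w \<in> A" "v \<otimes> w = \<one>"
  shows "laur A (v \<otimes> inv p) = laur A p"
proof -
  note i = inv_nonzero[OF assms(2,3)]
  have c: "v \<in> carrier R" "w \<in> carrier R" using assms subring_closed(1) by auto
  have v0: "v \<noteq> \<zero>" using assms(6) c by auto
  note q = inv_quot[OF c(1) v0 assms(2,3)]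
  have L: "subring (laur A p) R" "subring (laur A (v \<otimes> inv p)) R" using laur_subring assms q by auto
  note m = laur_mem[OF assms(1-3)] and m' = laur_mem[OF assms(1) q(1,2)]
  have wi: "inv (v \<otimes> inv p) = w \<otimes> p"
  proof -
    have "(w \<otimes> p) \<otimes> (v \<otimes> inv p) = (v \<otimes> w) \<otimes> (p \<otimes> inv p)" using c assms(2) i(1) by (simp add: m_ac)
    then have "(w \<otimes> p) \<otimes> (v \<otimes> inv p) = \<one>" using assms(6) i by simp
    then show ?thesis using inv_unique'[of "v \<otimes> inv p" "w \<otimes> p"] q c assms(2) by (simp add: m_comm)
  qed
  have ip: "inv p = w \<otimes> (v \<otimes> inv p)"
  proof -
    have "w \<otimes> (v \<otimes> inv p) = (v \<otimes> w) \<otimes> inv p" using c i(1) by (simp add: m_ac)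
    then show ?thesis using assms(6) i by simp
  qed
  have pp: "p = v \<otimes> inv (v \<otimes> inv p)" using q(3) by simp
  show ?thesis
  proof (rule equalityI)
    show "laur A (v \<otimes> inv p) \<subseteq> laur A p"
      by (rule laur_least[OF L(1) m(3)])
        (use q m wi assms subring_closed(4)[OF L(1)] in auto)
    show "laur A p \<subseteq> laur A (v \<otimes> inv p)"
    proof (rule laur_least[OF L(2) m'(3)])
      show "p \<in> laur A (v \<otimes> inv p)" using pp subring_closed(4)[OF L(2) subsetD[OF m'(3) assms(4)] m'(2)] by simp
      show "inv p \<in> laur A (v \<otimes> inv p)" using ip subring_closed(4)[OF L(2) subsetD[OF m'(3) assms(5)] m'(1)] by simp
    qed (use assms in auto)
  qed
qed

lemma adj_laur_clear:
  assumes "subring A R" "z \<in> carrier R" "x \<in> carrier R" "b \<in> adj (laur A z) x"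
  shows "\<exists>n::nat. b \<otimes> z [^] n \<in> adj (adj A z) x"
  using assms(4)
proof (induct rule: simple_extension.induct)
  case zero
  show ?case using simple_extension.zero by (intro exI[of _ 0]) simp
next
  case (lin q r)
  note PS = adj_subring[OF assms(1,2)] note QS = adj_subring[OF PS assms(3)]
  note Q = subring_closed[OF QS]
  obtain n :: nat where n: "q \<otimes> z [^] n \<in> adj (adj A z) x" using lin by blast
  obtain m :: nat where m: "r \<in> carrier R" "r \<otimes> z [^] m \<in> adj A z" using lin laurE by blast
  have qc: "q \<in> carrier R"
    using lin(1) subring_closed(1)[OF adj_subring[OF laur_subring[OF assms(1,2)] assms(3)]] by blast
  have zp: "z [^] k \<in> adj (adj A z) x" for k :: nat
    using Q(8) adj_incl[OF PS assms(3)] adj_mem[OF assms(1,2)] by blast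
  have zc: "z [^] k \<in> carrier R" for k :: nat using assms by simp
  have e: "(q \<otimes> x \<oplus> r) \<otimes> z [^] (n + m) = ((q \<otimes> z [^] n) \<otimes> z [^] m) \<otimes> x \<oplus> (r \<otimes> z [^] m) \<otimes> z [^] n"
    unfolding nat_pow_mult[OF assms(2), symmetric] using qc m zc assms(3) by algebra
  show ?case
    unfolding e[symmetric]
    by (rule exI[of _ "n + m"], unfold e)
      (rule Q(5)[OF adj_lin[OF PS assms(3) Q(4)[OF n zp]] Q(4)[OF adj_incl[OF PS assms(3) m(2)] zp]])
qed

text \<open>Coprimality is encoded as cancellability of \<open>g\<close> modulo \<open>f\<close>. In
  this form it passes to polynomials coefficient by coefficient, and to powers of \<open>f\<close>
  by \<open>coprime_pow\<close>.\<close>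

lemma coprime_adj:
  assumes "subring A R" "trans A u" "f \<in> A" "g \<in> A"
    and "\<And>a. a \<in> A \<Longrightarrow> dv A f (g \<otimes> a) \<Longrightarrow> dv A f a"
  shows "a \<in> adj A u \<Longrightarrow> dv (adj A u) f (g \<otimes> a) \<Longrightarrow> dv (adj A u) f a"
proof (induct rule: simple_extension.induct)
  case zero
  then show ?case using subring_closed(1)[OF assms(1)] assms by simp
next
  case (lin q r)
  note u = transD(1,2)[OF assms(2)] note PS = adj_subring[OF assms(1) u(1)]
  have c: "q \<in> carrier R" "r \<in> carrier R" "g \<in> carrier R"
    using lin assms subring_closed(1)[OF PS] subring_closed(1)[OF assms(1)] by auto
  have gq: "g \<otimes> q \<in> adj A u" "g \<otimes> r \<in> A"
    using subring_closed(4)[OF PS adj_incl[OF assms(1) u(1) assms(4)] lin(1)] subring_closed(4)[OF assms(1,4) lin(3)] by auto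
  have "g \<otimes> (q \<otimes> u \<oplus> r) = (g \<otimes> q) \<otimes> u \<oplus> g \<otimes> r" using c u by algebra
  then have "dv (adj A u) f (g \<otimes> q)" "dv A f (g \<otimes> r)"
    using dv_adj_iff[OF assms(1-3) gq] lin(4) by auto
  then show ?case using lin(2) assms(5)[OF lin(3)] dv_adj_iff[OF assms(1-3) lin(1,3)] by blast
qed

lemma coprime_pow:
  assumes "subring A R" "f \<in> A" "f \<noteq> \<zero>" "g \<in> A"
    and "\<And>a. a \<in> A \<Longrightarrow> dv A f (g \<otimes> a) \<Longrightarrow> dv A f a"
  shows "a \<in> A \<Longrightarrow> dv A (f [^] (n::nat)) (g \<otimes> a) \<Longrightarrow> dv A (f [^] n) a"
proof (induct n arbitrary: a)
  case 0
  then have "a = f [^] (0::nat) \<otimes> a" using subring_closed(1)[OF assms(1)] by simp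
  then show ?case using 0 dvI by metis
next
  case (Suc n)
  note A = subring_closed[OF assms(1)]
  obtain h where h: "h \<in> A" "g \<otimes> a = f [^] Suc n \<otimes> h" using Suc unfolding dv_def by auto
  have c: "f \<in> carrier R" "g \<in> carrier R" "a \<in> carrier R" "h \<in> carrier R" using A(1) assms Suc h by auto
  have "g \<otimes> a = f \<otimes> (f [^] n \<otimes> h)" unfolding h(2) using c by (simp add: m_ac)
  then have "dv A f (g \<otimes> a)" using A(4)[OF A(8)[OF assms(2)] h(1)] dvI by blast
  then obtain b where b: "b \<in> A" "a = f \<otimes> b" using assms(5)[OF Suc(2)] unfolding dv_def by auto
  have bc: "b \<in> carrier R" using A(1) b by auto
  have "(g \<otimes> b) \<otimes> f = (f [^] n \<otimes> h) \<otimes> f" using h(2) unfolding b(2) using c bc by (simp add: m_ac)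
  then have "g \<otimes> b = f [^] n \<otimes> h" using cancel_nonzero[OF c(1) assms(3)] c bc by auto
  then have "dv A (f [^] n) b" using Suc(1)[OF b(1)] h(1) dvI by blast
  then obtain d where d: "d \<in> A" "b = f [^] n \<otimes> d" unfolding dv_def by auto
  have "a = f [^] Suc n \<otimes> d" unfolding b(2) d(2) using c A(1)[OF d(1)] by (simp add: m_ac)
  then show ?case using d dvI by blast
qed

text \<open>Mutation in direction \<open>p\<close> does not affect the valuation at \<open>q\<close> when \<open>q\<close> does not occur in
  the exchange polynomial \<open>g\<close> of \<open>p\<close>.\<close>

lemma exring_mutate_zero:
  assumes "subring A R" "trans A p" "trans (laur A p) q" "f \<in> A" "f \<noteq> \<zero>" "g \<in> A" "g \<noteq> \<zero>"
    and coprime: "\<And>a. a \<in> A \<Longrightarrow> dv A f (g \<otimes> a) \<Longrightarrow> dv A f a"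
    and "z \<in> exring (laur A p) q f" "z \<in> laur (laur A (g \<otimes> inv p)) q"
  shows "z \<in> exring (laur A (g \<otimes> inv p)) q f"
proof -
  note p = transD(1,2)[OF assms(2)] and q = transD(1,2)[OF assms(3)]
  have c: "f \<in> carrier R" "g \<in> carrier R" using assms subring_closed(1) by auto
  note i = inv_nonzero[OF p]
  \<comment> \<open>In the application \<open>p\<close> is the mutated variable and
    \<open>p' = g/p\<close> the original one. In terms of \<open>u = 1/p\<close>, the latter is a
    polynomial, so \<open>adj A p'\<close> lies in \<open>adj A u\<close>.\<close>
  define u where "u = inv p"
  have u: "u \<in> carrier R" "u \<noteq> \<zero>" unfolding u_def using i by auto
  have tu: "trans A u" unfolding u_def using trans_inv[OF assms(1,2)] .
  have lu: "laur A p = laur A u"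
    unfolding u_def using laur_unit_inv[OF assms(1) p subring_closed(3)[OF assms(1)] subring_closed(3)[OF assms(1)]] i by simp
  define p' where "p' = g \<otimes> u"
  have p': "p' \<in> carrier R" "p' \<noteq> \<zero>" unfolding p'_def using c u assms(7) by (auto simp: integral_iff)
  note AS = laur_subring[OF assms(1) p(1)] note PS = adj_subring[OF assms(1) u(1)]
  note SS = adj_subring[OF assms(1) p'(1)] note TS = laur_subring[OF assms(1) p'(1)]
  have fS: "f \<in> adj A p'" "f \<in> laur A p'"
    using adj_incl[OF assms(1) p'(1) assms(4)] adj_in_laur[OF assms(1) p'(1)] by auto
  have fA: "f \<in> laur A p" using laur_mem(3)[OF assms(1) p] assms(4) by blast
  have SP: "adj A p' \<subseteq> adj A u"
    using adj_least[OF PS _ ] adj_incl[OF assms(1) u(1)]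
      subring_closed(4)[OF PS adj_incl[OF assms(1) u(1) assms(6)] adj_mem[OF assms(1) u(1)]]
    unfolding p'_def by blast
  have SA: "adj A p' \<subseteq> laur A p" using SP adj_in_laur[OF assms(1) u(1)] unfolding lu by blast
  have p'A: "p' \<in> laur A p" using SA adj_mem[OF assms(1) p'(1)] by blast
  \<comment> \<open>In a polynomial in \<open>p'\<close>, the coefficient of \<open>u^k\<close>
    carries the factor \<open>g^k\<close>. As \<open>g\<close> is cancellable modulo
    \<open>F\<close>, divisibility by \<open>F\<close> in \<open>adj A u\<close> already holds in
    \<open>adj A p'\<close>.\<close>
  have key: "dv (adj A p') F b" if "b \<in> adj A p'" "dv (adj A u) F b"
    and F: "F \<in> A" and cop: "\<And>a. a \<in> A \<Longrightarrow> dv A F (g \<otimes> a) \<Longrightarrow> dv A F a" for F b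
    using that(1,2)
  proof (induct rule: simple_extension.induct)
    case zero
    have "\<zero> = F \<otimes> \<zero>" using F subring_closed(1)[OF assms(1)] by simp
    then show ?case using dvI[OF simple_extension.zero] by metis
  next
    case (lin k r)
    have kc: "k \<in> carrier R" "r \<in> carrier R"
      using lin subring_closed(1)[OF SS] subring_closed(1)[OF assms(1)] by auto
    have kP: "g \<otimes> k \<in> adj A u" "k \<in> adj A u"
      using subring_closed(4)[OF PS adj_incl[OF assms(1) u(1) assms(6)]] SP lin(1) by blast+
    have e: "k \<otimes> p' \<oplus> r = (g \<otimes> k) \<otimes> u \<oplus> r" unfolding p'_def using kc c u by (simp add: m_ac)
    have d: "dv (adj A u) F (g \<otimes> k)" "dv A F r"
      using lin(4) dv_adj_iff[OF assms(1) tu F kP(1) lin(3)] unfolding e by auto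
    have "dv (adj A u) F k" using coprime_adj[OF assms(1) tu F assms(6) cop kP(2) d(1)] .
    then have "dv (adj A p') F k" using lin(2) by blast
    then obtain k' r' where k': "k' \<in> adj A p'" "k = F \<otimes> k'" "r' \<in> A" "r = F \<otimes> r'" using d(2) unfolding dv_def by auto
    have cc: "k' \<in> carrier R" "r' \<in> carrier R" "F \<in> carrier R"
      using k'(1,3) F subring_closed(1)[OF SS] subring_closed(1)[OF assms(1)] by auto
    have "k \<otimes> p' \<oplus> r = F \<otimes> (k' \<otimes> p' \<oplus> r')" unfolding k'(2,4) using cc p'(1) by algebra
    then show ?case using dvI[OF simple_extension.lin[OF k'(1,3)]] by blast
  qed
  obtain n :: nat where n: "z \<in> carrier R" "z \<otimes> q [^] n \<in> adj (laur A p') q"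
    using assms(10) laurE unfolding p'_def u_def by blast
  obtain m :: nat where m: "(z \<otimes> q [^] n) \<otimes> p' [^] m \<in> adj (adj A p') q"
    using adj_laur_clear[OF assms(1) p'(1) q(1) n(2)] by blast
  \<comment> \<open>\<open>p'\<close> is a unit of the target ring, so the power is divided out
    again at the end.\<close>
  define z' where "z' = z \<otimes> p' [^] m"
  have z'q: "z' \<otimes> q [^] n \<in> adj (adj A p') q"
    using m n(1) q(1) p'(1) unfolding z'_def by (simp add: m_ac)
  note DS = exring_subring[OF AS q fA]
  have z'D: "z' \<in> exring (laur A p) q f" unfolding z'_def
    using subring_closed(4)[OF DS assms(9) subring_closed(8)[OF DS subsetD[OF exring_mem(2)[OF AS q fA] p'A]]] .
  have "z' \<in> exring (adj A p') q f"
  proof (rule exring_restrict[OF SS AS SA assms(3) fS(1) _ z'D z'q])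
    fix k and h assume h: "h \<in> laur A p" "f [^] (k::nat) \<otimes> h \<in> adj A p'"
    have F: "f [^] k \<in> A" "f [^] k \<noteq> \<zero>" "f [^] k \<in> carrier R"
      using subring_closed(8)[OF assms(1,4)] pow_nonzero[OF c(1) assms(5)] c by auto
    have hP: "h \<in> adj A u"
      using laur_const_cancel[OF assms(1) tu F(1,2)] h SP unfolding lu by blast
    have "dv (adj A u) (f [^] k) (f [^] k \<otimes> h)" using hP dvI by blast
    then have "dv (adj A p') (f [^] k) (f [^] k \<otimes> h)"
      using key[OF h(2) _ F(1)] coprime_pow[OF assms(1,4,5,6) coprime] by blast
    then obtain h' where h': "h' \<in> adj A p'" "f [^] k \<otimes> h = f [^] k \<otimes> h'" unfolding dv_def by auto
    have hc: "h \<in> carrier R" "h' \<in> carrier R"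
      using hP h' subring_closed(1)[OF PS] subring_closed(1)[OF SS] by auto
    have "h \<otimes> f [^] k = h' \<otimes> f [^] k" using h'(2) hc F by (simp add: m_comm)
    then have "h = h'" using cancel_nonzero[OF F(3,2)] hc by blast
    then show "h \<in> adj A p'" using h'(1) by simp
  qed
  moreover have "exring (adj A p') q f \<subseteq> exring (laur A p') q f"
    unfolding exring_def using adj_mono[OF adj_mono[OF adj_in_laur[OF assms(1) p'(1)]]] .
  ultimately have z'T: "z' \<in> exring (laur A p') q f" by blast
  note ES = exring_subring[OF TS q fS(2)]
  have ip: "inv p' [^] m \<in> exring (laur A p') q f"
    using subring_closed(8)[OF ES] exring_mem(2)[OF TS q fS(2)] laur_mem(2)[OF assms(1) p'] by blast
  have "z = z \<otimes> (p' [^] m \<otimes> inv p' [^] m)" using n inv_pow[OF p'] by simp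
  also have "\<dots> = z' \<otimes> inv p' [^] m" unfolding z'_def using n p' inv_nonzero(1)[OF p'] by (simp add: m_assoc)
  finally show ?thesis using subring_closed(4)[OF ES z'T ip] unfolding p'_def u_def by simp
qed

text \<open>Modulo \<open>q\<close> the element \<open>p'\<close> equals
  \<open>\<tau> = a/p\<close>, and \<open>\<tau>^b + m a^b\<close> is the unit
  \<open>\<tau>^b\<close> times the old polynomial \<open>1 + m p^b\<close>. The new polynomial
  arises from this sum by writing \<open>p'\<close> for \<open>\<tau>\<close>. Divisibility of
  lowest coefficients by powers of the old polynomial is carried over by this substitution, and
  poles at \<open>q\<close> are then removed one by one as in
  \<open>exring_restrict\<close>.\<close>

lemma exring_mutate_nonzero:
  assumes "subring A R" "trans A p" "trans (laur A p) q"
    and a: "a \<in> A" "a' \<in> A" "a \<otimes> a' = \<one>" and m: "m \<in> A"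
    and e: "e \<in> adj (laur A p) q" and p': "p' = a \<otimes> inv p \<oplus> q \<otimes> e" "p' \<noteq> \<zero>"
    and z: "z \<in> exring (laur A p) q (\<one> \<oplus> m \<otimes> p [^] (b::nat))" "z \<in> laur (laur A p') q"
  shows "z \<in> exring (laur A p') q (p' [^] b \<oplus> m \<otimes> a [^] b)"
proof -
  note p = transD(1,2)[OF assms(2)] and q = transD(1,2)[OF assms(3)]
  note As = subring_closed[OF assms(1)]
  have c: "a \<in> carrier R" "a' \<in> carrier R" "m \<in> carrier R" using a m As(1) by auto
  have a0: "a \<noteq> \<zero>" using a c by auto
  note i = inv_nonzero[OF p]
  define \<tau> where "\<tau> = a \<otimes> inv p"
  have \<tau>: "\<tau> \<in> carrier R" "\<tau> \<noteq> \<zero>" "\<tau> \<otimes> p = a" unfolding \<tau>_def using inv_quot[OF c(1) a0 p] by auto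
  have t\<tau>: "trans A \<tau>" unfolding \<tau>_def using trans_quot[OF assms(1,2) a(1) a0] .
  let ?B = "laur A p"
  have l\<tau>: "laur A \<tau> = ?B" unfolding \<tau>_def using laur_unit_inv[OF assms(1) p a] .
  note BS = laur_subring[OF assms(1) p(1)] note B = subring_closed[OF BS]
  note BqS = adj_subring[OF BS q(1)] note Bq = subring_closed[OF BqS]
  have mB: "A \<subseteq> ?B" "p \<in> ?B" "inv p \<in> ?B" using laur_mem[OF assms(1) p] by auto
  have \<tau>B: "\<tau> \<in> ?B" using laur_mem(1)[OF assms(1) \<tau>(1,2)] l\<tau> by simp
  have BBq: "\<And>x. x \<in> ?B \<Longrightarrow> x \<in> adj ?B q" using adj_incl[OF BS q(1)] .
  have qBq: "q \<in> adj ?B q" using adj_mem[OF BS q(1)] .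
  have ec: "e \<in> carrier R" using e Bq(1) by blast
  have p'Bq: "p' \<in> adj ?B q" unfolding p'(1) \<tau>_def[symmetric]
    using Bq(5)[OF BBq[OF \<tau>B] Bq(4)[OF qBq e]] .
  have p'c: "p' \<in> carrier R" using p'Bq Bq(1) by blast
  define f where "f = \<one> \<oplus> m \<otimes> p [^] b"
  define f' where "f' = p' [^] b \<oplus> m \<otimes> a [^] b"
  define h where "h = \<tau> [^] b \<oplus> m \<otimes> a [^] b"
  have fB: "f \<in> ?B" unfolding f_def using B(5)[OF B(3) B(4)[OF subsetD[OF mB(1) m] B(8)[OF mB(2)]]] .
  have mab: "m \<otimes> a [^] b \<in> A" using As(4)[OF m As(8)[OF a(1)]] .
  have hB: "h \<in> ?B" unfolding h_def using B(5)[OF B(8)[OF \<tau>B] subsetD[OF mB(1) mab]] .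
  have fc: "f \<in> carrier R" "h \<in> carrier R" using fB hB B(1) by auto
  have hf: "h = \<tau> [^] b \<otimes> f"
  proof -
    have "\<tau> [^] b \<otimes> p [^] b = a [^] b" using nat_pow_distrib[OF \<tau>(1) p(1)] \<tau>(3) by metis
    moreover have "\<tau> [^] b \<otimes> f = \<tau> [^] b \<oplus> m \<otimes> (\<tau> [^] b \<otimes> p [^] b)"
      unfolding f_def using c \<tau> p nat_pow_closed[OF \<tau>(1), of b] nat_pow_closed[OF p(1), of b] by algebra
    ultimately show ?thesis unfolding h_def by simp
  qed
  let ?E = "exring ?B q f"
  note ES = exring_subring[OF BS q fB] note E = subring_closed[OF ES]
  have BE: "adj ?B q \<subseteq> ?E" "?B \<subseteq> ?E" "q \<in> ?E" "f \<otimes> inv q \<in> ?E" using exring_mem[OF BS q fB] by auto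
  note SS = adj_subring[OF assms(1) p'c] note TS = laur_subring[OF assms(1) p'c]
  note SqS = adj_subring[OF SS q(1)] note Sq = subring_closed[OF SqS]
  have AS: "A \<subseteq> adj A p'" using adj_incl[OF assms(1) p'c] by blast
  have p'S: "p' \<in> adj A p'" using adj_mem[OF assms(1) p'c] .
  have f'S: "f' \<in> adj A p'" unfolding f'_def
    using subring_closed(5)[OF SS subring_closed(8)[OF SS p'S] subsetD[OF AS mab]] .
  have f'T: "f' \<in> laur A p'" using f'S adj_in_laur[OF assms(1) p'c] by blast
  let ?G = "exring (laur A p') q f'"
  note GS = exring_subring[OF TS q f'T] note G = subring_closed[OF GS]
  have TG: "adj (laur A p') q \<subseteq> ?G" "laur A p' \<subseteq> ?G" "f' \<otimes> inv q \<in> ?G"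
    using exring_mem[OF TS q f'T] by auto
  have SG: "adj A p' \<subseteq> ?G" "adj (adj A p') q \<subseteq> ?G"
    using TG adj_in_laur[OF assms(1) p'c] adj_mono[OF adj_in_laur[OF assms(1) p'c]] by blast+
  have SB: "adj A p' \<subseteq> adj ?B q" using adj_least[OF BqS] BBq mB(1) p'Bq by blast
  note pv = assms(1) p'c \<tau>(1)
  have fh: "(f', h) \<in> pev A p' \<tau>" unfolding f'_def h_def
    using pev_add[OF pv pev_pow[OF pv pev_var[OF pv]] pev_const[OF pv mab]] .
  have diff: "\<exists>d\<in>adj ?B q. x = y \<oplus> q \<otimes> d" if xy: "(x, y) \<in> pev A p' \<tau>" for x y
  proof -
    obtain d where d: "d \<in> adj ?B q" "x = y \<oplus> (p' \<ominus> \<tau>) \<otimes> d"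
      using pev_diff[OF pv BqS _ p'Bq BBq[OF \<tau>B] xy] BBq mB(1) by blast
    have "p' \<ominus> \<tau> = q \<otimes> e" unfolding p'(1) \<tau>_def[symmetric] using \<tau> q ec by algebra
    then have "x = y \<oplus> q \<otimes> (e \<otimes> d)" using d(2) q ec Bq(1)[OF d(1)] by (simp add: m_assoc)
    then show ?thesis using Bq(4)[OF e d(1)] by blast
  qed
  \<comment> \<open>The correction terms of the induction contain \<open>f'/q\<close>, which must
    lie in the source ring too: \<open>f'\<close> differs from \<open>\<tau>^b f\<close> by a
    multiple of \<open>q\<close>.\<close>
  have f'E: "f' \<otimes> inv q \<in> ?E"
  proof -
    obtain d where d: "d \<in> adj ?B q" "f' = h \<oplus> q \<otimes> d" using diff[OF fh] by blast
    have cc: "d \<in> carrier R" "inv q \<in> carrier R" using d Bq(1) inv_nonzero[OF q] by auto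
    have "f' \<otimes> inv q = \<tau> [^] b \<otimes> (f \<otimes> inv q) \<oplus> d \<otimes> (q \<otimes> inv q)"
      unfolding d(2) hf using cc fc q nat_pow_closed[OF \<tau>(1), of b] by algebra
    then have "f' \<otimes> inv q = \<tau> [^] b \<otimes> (f \<otimes> inv q) \<oplus> d" using inv_nonzero[OF q] cc by simp
    then show ?thesis
      using E(5)[OF E(4)[OF subsetD[OF BE(2) B(8)[OF \<tau>B]] BE(4)] subsetD[OF BE(1) d(1)]] by simp
  qed
  have "f' \<in> carrier R" using f'S subring_closed(1)[OF SS] by blast
  define x where "x = f' \<otimes> inv q"
  have x: "x \<in> carrier R" "x \<otimes> q = f'" "x \<in> ?E" "x \<in> ?G"
    unfolding x_def using f'E TG(3) E(1) inv_nonzero[OF q] \<open>f' \<in> carrier R\<close> q by (auto simp: m_assoc)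
  have ip': "inv p' [^] k \<in> ?G" "inv p' [^] k \<in> carrier R" for k :: nat
    using G(8) TG(2) laur_mem(2)[OF assms(1) p'c p'(2)] inv_nonzero(1)[OF p'c p'(2)] by auto
  have undo: "w \<in> ?G" if "w \<otimes> p' [^] (k::nat) \<in> ?G" "w \<in> carrier R" for w k
  proof -
    have "w = w \<otimes> (p' [^] k \<otimes> inv p' [^] k)" using that(2) inv_pow[OF p'c p'(2)] by simp
    also have "\<dots> = (w \<otimes> p' [^] k) \<otimes> inv p' [^] k" using that(2) p'c ip' by (simp add: m_assoc)
    finally show ?thesis using G(4)[OF that(1) ip'(1)[of k]] by simp
  qed
  have p'pE: "p' [^] k \<in> ?E" "p' [^] k \<in> carrier R" for k :: nat
    using E(8)[OF subsetD[OF BE(1) p'Bq]] nat_pow_closed[OF p'c] by auto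
  have main: "w \<in> ?G" if "w \<in> ?E" "w \<otimes> q [^] (n::nat) \<in> adj (adj A p') q" for w n
    using that
  proof (induct n arbitrary: w)
    case 0
    then show ?case using SG(2) E(1) by auto
  next
    case (Suc n)
    have w: "w \<in> carrier R" using E(1) Suc by blast
    obtain v k where v: "v \<in> adj (adj A p') q" "k \<in> adj A p'" "w \<otimes> q [^] Suc n = v \<otimes> q \<oplus> k"
      using adj_cases[OF SS q(1) Suc(3)] by blast
    obtain k0 where k0: "(k, k0) \<in> pev A p' \<tau>" using pev_ex[OF v(2)] by blast
    obtain d where d: "d \<in> adj ?B q" "k = k0 \<oplus> q \<otimes> d" using diff[OF k0] by blast
    have k0B: "k0 \<in> ?B" using pev_adj[OF k0] adj_in_laur[OF assms(1) \<tau>(1)] l\<tau> by blast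
    have vB: "v \<in> adj ?B q"
      using v(1) adj_least[OF BqS SB qBq] by blast
    have cc: "v \<in> carrier R" "k \<in> carrier R" "k0 \<in> carrier R" "d \<in> carrier R"
      using vB d(1) Bq(1) k0B B(1) v(2) subring_closed(1)[OF SS] by auto
    have "w \<otimes> q [^] Suc n = (v \<oplus> d) \<otimes> q \<oplus> k0" unfolding v(3) d(2) using cc q by algebra
    then obtain g where g: "g \<in> ?B" "k0 = f [^] Suc n \<otimes> g"
      using exring_const[OF BS assms(3) fB Suc(2) _ Bq(5)[OF vB d(1)] k0B] by blast
    have gc: "g \<in> carrier R" using g B(1) by blast
    \<comment> \<open>Dividing by this power of \<open>\<tau>\<close> replaces \<open>f\<close> by
      \<open>h\<close>: the lowest coefficient is \<open>h^(n+1) g1\<close>. It can be transported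
      to \<open>p'\<close> once a power \<open>M\<close> of \<open>\<tau>\<close> makes
      \<open>g1\<close> a polynomial in \<open>\<tau>\<close>.\<close>
    define g1 where "g1 = g \<otimes> inv \<tau> [^] (b * Suc n)"
    have i\<tau>: "inv \<tau> \<in> ?B" using laur_mem(2)[OF assms(1) \<tau>(1,2)] l\<tau> by simp
    have i\<tau>c: "inv \<tau> \<in> carrier R" using i\<tau> B(1) by blast
    have "g1 \<in> laur A \<tau>" unfolding g1_def l\<tau> using B(4)[OF g(1) B(8)[OF i\<tau>]] .
    then obtain M :: nat where M: "g1 \<in> carrier R" "g1 \<otimes> \<tau> [^] M \<in> adj A \<tau>" using laurE by blast
    obtain g2 where g2: "(g2, g1 \<otimes> \<tau> [^] M) \<in> pev A p' \<tau>" using pev_ex[OF M(2)] pev_sym by blast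
    have "(\<tau> [^] b) [^] Suc n \<otimes> inv \<tau> [^] (b * Suc n) = \<one>"
      unfolding nat_pow_pow[OF \<tau>(1)] using inv_pow[OF \<tau>(1,2)] by blast
    moreover have "h [^] Suc n \<otimes> g1 = (\<tau> [^] b) [^] Suc n \<otimes> f [^] Suc n \<otimes> (g \<otimes> inv \<tau> [^] (b * Suc n))"
      unfolding hf g1_def using nat_pow_distrib[of "\<tau> [^] b" f "Suc n"] \<tau>(1) fc by simp
    moreover have "\<dots> = ((\<tau> [^] b) [^] Suc n \<otimes> inv \<tau> [^] (b * Suc n)) \<otimes> (f [^] Suc n \<otimes> g)"
      using \<tau>(1) fc gc i\<tau>c by (simp add: m_ac del: nat_pow_Suc)
    ultimately have hg1: "h [^] Suc n \<otimes> g1 = k0" using g(2) cc by simp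
    have "(k \<otimes> p' [^] M, k0 \<otimes> \<tau> [^] M) \<in> pev A p' \<tau>"
      using pev_mult[OF pv k0 pev_pow[OF pv pev_var[OF pv]]] .
    moreover have "(f' [^] Suc n \<otimes> g2, h [^] Suc n \<otimes> (g1 \<otimes> \<tau> [^] M)) \<in> pev A p' \<tau>"
      using pev_mult[OF pv pev_pow[OF pv fh] g2] .
    moreover have "h [^] Suc n \<otimes> (g1 \<otimes> \<tau> [^] M) = k0 \<otimes> \<tau> [^] M"
      unfolding hg1[symmetric] using fc M \<tau>(1) by (simp add: m_assoc del: nat_pow_Suc)
    \<comment> \<open>Both sides are values at \<open>p'\<close> of polynomials that agree at the
      transcendental \<open>\<tau>\<close>.\<close>
    ultimately have kM: "k \<otimes> p' [^] M = f' [^] Suc n \<otimes> g2"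
      using pev_fun[OF assms(1) \<tau>(1) p'c t\<tau> pev_sym pev_sym] by metis
    have g2S: "g2 \<in> adj A p'" using pev_adj[OF g2] by blast
    have g2c: "g2 \<in> carrier R" using g2S subring_closed(1)[OF SS] by blast
    define w1 where "w1 = w \<otimes> p' [^] M \<ominus> g2 \<otimes> x [^] Suc n"
    have w1E: "w1 \<in> ?E" unfolding w1_def
      using E(6)[OF E(4)[OF Suc(2) p'pE(1)] E(4)[OF subsetD[OF BE(1) subsetD[OF SB g2S]] E(8)[OF x(3)]]] .
    have w1c: "w1 \<in> carrier R" using w1E E(1) by blast
    have xq: "x [^] Suc n \<otimes> q [^] Suc n = f' [^] Suc n" using nat_pow_distrib[OF x(1) q(1)] x(2) by metis
    have pc: "x [^] Suc n \<in> carrier R" "q [^] Suc n \<in> carrier R" "f' [^] Suc n \<in> carrier R"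
      using x(1) q(1) \<open>f' \<in> carrier R\<close> by auto
    have "w1 \<otimes> q [^] Suc n = (w \<otimes> q [^] Suc n) \<otimes> p' [^] M \<ominus> g2 \<otimes> (x [^] Suc n \<otimes> q [^] Suc n)"
      unfolding w1_def using w pc g2c p'pE(2)[of M] by algebra
    also have "\<dots> = (v \<otimes> p' [^] M) \<otimes> q \<oplus> (k \<otimes> p' [^] M) \<ominus> g2 \<otimes> f' [^] Suc n"
      unfolding v(3) xq using cc q(1) p'pE(2)[of M] g2c pc by algebra
    also have "\<dots> = (v \<otimes> p' [^] M) \<otimes> q" unfolding kM using cc q(1) p'pE(2)[of M] g2c pc by algebra
    finally have "(w1 \<otimes> q [^] n) \<otimes> q = (v \<otimes> p' [^] M) \<otimes> q" using w1c q by (simp add: m_assoc)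
    then have w1q: "w1 \<otimes> q [^] n = v \<otimes> p' [^] M" using cancel_nonzero[OF q] w1c q(1) cc p'c by simp
    have "v \<otimes> p' [^] M \<in> adj (adj A p') q"
      using Sq(4)[OF v(1) Sq(8)[OF adj_incl[OF SS q(1) p'S]]] .
    then have w1G: "w1 \<in> ?G" using Suc(1)[OF w1E] w1q by simp
    have "w \<otimes> p' [^] M = w1 \<oplus> g2 \<otimes> x [^] Suc n" unfolding w1_def using w pc g2c p'pE(2)[of M] by algebra
    then have "w \<otimes> p' [^] M \<in> ?G"
      using G(5)[OF w1G G(4)[OF subsetD[OF SG(1) g2S] G(8)[OF x(4)]]] by (simp only:)
    then show ?case using undo w by blast
  qed
  obtain n :: nat where n: "z \<in> carrier R" "z \<otimes> q [^] n \<in> adj (laur A p') q" using z(2) laurE by blast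
  obtain k :: nat where k: "(z \<otimes> q [^] n) \<otimes> p' [^] k \<in> adj (adj A p') q"
    using adj_laur_clear[OF assms(1) p'c q(1) n(2)] by blast
  have "(z \<otimes> p' [^] k) \<otimes> q [^] n \<in> adj (adj A p') q" using k n(1) q(1) p'c by (simp add: m_ac)
  moreover have "z \<otimes> p' [^] k \<in> ?E" using E(4)[OF _ p'pE(1)] z(1) unfolding f_def by blast
  ultimately have "z \<otimes> p' [^] k \<in> ?G" using main by blast
  then show ?thesis using undo n(1) unfolding f'_def by blast
qed

end

subsection \<open>Laurent monomials\<close>

lemma (in comm_monoid) finprod_units_of:
  assumes "finite J" "\<And>j. j \<in> J \<Longrightarrow> f j \<in> Units G"
  shows "finprod G f J = finprod (units_of G) f J"
proof -
  interpret U: comm_group "units_of G" by (rule units_comm_group)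
  show ?thesis using assms
  proof (induct J)
    case (insert j J)
    then have "f \<in> J \<rightarrow> Units G" "f j \<in> Units G" by auto
    moreover from this have "f \<in> J \<rightarrow> carrier G" "f j \<in> carrier G" by auto
    ultimately show ?case using insert(1-3) U.finprod_insert[of J j f] finprod_insert[of J j f]
      by (simp add: units_of_carrier units_of_mult Pi_iff)
  qed (simp add: units_of_one)
qed

context field
begin

interpretation U: comm_group "units_of R"
  rewrites "(\<otimes>\<^bsub>units_of R\<^esub>) = (\<otimes>)" and "\<one>\<^bsub>units_of R\<^esub> = \<one>"
    and "carrier (units_of R) = carrier R - {\<zero>}"
  by (simp_all add: units_comm_group units_of_mult units_of_one units_of_carrier field_Units)

text \<open>Integer powers are taken in the group of units of the field, where the laws of exponents
  cover negative exponents.\<close>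

abbreviation ipow :: "'a \<Rightarrow> int \<Rightarrow> 'a" where
  "ipow t k \<equiv> t [^]\<^bsub>units_of R\<^esub> k"

definition mon :: "('i \<Rightarrow> 'a) \<Rightarrow> 'i set \<Rightarrow> ('i \<Rightarrow> int) \<Rightarrow> 'a" where
  "mon x J e = finprod (units_of R) (\<lambda>j. ipow (x j) (e j)) J"

lemma ipow_closed:
  assumes "t \<in> carrier R" "t \<noteq> \<zero>"
  shows "ipow t k \<in> carrier R" "ipow t k \<noteq> \<zero>"
  using U.int_pow_closed[of t k] assms by auto

lemma ipow_zero: "ipow t 0 = \<one>"
  by (simp add: int_pow_def2 units_of_one)

lemma ipow_nat:
  assumes "t \<in> carrier R" "t \<noteq> \<zero>"
  shows "ipow t (int n) = t [^] n"
proof -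
  have "t [^]\<^bsub>units_of R\<^esub> n = t [^] n" using units_of_pow assms field_Units by auto
  then show ?thesis by (simp add: int_pow_int)
qed

lemma ipow_add:
  assumes "t \<in> carrier R" "t \<noteq> \<zero>"
  shows "ipow t (k + l) = ipow t k \<otimes> ipow t l"
  using U.int_pow_mult[of t k l] assms by auto

lemma ipow_uminus:
  assumes "t \<in> carrier R" "t \<noteq> \<zero>"
  shows "ipow t (- k) \<otimes> ipow t k = \<one>"
  using ipow_add[OF assms, of "- k" k] ipow_zero by simp

lemma ipow_mem:
  assumes "subring A R" "t \<in> A" "inv t \<in> A" "t \<noteq> \<zero>"
  shows "ipow t k \<in> A"
proof -
  have t: "t \<in> carrier R" using assms subring_closed(1) by blast
  note i = inv_nonzero[OF t assms(4)]
  show ?thesis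
  proof (cases "k \<ge> 0")
    case True
    then have "ipow t k = t [^] nat k" using ipow_nat[OF t assms(4), of "nat k"] by simp
    then show ?thesis using subring_closed(8)[OF assms(1,2)] by simp
  next
    case False
    then obtain n where k: "k = - int n" by (intro that[of "nat (- k)"]) simp
    have "ipow t k \<otimes> t [^] n = \<one>"
      using ipow_uminus[OF t assms(4), of "int n"] unfolding k ipow_nat[OF t assms(4)] .
    also have "\<dots> = inv t [^] n \<otimes> t [^] n" using inv_pow[OF t assms(4), of n] i t by (simp add: m_comm)
    finally have "ipow t k = inv t [^] n"
      using cancel_nonzero[OF nat_pow_closed[OF t] pow_nonzero[OF t assms(4)]]
        ipow_closed[OF t assms(4)] nat_pow_closed[OF i(1)] by blast
    then show ?thesis using subring_closed(8)[OF assms(1,3)] by simp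
  qed
qed

definition nz :: "('i \<Rightarrow> 'a) \<Rightarrow> 'i set \<Rightarrow> bool" where
  "nz x J \<longleftrightarrow> (\<forall>j\<in>J. x j \<in> carrier R \<and> x j \<noteq> \<zero>)"

lemma nzD: "nz x J \<Longrightarrow> j \<in> J \<Longrightarrow> x j \<in> carrier R" "nz x J \<Longrightarrow> j \<in> J \<Longrightarrow> x j \<noteq> \<zero>"
  unfolding nz_def by auto

lemma nz_mono: "nz x J \<Longrightarrow> L \<subseteq> J \<Longrightarrow> nz x L"
  unfolding nz_def by auto

lemma mon_Pi: "nz x J \<Longrightarrow> (\<lambda>j. ipow (x j) (e j)) \<in> J \<rightarrow> carrier R - {\<zero>}"
  using ipow_closed unfolding nz_def by auto

lemma mon_closed:
  assumes "nz x J"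
  shows "mon x J e \<in> carrier R" "mon x J e \<noteq> \<zero>"
  using U.finprod_closed[OF mon_Pi[OF assms]] unfolding mon_def by auto

lemma mon_add:
  assumes "nz x J"
  shows "mon x J (\<lambda>k. e k + e' k) = mon x J e \<otimes> mon x J e'"
proof -
  have "mon x J (\<lambda>k. e k + e' k) = finprod (units_of R) (\<lambda>j. ipow (x j) (e j) \<otimes> ipow (x j) (e' j)) J"
    unfolding mon_def
    by (rule U.finprod_cong') (use assms ipow_add ipow_closed in \<open>auto simp: nz_def integral_iff\<close>)
  also have "\<dots> = mon x J e \<otimes> mon x J e'"
    unfolding mon_def using U.finprod_multf[OF mon_Pi[OF assms] mon_Pi[OF assms]] .
  finally show ?thesis .
qed

lemma mon_zero: "nz x J \<Longrightarrow> (\<And>j. j \<in> J \<Longrightarrow> e j = 0) \<Longrightarrow> mon x J e = \<one>"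
  unfolding mon_def by (rule U.finprod_one_eqI) (simp add: ipow_zero units_of_one)

lemma mon_cong:
  assumes "nz x J" "\<And>j. j \<in> J \<Longrightarrow> x j = x' j" "\<And>j. j \<in> J \<Longrightarrow> e j = e' j"
  shows "mon x J e = mon x' J e'"
  unfolding mon_def
  by (rule U.finprod_cong') (use assms mon_Pi[of x' J e'] in \<open>auto simp: nz_def\<close>)

lemma mon_uminus: "nz x J \<Longrightarrow> mon x J (\<lambda>k. - e k) \<otimes> mon x J e = \<one>"
  using mon_add[of x J "\<lambda>k. - e k" e] mon_zero[of x J "\<lambda>k. - e k + e k"] by simp

lemma mon_insert:
  assumes "finite J" "j \<notin> J" "nz x (insert j J)"
  shows "mon x (insert j J) e = ipow (x j) (e j) \<otimes> mon x J e"
  unfolding mon_def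
  by (rule U.finprod_insert[OF assms(1,2)])
    (use assms ipow_closed mon_Pi[OF nz_mono[OF assms(3)], of J] in \<open>auto simp: nz_def\<close>)

lemma mon_remove:
  assumes "finite J" "j \<in> J" "nz x J"
  shows "mon x J e = ipow (x j) (e j) \<otimes> mon x (J - {j}) e"
  using mon_insert[of "J - {j}" j x e] assms by (simp add: insert_absorb)

lemma mon_drop:
  assumes "finite J" "nz x J" "e j = 0"
  shows "mon x (J - {j}) e = mon x J e"
proof (cases "j \<in> J")
  case True
  then show ?thesis
    using mon_remove[OF assms(1) True assms(2), of e] assms(3) ipow_zero
      mon_closed(1)[OF nz_mono[OF assms(2), of "J - {j}"], of e] by auto
qed simp

lemma mon_mem_factors:
  assumes "subring A R" "nz x J" "finite J" "\<And>k. k \<in> J \<Longrightarrow> ipow (x k) (e k) \<in> A"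
  shows "mon x J e \<in> A"
  using assms(3,2,4)
proof (induct J)
  case empty
  then show ?case using mon_zero[of x "{}"] subring_closed(3)[OF assms(1)] by (simp add: nz_def)
next
  case (insert j J)
  have "mon x J e \<in> A" using insert nz_mono[OF insert(4)] by auto
  then show ?case using mon_insert[OF insert(1,2,4)] insert(5) subring_closed(4)[OF assms(1)] by simp
qed

lemma mon_pow:
  assumes "nz x J"
  shows "mon x J e [^] (n::nat) = mon x J (\<lambda>k. int n * e k)"
proof (induct n)
  case 0
  then show ?case using mon_zero[OF assms, of "\<lambda>k. int 0 * e k"] by simp
next
  case (Suc n)
  have "mon x J (\<lambda>k. int (Suc n) * e k) = mon x J (\<lambda>k. int n * e k + e k)"
    by (rule mon_cong[OF assms]) (auto simp: algebra_simps)
  then show ?case using Suc mon_add[OF assms, of "\<lambda>k. int n * e k" e] by simp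
qed

section \<open>Laurent polynomial rings in several variables\<close>

definition LP :: "'a set \<Rightarrow> ('i \<Rightarrow> 'a) \<Rightarrow> 'i set \<Rightarrow> 'a set" where
  "LP K x J = generate_ring R (K \<union> x ` J \<union> (\<lambda>j. inv (x j)) ` J)"

lemma LP_incl:
  assumes "subring K R" "nz x J"
  shows "K \<union> x ` J \<union> (\<lambda>j. inv (x j)) ` J \<subseteq> carrier R"
  using assms(2) inv_nonzero(1) subring_closed(1)[OF assms(1)] unfolding nz_def by auto

lemma LP_subring: "subring K R \<Longrightarrow> nz x J \<Longrightarrow> subring (LP K x J) R"
  unfolding LP_def using generate_ring_is_subring[OF LP_incl] .

lemma LP_mem:
  assumes "subring K R" "nz x J"
  shows "K \<subseteq> LP K x J" "j \<in> J \<Longrightarrow> x j \<in> LP K x J" "j \<in> J \<Longrightarrow> inv (x j) \<in> LP K x J"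
  unfolding LP_def by (auto intro: generate_ring.incl)

lemma LP_least:
  assumes "subring K R" "nz x J" "subring B R" "K \<subseteq> B" "\<And>j. j \<in> J \<Longrightarrow> x j \<in> B" "\<And>j. j \<in> J \<Longrightarrow> inv (x j) \<in> B"
  shows "LP K x J \<subseteq> B"
  unfolding LP_def using generate_ring_min_subring1[OF LP_incl[OF assms(1,2)] assms(3)] assms(4-) by blast

lemma LP_mono: "subring K R \<Longrightarrow> nz x J \<Longrightarrow> L \<subseteq> J \<Longrightarrow> LP K x L \<subseteq> LP K x J"
  by (rule LP_least) (auto intro: nz_mono LP_subring LP_mem subsetD[OF LP_mem(1)])

lemma LP_cong: "(\<And>j. j \<in> J \<Longrightarrow> x j = x' j) \<Longrightarrow> LP K x J = LP K x' J"
  unfolding LP_def by (metis (no_types, lifting) image_cong)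

lemma LP_empty: "subring K R \<Longrightarrow> LP K x {} = K"
  using LP_mem(1)[of K x "{}"] LP_least[of K x "{}" K] unfolding nz_def by auto

text \<open>Any variable can be split off as the last one, which reduces questions in several
  variables to \<open>laur\<close>, with the variable chosen as the situation demands.\<close>

lemma LP_insert:
  assumes "subring K R" "nz x (insert j J)"
  shows "LP K x (insert j J) = laur (LP K x J) (x j)"
proof -
  have nJ: "nz x J" using nz_mono[OF assms(2)] by auto
  have xj: "x j \<in> carrier R" "x j \<noteq> \<zero>" using assms(2) unfolding nz_def by auto
  note JS = LP_subring[OF assms(1) nJ]
  show ?thesis
  proof
    show "LP K x (insert j J) \<subseteq> laur (LP K x J) (x j)"
      by (rule LP_least[OF assms laur_subring[OF JS xj(1)]])
        (use laur_mem[OF JS xj] LP_mem[OF assms(1) nJ] in auto)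
    show "laur (LP K x J) (x j) \<subseteq> LP K x (insert j J)"
      by (rule laur_least[OF LP_subring[OF assms] LP_mono[OF assms]])
        (use LP_mem[OF assms] xj in auto)
  qed
qed

lemma LP_remove:
  assumes "subring K R" "nz x J" "j \<in> J"
  shows "LP K x J = laur (LP K x (J - {j})) (x j)"
  using LP_insert[OF assms(1), of x j "J - {j}"] assms by (simp add: insert_absorb)

lemma mon_LP:
  assumes "subring K R" "nz x J" "finite J"
  shows "mon x J e \<in> LP K x J"
  using LP_mem(2,3)[OF assms(1,2)] nzD(2)[OF assms(2)]
  by (intro mon_mem_factors[OF LP_subring[OF assms(1,2)] assms(2,3)] ipow_mem[OF LP_subring[OF assms(1,2)]]) auto

text \<open>Transcendence is required over all other variables, not only the preceding ones, so that
  each variable can play the role of the last one.\<close>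

definition indep :: "'a set \<Rightarrow> ('i \<Rightarrow> 'a) \<Rightarrow> 'i set \<Rightarrow> bool" where
  "indep K x I \<longleftrightarrow> (\<forall>i\<in>I. trans (LP K x (I - {i})) (x i))"

lemma indep_nz: "indep K x I \<Longrightarrow> nz x I"
  unfolding indep_def nz_def using transD(1,2) by blast

lemma indep_trans:
  assumes "subring K R" "indep K x I" "i \<in> I" "J \<subseteq> I - {i}"
  shows "trans (LP K x J) (x i)"
  using trans_mono[OF _ LP_mono[OF assms(1) nz_mono[OF indep_nz[OF assms(2)]] assms(4)]] assms(2,3)
  unfolding indep_def by blast

lemma LP_ufd:
  assumes "ufd K" "indep K x I" "finite J" "J \<subseteq> I"
  shows "ufd (LP K x J)"
  using assms(3,4)
proof (induct J)
  case empty
  have "subring K R" using assms(1) unfolding ufd_def by auto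
  then show ?case using LP_empty assms(1) by metis
next
  case (insert j J)
  have K: "subring K R" using assms(1) unfolding ufd_def by auto
  note nz = indep_nz[OF assms(2)]
  have t: "trans (LP K x J) (x j)" using indep_trans[OF K assms(2), of j J] insert by auto
  have nJ: "nz x (insert j J)" using nz_mono[OF nz] insert by auto
  have "subring (LP K x J) R" using LP_subring[OF K nz_mono[OF nJ]] by auto
  then show ?case unfolding LP_insert[OF K nJ]
    using laur_ufd[OF _ transD(1,2)[OF t]] gauss_ufd[OF _ t] insert by auto
qed

lemma trans_ipow_not:
  assumes "subring A R" "trans A t" "u \<in> A" "v \<in> A" "u \<otimes> v = \<one>" "k \<noteq> 0" "c \<in> A"
  shows "ipow t k \<otimes> u \<noteq> c"
proof
  assume e: "ipow t k \<otimes> u = c"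
  note t = transD(1,2)[OF assms(2)]
  note PS = adj_subring[OF assms(1) t(1)]
  have cc: "u \<in> carrier R" "v \<in> carrier R" "c \<in> carrier R" using assms subring_closed(1) by auto
  have pw: "False" if p: "a \<otimes> t [^] Suc n = b" "a \<in> A" "b \<in> A" "a \<noteq> \<zero>" for a b n
  proof -
    have ab: "a \<in> carrier R" "b \<in> carrier R" using p subring_closed(1)[OF assms(1)] by auto
    have "a \<otimes> t [^] n \<in> adj A t"
      using subring_closed(4)[OF PS adj_incl[OF assms(1) t(1) p(2)] subring_closed(8)[OF PS adj_mem[OF assms(1) t(1)]]] .
    moreover have "(a \<otimes> t [^] n) \<otimes> t \<oplus> \<ominus> b = \<zero>" using p(1) ab t by (simp add: m_assoc r_neg)
    ultimately have "a \<otimes> t [^] n = \<zero>"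
      using trans_zero(1)[OF assms(1,2) _ subring_closed(7)[OF assms(1) p(3)]] by blast
    then show False using ab t p(4) pow_nonzero[OF t] by (simp add: integral_iff)
  qed
  have u0: "u \<noteq> \<zero>" "v \<noteq> \<zero>" using assms(5) cc by auto
  show False
  proof (cases "k > 0")
    case True
    then obtain n where k: "k = int (Suc n)" by (metis Suc_pred nat_0_le less_imp_le zero_less_nat_eq)
    have "u \<otimes> t [^] Suc n = c" using e ipow_nat[OF t, of "Suc n"] cc t unfolding k by (simp add: m_comm)
    then show False using pw u0 assms by blast
  next
    case False
    then have "- k > 0" using assms(6) by simp
    then obtain n where k: "- k = int (Suc n)" by (metis Suc_pred nat_0_le less_imp_le zero_less_nat_eq)
    have i: "ipow t k \<in> carrier R" using ipow_closed t by blast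
    have "c \<otimes> t [^] Suc n = (ipow t (- k) \<otimes> ipow t k) \<otimes> u"
      unfolding e[symmetric] k ipow_nat[OF t] using i cc t by (simp add: m_ac del: nat_pow_Suc)
    then have "c \<otimes> t [^] Suc n = u" using ipow_uminus[OF t] cc by simp
    moreover have "c \<noteq> \<zero>" using e ipow_closed[OF t] u0 cc by (auto simp: integral_iff)
    ultimately show False using pw assms by blast
  qed
qed

text \<open>Splitting off the variable \<open>k\<close> reduces this to
  \<open>trans_ipow_not\<close>. Excluding the value -1 makes exchange polynomials nonzero;
  excluding 1 enters their coprimality.\<close>

lemma mon_not_const:
  assumes "subring K R" "indep K x I" "finite J" "J \<subseteq> I" "k \<in> J" "e k \<noteq> 0" "c \<in> K"
  shows "mon x J e \<noteq> c"
proof -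
  have nJ: "nz x J" using nz_mono[OF indep_nz[OF assms(2)] assms(4)] .
  have nz: "nz x J" "nz x (J - {k})" using nJ nz_mono[OF nJ] by auto
  have t: "trans (LP K x (J - {k})) (x k)" using indep_trans[OF assms(1,2), of k "J - {k}"] assms(4,5) by blast
  note S = LP_subring[OF assms(1) nz(2)]
  have m: "mon x (J - {k}) f \<in> LP K x (J - {k})" for f using mon_LP[OF assms(1) nz(2)] assms by auto
  have "mon x (J - {k}) e \<otimes> mon x (J - {k}) (\<lambda>k. - e k) = \<one>"
    using mon_uminus[OF nz(2)] mon_closed[OF nz(2)] by (simp add: m_comm)
  from trans_ipow_not[OF S t m m this assms(6)] show ?thesis
    unfolding mon_remove[OF assms(3,5) nz(1)] using LP_mem(1)[OF assms(1) nz(2)] assms(7) by blast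
qed

end

subsection \<open>Exchange matrices\<close>

text \<open>This form exhibits mutation, up to the signs in row and column \<open>i\<close>, as the
  addition of multiples of row \<open>i\<close> to other rows and of column \<open>i\<close> to
  other columns.\<close>

lemma mutate_mat_eq:
  "mutate_mat i b k l = (if k = i \<or> l = i then - b k l else b k l + max 0 (b k i) * b i l + b k i * max 0 (- b i l))"
proof -
  have "(\<bar>u\<bar> * v + u * \<bar>v\<bar>) div 2 = max 0 u * v + u * max 0 (- v)" for u v :: int
  proof -
    have "\<bar>u\<bar> * v + u * \<bar>v\<bar> = 2 * (max 0 u * v + u * max 0 (- v))"
      by (auto simp: abs_if max_def algebra_simps)
    then show ?thesis by simp
  qed
  then show ?thesis by (simp add: mutate_mat_def)
qed

definition skew :: "'i set \<Rightarrow> ('i \<Rightarrow> 'i \<Rightarrow> int) \<Rightarrow> bool" where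
  "skew E b \<longleftrightarrow> (\<exists>d. (\<forall>i\<in>E. d i > 0) \<and> (\<forall>i\<in>E. \<forall>j\<in>E. d i * b i j = - (d j * b j i :: int)))"

lemma skew_sign:
  assumes "skew E b" "i \<in> E" "j \<in> E"
  shows "b i i = 0" "b i j > 0 \<longleftrightarrow> b j i < 0" "b i j = 0 \<longleftrightarrow> b j i = 0"
proof -
  obtain d where d: "d i > 0" "d j > 0" "d i * b i i = - (d i * b i i)" "d i * b i j = - (d j * b j i)"
    using assms unfolding skew_def by metis
  show "b i i = 0" using d(1,3) by auto
  have "b i j > 0 \<longleftrightarrow> d i * b i j > 0" using d(1) by (simp add: zero_less_mult_iff)
  also have "\<dots> \<longleftrightarrow> d j * b j i < 0" using d(4) by auto
  also have "\<dots> \<longleftrightarrow> b j i < 0" using d(2) by (simp add: mult_less_0_iff)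
  finally show "b i j > 0 \<longleftrightarrow> b j i < 0" .
  have "b i j = 0 \<longleftrightarrow> d i * b i j = 0" using d(1) by simp
  also have "\<dots> \<longleftrightarrow> d j * b j i = 0" using d(4) by auto
  also have "\<dots> \<longleftrightarrow> b j i = 0" using d(2) by simp
  finally show "b i j = 0 \<longleftrightarrow> b j i = 0" .
qed

lemma skew_mutate:
  assumes "skew E b" "i \<in> E"
  shows "skew E (mutate_mat i b)"
proof -
  obtain d where d: "\<And>j. j \<in> E \<Longrightarrow> d j > 0" "\<And>j k. j \<in> E \<Longrightarrow> k \<in> E \<Longrightarrow> d j * b j k = - (d k * b k j)"
    using assms unfolding skew_def by metis
  have "d k * mutate_mat i b k l = - (d l * mutate_mat i b l k)" if kl: "k \<in> E" "l \<in> E" for k l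
  proof (cases "k = i \<or> l = i")
    case True
    then show ?thesis using d(2)[OF kl] unfolding mutate_mat_eq by auto
  next
    case False
    have 1: "d k * b k i = - (d i * b i k)" "d i * b i l = - (d l * b l i)" by (rule d(2)[OF kl(1) assms(2)], rule d(2)[OF assms(2) kl(2)])
    have "d k * (b k i * b i l) = (d k * b k i) * b i l" by simp
    also have "\<dots> = - b i k * (d i * b i l)" unfolding 1(1) by (simp add: algebra_simps)
    also have "\<dots> = d l * (b l i * b i k)" unfolding 1(2) by (simp add: algebra_simps)
    finally have 2: "d k * (b k i * b i l) = d l * (b l i * b i k)" .
    have s: "b k i > 0 \<longleftrightarrow> b i k < 0" "b i k > 0 \<longleftrightarrow> b k i < 0" "b i l > 0 \<longleftrightarrow> b l i < 0" "b l i > 0 \<longleftrightarrow> b i l < 0"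
      using skew_sign(2)[OF assms(1)] kl assms(2) by blast+
    have "d k * (max 0 (b k i) * b i l + b k i * max 0 (- b i l)) =
      - (d l * (max 0 (b l i) * b i k + b l i * max 0 (- b i k)))"
    proof -
      have mx: "max 0 u * v + u * max 0 (- v) = (if u > 0 \<and> v > 0 then u * v else if u < 0 \<and> v < 0 then - (u * v) else 0)"
        for u v :: int by (auto simp: max_def)
      show ?thesis unfolding mx using s 2 by auto
    qed
    then show ?thesis using d(2)[OF kl] False unfolding mutate_mat_eq by (simp add: algebra_simps)
  qed
  then show ?thesis unfolding skew_def using d(1) by blast
qed

definition cols_indep :: "'i set \<Rightarrow> 'i set \<Rightarrow> ('i \<Rightarrow> 'i \<Rightarrow> int) \<Rightarrow> bool" where
  "cols_indep I E b \<longleftrightarrow> (\<forall>c. (\<forall>k\<in>I. (\<Sum>l\<in>E. c l * b k l) = 0) \<longrightarrow> (\<forall>l\<in>E. c l = 0))"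

text \<open>Mutation consists of invertible row and column operations, so a relation
  \<open>c\<close> among the new columns can be carried back to a relation \<open>c'\<close> among
  the old ones.\<close>

lemma cols_indep_mutate:
  assumes "cols_indep I E b" "i \<in> E" "E \<subseteq> I" "finite E" "b i i = 0"
  shows "cols_indep I E (mutate_mat i b)"
  unfolding cols_indep_def
proof (intro allI impI)
  fix c assume c: "\<forall>k\<in>I. (\<Sum>l\<in>E. c l * mutate_mat i b k l) = 0"
  have split: "(\<Sum>l\<in>E. f l) = f i + (\<Sum>l\<in>E - {i}. f l)" for f :: "nat \<Rightarrow> int"
    using sum.remove[OF assms(4,2)] .
  \<comment> \<open>The entry at \<open>i\<close> collects the multiples of column \<open>i\<close>
    that mutation adds to the other columns; its minus sign is the sign change of column
    \<open>i\<close>.\<close>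
  define c' where "c' = c(i := - c i + (\<Sum>l\<in>E - {i}. c l * max 0 (- b i l)))"
  \<comment> \<open>Row \<open>i\<close> of the relation; it cancels the contribution of the row
    operation.\<close>
  have s0: "(\<Sum>l\<in>E - {i}. c l * b i l) = 0"
  proof -
    have "(\<Sum>l\<in>E. c l * mutate_mat i b i l) = - (\<Sum>l\<in>E. c l * b i l)"
      by (simp add: mutate_mat_eq sum_negf)
    then show ?thesis using c assms(2,3,5) split[of "\<lambda>l. c l * b i l"] by auto
  qed
  have "(\<Sum>l\<in>E. c' l * b k l) = 0" if k: "k \<in> I" for k
  proof (cases "k = i")
    case True
    then show ?thesis using s0 assms(5) unfolding split c'_def by simp
  next
    case False
    have "0 = (\<Sum>l\<in>E. c l * mutate_mat i b k l)" using c k by simp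
    also have "\<dots> = - (c i * b k i) + (\<Sum>l\<in>E - {i}. c l * (b k l + max 0 (b k i) * b i l + b k i * max 0 (- b i l)))"
      unfolding split using False by (simp add: mutate_mat_eq)
    also have "(\<Sum>l\<in>E - {i}. c l * (b k l + max 0 (b k i) * b i l + b k i * max 0 (- b i l))) =
      (\<Sum>l\<in>E - {i}. c l * b k l) + max 0 (b k i) * (\<Sum>l\<in>E - {i}. c l * b i l)
       + b k i * (\<Sum>l\<in>E - {i}. c l * max 0 (- b i l))"
      by (simp add: sum_distrib_left sum.distrib algebra_simps)
    also have "\<dots> = (\<Sum>l\<in>E - {i}. c l * b k l) + b k i * (\<Sum>l\<in>E - {i}. c l * max 0 (- b i l))"
      using s0 by simp
    finally have "0 = (\<Sum>l\<in>E - {i}. c l * b k l) + b k i * (- c i + (\<Sum>l\<in>E - {i}. c l * max 0 (- b i l)))"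
      by (simp add: algebra_simps)
    then show ?thesis unfolding split c'_def by (simp add: mult.commute)
  qed
  then have z: "\<forall>l\<in>E. c' l = 0" using assms(1) unfolding cols_indep_def by blast
  then have 1: "c l = 0" if "l \<in> E - {i}" for l using that unfolding c'_def by (auto dest!: bspec[of _ _ l])
  then have "(\<Sum>l\<in>E - {i}. c l * max 0 (- b i l)) = 0" by simp
  then have "c i = 0" using z assms(2) unfolding c'_def by auto
  then show "\<forall>l\<in>E. c l = 0" using 1 by blast
qed

lemma cols_indep_nonzero:
  assumes "cols_indep I E b" "j \<in> E" "finite E"
  shows "\<exists>k\<in>I. b k j \<noteq> 0"
proof (rule ccontr)
  assume "\<not> ?thesis"
  moreover have "(\<Sum>l\<in>E. (if l = j then 1 else 0) * b k l) = (\<Sum>l\<in>E. if l = j then b k l else 0)" for k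
    by (rule sum.cong) auto
  ultimately have "\<forall>k\<in>I. (\<Sum>l\<in>E. (if l = j then 1 else 0) * b k l) = 0"
    using assms(2,3) by simp
  then have "(if j = j then 1 else 0 :: int) = 0"
    using assms(1)[unfolded cols_indep_def, rule_format, of "\<lambda>l. if l = j then 1 else 0" j] assms(2) by blast
  then show False by simp
qed

text \<open>If these minors all vanished, \<open>b k j\<close> times column \<open>i\<close> minus
  \<open>b k i\<close> times column \<open>j\<close> would be a nontrivial relation. A nonzero minor
  is what makes two binomials coprime.\<close>

lemma cols_indep_two:
  assumes "cols_indep I E b" "i \<in> E" "j \<in> E" "i \<noteq> j" "finite E"
  obtains k l where "k \<in> I" "b k j \<noteq> 0" "l \<in> I" "b k j * b l i \<noteq> b k i * b l j"
proof -
  obtain k where k: "k \<in> I" "b k j \<noteq> 0" using cols_indep_nonzero[OF assms(1,3,5)] by blast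
  have "\<exists>l\<in>I. b k j * b l i \<noteq> b k i * b l j"
  proof (rule ccontr)
    assume n: "\<not> ?thesis"
    define c where "c = (\<lambda>l. if l = i then b k j else if l = j then - b k i else 0)"
    have "(\<Sum>l\<in>E. c l * b m l) = 0" if m: "m \<in> I" for m
    proof -
      have "(\<Sum>l\<in>E. c l * b m l) = (\<Sum>l\<in>{i, j}. c l * b m l)"
        by (rule sum.mono_neutral_right[OF assms(5)]) (use assms(2,3) in \<open>auto simp: c_def\<close>)
      also have "\<dots> = b k j * b m i - b k i * b m j" using assms(4) by (simp add: c_def)
      finally show ?thesis using n m by simp
    qed
    then have "c i = 0" using assms(1,2) unfolding cols_indep_def by blast
    then show False using k unfolding c_def by simp
  qed
  then show thesis using that k by blast
qed

context field
begin

subsection \<open>Coprimality of binomials\<close>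

text \<open>\<open>1 + w t\<close> has constant term 1, so it is invertible as a power series in
  \<open>t\<close>: solving for the coefficients of \<open>h\<close> from the lowest one up yields
  multiples of \<open>r\<close>.\<close>

lemma cop_adj:
  assumes "subring A R" "trans A t" "w \<in> adj A t" "r \<in> A" "r \<noteq> \<zero>"
  shows "h \<in> adj A t \<Longrightarrow> a \<in> adj A t \<Longrightarrow> r \<otimes> a = (\<one> \<oplus> w \<otimes> t) \<otimes> h \<Longrightarrow> \<exists>h'\<in>adj A t. h = r \<otimes> h'"
proof (induct arbitrary: a rule: simple_extension.induct)
  case zero
  then show ?case using subring_closed(1)[OF assms(1,4)] by (intro bexI[of _ \<zero>]) auto
next
  case (lin q s)
  note t = transD(1,2)[OF assms(2)] note PS = adj_subring[OF assms(1) t(1)]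
  note P = subring_closed[OF PS] and A = subring_closed[OF assms(1)]
  obtain a1 a0 where a: "a1 \<in> adj A t" "a0 \<in> A" "a = a1 \<otimes> t \<oplus> a0" using adj_cases[OF assms(1) t(1) lin(4)] by blast
  have c: "q \<in> carrier R" "s \<in> carrier R" "a1 \<in> carrier R" "a0 \<in> carrier R" "r \<in> carrier R" "w \<in> carrier R"
    using a(1,2) lin(1,3) assms(3,4) P(1) A(1) by auto
  have rP: "r \<in> adj A t" "s \<in> adj A t" "a0 \<in> adj A t" using adj_incl[OF assms(1) t(1)] assms(4) lin(3) a(2) by auto
  have l1: "r \<otimes> a1 \<in> adj A t" using P(4)[OF rP(1) a(1)] .
  have l2: "q \<oplus> w \<otimes> (q \<otimes> t \<oplus> s) \<in> adj A t"
    using P(5)[OF lin(1) P(4)[OF assms(3) simple_extension.lin[OF lin(1,3)]]] .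
  have "(r \<otimes> a1) \<otimes> t \<oplus> r \<otimes> a0 = r \<otimes> a" unfolding a(3) using c t by algebra
  also have "\<dots> = (q \<oplus> w \<otimes> (q \<otimes> t \<oplus> s)) \<otimes> t \<oplus> s" unfolding lin(5) using c t by algebra
  finally have e: "(r \<otimes> a1) \<otimes> t \<oplus> r \<otimes> a0 = (q \<oplus> w \<otimes> (q \<otimes> t \<oplus> s)) \<otimes> t \<oplus> s" .
  note u = trans_unique[OF assms(1,2) l1 l2 A(4)[OF assms(4) a(2)] lin(3) e]
  have "r \<otimes> (a1 \<ominus> w \<otimes> a0) = r \<otimes> a1 \<ominus> w \<otimes> (r \<otimes> a0)" using c by algebra
  also have "\<dots> = (\<one> \<oplus> w \<otimes> t) \<otimes> q" unfolding u using c t by algebra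
  finally have "r \<otimes> (a1 \<ominus> w \<otimes> a0) = (\<one> \<oplus> w \<otimes> t) \<otimes> q" .
  then obtain q' where q': "q' \<in> adj A t" "q = r \<otimes> q'"
    using lin(2)[OF P(6)[OF a(1) P(4)[OF assms(3) rP(3)]]] by blast
  have "q' \<in> carrier R" using q' P(1) by blast
  then have "q \<otimes> t \<oplus> s = r \<otimes> (q' \<otimes> t \<oplus> a0)" unfolding q'(2) u(2)[symmetric] using c t by algebra
  then show ?case using simple_extension.lin[OF q'(1) a(2)] by blast
qed

lemma cop_laur:
  assumes "subring A R" "trans A t" "w \<in> adj A t" "r \<in> A" "r \<noteq> \<zero>" "h \<in> laur A t" "a \<in> laur A t"
    and "r \<otimes> a = (\<one> \<oplus> w \<otimes> t) \<otimes> h"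
  shows "dv (laur A t) (\<one> \<oplus> w \<otimes> t) a"
proof -
  note t = transD(1,2)[OF assms(2)] note PS = adj_subring[OF assms(1) t(1)]
  note L = subring_closed[OF laur_subring[OF assms(1) t(1)]]
  obtain n :: nat where n: "h \<in> carrier R" "h \<otimes> t [^] n \<in> adj A t" using assms(6) laurE by blast
  obtain m :: nat where m: "a \<in> carrier R" "a \<otimes> t [^] m \<in> adj A t" using assms(7) laurE by blast
  define k where "k = n + m"
  have hk: "h \<otimes> t [^] k \<in> adj A t" "a \<otimes> t [^] k \<in> adj A t"
    using adj_pow_raise[OF assms(1) t(1) n, of k] adj_pow_raise[OF assms(1) t(1) m, of k] by (simp_all add: k_def)
  have c: "r \<in> carrier R" "w \<in> carrier R" "t [^] k \<in> carrier R"
    using assms subring_closed(1)[OF assms(1)] subring_closed(1)[OF PS] t by auto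
  have "r \<otimes> (a \<otimes> t [^] k) = (r \<otimes> a) \<otimes> t [^] k" using c m by (simp add: m_assoc)
  also have "\<dots> = (\<one> \<oplus> w \<otimes> t) \<otimes> (h \<otimes> t [^] k)" unfolding assms(8) using c n t by (simp add: m_assoc)
  finally have e: "r \<otimes> (a \<otimes> t [^] k) = (\<one> \<oplus> w \<otimes> t) \<otimes> (h \<otimes> t [^] k)" .
  obtain h' where h': "h' \<in> adj A t" "h \<otimes> t [^] k = r \<otimes> h'" using cop_adj[OF assms(1-5) hk e] by blast
  have hc: "h' \<in> carrier R" using h' subring_closed(1)[OF PS] by blast
  have P: "\<one> \<oplus> w \<otimes> t \<in> carrier R" using c t by simp
  have "(a \<otimes> t [^] k) \<otimes> r = r \<otimes> (a \<otimes> t [^] k)" using c m by (simp add: m_comm)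
  also have "\<dots> = ((\<one> \<oplus> w \<otimes> t) \<otimes> h') \<otimes> r" unfolding e h'(2) using c(1) hc P by (simp add: m_ac)
  finally have ak: "a \<otimes> t [^] k = (\<one> \<oplus> w \<otimes> t) \<otimes> h'"
    by (rule cancel_nonzero[OF c(1) assms(5) m_closed[OF m(1) c(3)] m_closed[OF P hc]])
  note i = inv_nonzero[OF t]
  have "a = a \<otimes> (t [^] k \<otimes> inv t [^] k)" using m inv_pow[OF t] by simp
  also have "\<dots> = (a \<otimes> t [^] k) \<otimes> inv t [^] k" using m c i by (simp add: m_assoc)
  also have "\<dots> = (\<one> \<oplus> w \<otimes> t) \<otimes> (h' \<otimes> inv t [^] k)" unfolding ak using hc c i t by (simp add: m_assoc)
  finally show ?thesis
    using dvI[OF L(4)[OF subsetD[OF adj_in_laur[OF assms(1) t(1)] h'(1)] L(8)[OF laur_mem(2)[OF assms(1) t]]]] by blast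
qed

lemma dv_unit_iff:
  assumes "subring B R" "v \<in> B" "w \<in> B" "v \<otimes> w = \<one>" "f \<in> carrier R"
  shows "dv B (v \<otimes> f) a \<longleftrightarrow> dv B f a"
proof
  have c: "v \<in> carrier R" "w \<in> carrier R" using assms subring_closed(1) by auto
  {
    assume "dv B (v \<otimes> f) a"
    then obtain d where d: "d \<in> B" "a = (v \<otimes> f) \<otimes> d" unfolding dv_def by auto
    then have "a = f \<otimes> (v \<otimes> d)" using c assms(5) subring_closed(1)[OF assms(1) d(1)] by (simp add: m_ac)
    then show "dv B f a" using subring_closed(4)[OF assms(1,2) d(1)] dvI by blast
  }
  {
    assume "dv B f a"
    then obtain d where d: "d \<in> B" "a = f \<otimes> d" unfolding dv_def by auto
    have dc: "d \<in> carrier R" using d subring_closed(1)[OF assms(1)] by blast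
    have "(v \<otimes> f) \<otimes> (w \<otimes> d) = (v \<otimes> w) \<otimes> (f \<otimes> d)" using c assms(5) dc by (simp add: m_ac)
    then have "a = (v \<otimes> f) \<otimes> (w \<otimes> d)" using d assms(4,5) dc by simp
    then show "dv B (v \<otimes> f) a" using subring_closed(4)[OF assms(1,3) d(1)] dvI by blast
  }
qed

lemma binomial_flip:
  assumes "nz x J"
  shows "\<one> \<oplus> mon x J e = mon x J e \<otimes> (\<one> \<oplus> mon x J (\<lambda>k. - e k))"
proof -
  have "mon x J e \<otimes> mon x J (\<lambda>k. - e k) = \<one>"
    using mon_uminus[OF assms] mon_closed[OF assms] by (simp add: m_comm)
  then show ?thesis using mon_closed(1)[OF assms] by (simp add: r_distr a_comm)
qed

text \<open>The ideal generated by \<open>1 + X\<^sup>\<alpha>\<close> and \<open>1 + X\<^sup>\<beta>\<close> contains \<open>X\<^sup>\<gamma> - 1\<close> for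
  every even combination \<open>\<gamma>\<close> of \<open>\<alpha>\<close> and \<open>\<beta>\<close>; eliminating the variable \<open>k\<close> leaves a nonzero
  constant in the other variables.\<close>

lemma binomials_eliminate:
  fixes p q :: int
  assumes "subring K R" "nz x J" "finite J"
  shows "\<exists>s1\<in>LP K x J. \<exists>s2\<in>LP K x J.
    mon x J (\<lambda>l. 2 * p * \<alpha> l + 2 * q * \<beta> l) \<ominus> \<one> = (\<one> \<oplus> mon x J \<beta>) \<otimes> s1 \<oplus> (\<one> \<oplus> mon x J \<alpha>) \<otimes> s2"
proof -
  note BS = LP_subring[OF assms(1,2)] note B = subring_closed[OF BS]
  let ?B = "LP K x J" let ?f = "\<one> \<oplus> mon x J \<beta>" let ?g = "\<one> \<oplus> mon x J \<alpha>"
  \<comment> \<open>The exponents \<open>e\<close> for which \<open>X^e - 1\<close> lies in the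
    ideal form a group. It contains twice \<alpha> and twice \<beta>, because \<open>X^e + 1\<close>
    divides \<open>X^(2e) - 1\<close>.\<close>
  define H where "H = (\<lambda>e. \<exists>s1\<in>?B. \<exists>s2\<in>?B. mon x J e \<ominus> \<one> = ?f \<otimes> s1 \<oplus> ?g \<otimes> s2)"
  have m: "mon x J e \<in> ?B" "mon x J e \<in> carrier R" for e using mon_LP[OF assms(1-3)] mon_closed[OF assms(2)] by auto
  have fg: "?f \<in> carrier R" "?g \<in> carrier R" using m by auto
  have add: "H (\<lambda>l. e l + e' l)" if ee: "H e" "H e'" for e e'
  proof -
    obtain s1 s2 where s: "s1 \<in> ?B" "s2 \<in> ?B" "mon x J e \<ominus> \<one> = ?f \<otimes> s1 \<oplus> ?g \<otimes> s2" using ee(1) unfolding H_def by blast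
    obtain t1 t2 where t: "t1 \<in> ?B" "t2 \<in> ?B" "mon x J e' \<ominus> \<one> = ?f \<otimes> t1 \<oplus> ?g \<otimes> t2" using ee(2) unfolding H_def by blast
    have c: "s1 \<in> carrier R" "s2 \<in> carrier R" "t1 \<in> carrier R" "t2 \<in> carrier R" using s t B(1) by auto
    have "mon x J e \<otimes> mon x J e' \<ominus> \<one> = mon x J e \<otimes> (mon x J e' \<ominus> \<one>) \<oplus> (mon x J e \<ominus> \<one>)"
      using m(2)[of e] m(2)[of e'] by algebra
    also have "\<dots> = ?f \<otimes> (mon x J e \<otimes> t1 \<oplus> s1) \<oplus> ?g \<otimes> (mon x J e \<otimes> t2 \<oplus> s2)"
      unfolding s(3) t(3) using c fg m(2)[of e] by algebra
    finally show ?thesis unfolding H_def mon_add[OF assms(2)] using B(5)[OF B(4)[OF m(1)]] s t by blast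
  qed
  have neg: "H (\<lambda>l. - e l)" if ee: "H e" for e
  proof -
    obtain s1 s2 where s: "s1 \<in> ?B" "s2 \<in> ?B" "mon x J e \<ominus> \<one> = ?f \<otimes> s1 \<oplus> ?g \<otimes> s2" using ee(1) unfolding H_def by blast
    define n where "n = mon x J (\<lambda>l. - e l)"
    have n: "n \<in> ?B" "n \<in> carrier R" "n \<otimes> mon x J e = \<one>" unfolding n_def using m mon_uminus[OF assms(2)] by auto
    have c: "s1 \<in> carrier R" "s2 \<in> carrier R" using s B(1) by auto
    have "n \<ominus> \<one> = n \<ominus> n \<otimes> mon x J e" using n by simp
    also have "\<dots> = (\<ominus> n) \<otimes> (mon x J e \<ominus> \<one>)" using m(2)[of e] n(2) by algebra
    also have "\<dots> = ?f \<otimes> (\<ominus> n \<otimes> s1) \<oplus> ?g \<otimes> (\<ominus> n \<otimes> s2)"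
      unfolding s(3) using c fg n(2) by algebra
    finally show ?thesis unfolding H_def n_def[symmetric] using B(4)[OF B(7)[OF n(1)]] s by blast
  qed
  have zero: "H (\<lambda>l. 0)" unfolding H_def
    using B(2) mon_zero[OF assms(2), of "\<lambda>l. 0"] fg
    by (intro bexI[of _ \<zero>]) (auto simp: a_minus_def r_neg)
  have nat_mult: "H (\<lambda>l. int n * e l)" if "H e" for e n
  proof (induct n)
    case (Suc n)
    have "(\<lambda>l. int (Suc n) * e l) = (\<lambda>l. int n * e l + e l)" by (auto simp: algebra_simps)
    then show ?case using add[OF Suc that] by simp
  qed (use zero in simp)
  have int_mult: "H (\<lambda>l. p * e l)" if "H e" for e p
  proof (cases "p \<ge> 0")
    case True
    then show ?thesis using nat_mult[OF that, of "nat p"] by simp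
  next
    case False
    then have "(\<lambda>l. p * e l) = (\<lambda>l. - (int (nat (- p)) * e l))" by simp
    then show ?thesis using neg[OF nat_mult[OF that, of "nat (- p)"]] by simp
  qed
  have two: "mon x J (\<lambda>l. 2 * e l) \<ominus> \<one> = (\<one> \<oplus> mon x J e) \<otimes> (mon x J e \<ominus> \<one>)" for e
  proof -
    have "(\<lambda>l. 2 * e l) = (\<lambda>l. e l + e l)" by (rule ext) simp
    then have "mon x J (\<lambda>l. 2 * e l) = mon x J e \<otimes> mon x J e" using mon_add[OF assms(2), of e e] by (simp only:)
    moreover have "mon x J e \<otimes> mon x J e \<ominus> \<one> = (\<one> \<oplus> mon x J e) \<otimes> (mon x J e \<ominus> \<one>)"
      using m(2)[of e] by algebra
    ultimately show ?thesis by simp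
  qed
  have "H (\<lambda>l. 2 * \<beta> l)" unfolding H_def two
    using fg m(2)[of \<beta>] B(2) B(6)[OF m(1) B(3)] by (intro bexI[of _ "mon x J \<beta> \<ominus> \<one>"] bexI[of _ \<zero>]) auto
  moreover have "H (\<lambda>l. 2 * \<alpha> l)" unfolding H_def two
    using fg m(2)[of \<alpha>] B(2) B(6)[OF m(1) B(3)] by (intro bexI[of _ \<zero>] bexI[of _ "mon x J \<alpha> \<ominus> \<one>"]) auto
  ultimately have "H (\<lambda>l. p * (2 * \<alpha> l) + q * (2 * \<beta> l))" using add int_mult by blast
  moreover have "(\<lambda>l. p * (2 * \<alpha> l) + q * (2 * \<beta> l)) = (\<lambda>l. 2 * p * \<alpha> l + 2 * q * \<beta> l)" by (simp add: algebra_simps)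
  ultimately show ?thesis unfolding H_def by simp
qed

text \<open>The combination of \<alpha> and \<beta> in which \<open>x k\<close> cancels gives an
  element \<open>r\<close> of the ideal, free of \<open>x k\<close>, and nonzero by the minor at
  \<open>k\<close> and \<open>l\<close>. The binomial of \<beta> divides
  \<open>r \<otimes> a\<close>; being of the form \<open>1 + w x_k\<close>, it is coprime to the
  constant \<open>r\<close>.\<close>

lemma binomials_coprime_pos:
  assumes "subring K R" "indep K x I" "finite J" "J \<subseteq> I" "k \<in> J" "l \<in> J" "\<beta> k > 0" "\<beta> k * \<alpha> l \<noteq> \<alpha> k * \<beta> l"
    and a: "a \<in> LP K x J" "dv (LP K x J) (\<one> \<oplus> mon x J \<beta>) ((\<one> \<oplus> mon x J \<alpha>) \<otimes> a)"
  shows "dv (LP K x J) (\<one> \<oplus> mon x J \<beta>) a"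
proof -
  have nJ: "nz x J" using nz_mono[OF indep_nz[OF assms(2)] assms(4)] .
  have nJk: "nz x (J - {k})" using nz_mono[OF nJ] by auto
  let ?A = "LP K x (J - {k})" let ?B = "LP K x J"
  have LB: "?B = laur ?A (x k)" using LP_remove[OF assms(1) nJ assms(5)] .
  note AS = LP_subring[OF assms(1) nJk] and BS = LP_subring[OF assms(1) nJ]
  note B = subring_closed[OF BS]
  have t: "trans ?A (x k)" using indep_trans[OF assms(1,2), of k "J - {k}"] assms(4,5) by blast
  note tc = transD(1,2)[OF t]
  note PS = adj_subring[OF AS tc(1)]
  have mc: "mon x J e \<in> carrier R" for e using mon_closed[OF nJ] by blast
  define r where "r = mon x J (\<lambda>l. 2 * \<beta> k * \<alpha> l + 2 * (- \<alpha> k) * \<beta> l) \<ominus> \<one>"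
  obtain s1 s2 where s: "s1 \<in> ?B" "s2 \<in> ?B" "r = (\<one> \<oplus> mon x J \<beta>) \<otimes> s1 \<oplus> (\<one> \<oplus> mon x J \<alpha>) \<otimes> s2"
    using binomials_eliminate[OF assms(1) nJ assms(3)] unfolding r_def by blast
  have rA: "r \<in> ?A"
  proof -
    have "mon x J (\<lambda>l. 2 * \<beta> k * \<alpha> l + 2 * (- \<alpha> k) * \<beta> l) = mon x (J - {k}) (\<lambda>l. 2 * \<beta> k * \<alpha> l + 2 * (- \<alpha> k) * \<beta> l)"
      by (rule mon_drop[OF assms(3) nJ, symmetric]) simp
    then show ?thesis unfolding r_def
      using subring_closed(6)[OF AS mon_LP[OF assms(1) nJk] subring_closed(3)[OF AS]] assms(3) by simp
  qed
  have r0: "r \<noteq> \<zero>"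
  proof
    assume "r = \<zero>"
    then have "mon x J (\<lambda>l. 2 * \<beta> k * \<alpha> l + 2 * (- \<alpha> k) * \<beta> l) = \<one>"
      unfolding r_def using mc by (simp add: r_right_minus_eq)
    moreover have "2 * \<beta> k * \<alpha> l + 2 * (- \<alpha> k) * \<beta> l \<noteq> 0" using assms(8) by (simp add: algebra_simps)
    ultimately show False
      using mon_not_const[OF assms(1-4,6), of "\<lambda>l. 2 * \<beta> k * \<alpha> l + 2 * (- \<alpha> k) * \<beta> l" \<one>]
        subring_closed(3)[OF assms(1)] by blast
  qed
  obtain h where h: "h \<in> ?B" "(\<one> \<oplus> mon x J \<alpha>) \<otimes> a = (\<one> \<oplus> mon x J \<beta>) \<otimes> h" using a unfolding dv_def by auto
  have c: "s1 \<in> carrier R" "s2 \<in> carrier R" "a \<in> carrier R" "h \<in> carrier R" "r \<in> carrier R"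
    using s(1,2) a(1) h(1) B(1) rA subring_closed(1)[OF AS] by auto
  have "r \<otimes> a = (\<one> \<oplus> mon x J \<beta>) \<otimes> (s1 \<otimes> a) \<oplus> s2 \<otimes> ((\<one> \<oplus> mon x J \<alpha>) \<otimes> a)"
    unfolding s(3) using c mc[of \<alpha>] mc[of \<beta>] by algebra
  also have "\<dots> = (\<one> \<oplus> mon x J \<beta>) \<otimes> (s1 \<otimes> a \<oplus> s2 \<otimes> h)" unfolding h(2) using c mc[of \<beta>] by algebra
  finally have e: "r \<otimes> a = (\<one> \<oplus> mon x J \<beta>) \<otimes> (s1 \<otimes> a \<oplus> s2 \<otimes> h)" .
  have hB: "s1 \<otimes> a \<oplus> s2 \<otimes> h \<in> ?B" using B(5)[OF B(4)[OF s(1) a(1)] B(4)[OF s(2) h(1)]] .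
  obtain n where n: "\<beta> k = int (Suc n)" using assms(7) by (metis Suc_pred nat_0_le less_imp_le zero_less_nat_eq)
  define w where "w = mon x (J - {k}) \<beta> \<otimes> x k [^] n"
  have mA: "mon x (J - {k}) \<beta> \<in> ?A" using mon_LP[OF assms(1) nJk] assms(3) by simp
  have w: "w \<in> adj ?A (x k)" unfolding w_def
    using subring_closed(4)[OF PS adj_incl[OF AS tc(1) mA] subring_closed(8)[OF PS adj_mem[OF AS tc(1)]]] .
  have f: "mon x J \<beta> = w \<otimes> x k"
    unfolding mon_remove[OF assms(3,5) nJ] w_def n ipow_nat[OF tc]
    using tc subring_closed(1)[OF AS mA] by (simp add: m_ac)
  show ?thesis using cop_laur[OF AS t w rA r0] hB a(1) e unfolding LB f by blast
qed

text \<open>If \<open>x k\<close> has a negative exponent, \<beta> is replaced by its negative,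
  which changes the binomial by a unit.\<close>

lemma binomials_coprime:
  assumes "subring K R" "indep K x I" "finite J" "J \<subseteq> I" "k \<in> J" "l \<in> J" "\<beta> k \<noteq> 0" "\<beta> k * \<alpha> l \<noteq> \<alpha> k * \<beta> l"
    and a: "a \<in> LP K x J" "dv (LP K x J) (\<one> \<oplus> mon x J \<beta>) ((\<one> \<oplus> mon x J \<alpha>) \<otimes> a)"
  shows "dv (LP K x J) (\<one> \<oplus> mon x J \<beta>) a"
proof (cases "\<beta> k > 0")
  case True
  then show ?thesis using binomials_coprime_pos[OF assms(1-6) _ assms(8)] a by blast
next
  case False
  have nJ: "nz x J" using nz_mono[OF indep_nz[OF assms(2)] assms(4)] .
  note BS = LP_subring[OF assms(1) nJ]
  let ?f = "\<one> \<oplus> mon x J (\<lambda>k. - \<beta> k)"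
  have m: "mon x J e \<in> LP K x J" "mon x J e \<in> carrier R" for e using mon_LP[OF assms(1) nJ assms(3)] mon_closed[OF nJ] by auto
  have 1: "mon x J \<beta> \<otimes> mon x J (\<lambda>k. - \<beta> k) = \<one>" using mon_uminus[OF nJ] m by (simp add: m_comm)
  have eq: "dv (LP K x J) (\<one> \<oplus> mon x J \<beta>) b \<longleftrightarrow> dv (LP K x J) ?f b" for b
    unfolding binomial_flip[OF nJ, of \<beta>] by (rule dv_unit_iff[OF BS m(1) m(1) 1]) (use m in simp)
  have "- \<beta> k > 0" "- \<beta> k * \<alpha> l \<noteq> \<alpha> k * - \<beta> l" using False assms(7,8) by auto
  then show ?thesis
    using binomials_coprime_pos[OF assms(1-6), of "\<lambda>k. - \<beta> k" \<alpha>] a unfolding eq by blast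
qed

subsection \<open>The upper bound\<close>

definition exch :: "(nat \<Rightarrow> 'a) \<Rightarrow> nat set \<Rightarrow> (nat \<Rightarrow> nat \<Rightarrow> int) \<Rightarrow> nat \<Rightarrow> 'a" where
  "exch x I b i = mon x I (\<lambda>k. max 0 (b k i)) \<oplus> mon x I (\<lambda>k. max 0 (- b k i))"

text \<open>\<open>fl x I b j\<close> is the exchange polynomial divided by its second monomial, a unit of
  \<open>LP K x (I - {j})\<close>.\<close>

definition fl :: "(nat \<Rightarrow> 'a) \<Rightarrow> nat set \<Rightarrow> (nat \<Rightarrow> nat \<Rightarrow> int) \<Rightarrow> nat \<Rightarrow> 'a" where
  "fl x I b j = \<one> \<oplus> mon x (I - {j}) (\<lambda>k. b k j)"

definition mutx :: "(nat \<Rightarrow> 'a) \<Rightarrow> nat set \<Rightarrow> (nat \<Rightarrow> nat \<Rightarrow> int) \<Rightarrow> nat \<Rightarrow> nat \<Rightarrow> 'a" where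
  "mutx x I b i = x(i := exch x I b i \<otimes> inv (x i))"

text \<open>Collects what mutation preserves. Principal coefficients are lost under mutation, so
  only the independence of the columns is recorded.\<close>

definition good :: "'a set \<Rightarrow> (nat \<Rightarrow> 'a) \<Rightarrow> nat set \<Rightarrow> nat set \<Rightarrow> (nat \<Rightarrow> nat \<Rightarrow> int) \<Rightarrow> bool" where
  "good K x I E b \<longleftrightarrow> finite I \<and> E \<subseteq> I \<and> indep K x I \<and> skew E b \<and> cols_indep I E b"

text \<open>The Laurent ring is a condition of its own because the set of directions may be empty;
  the inductions over that set start there.\<close>

definition UB :: "'a set \<Rightarrow> (nat \<Rightarrow> 'a) \<Rightarrow> nat set \<Rightarrow> nat set \<Rightarrow> (nat \<Rightarrow> nat \<Rightarrow> int) \<Rightarrow> 'a set" where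
  "UB K x I E b = {z \<in> LP K x I. \<forall>j\<in>E. z \<in> exring (LP K x (I - {j})) (x j) (fl x I b j)}"

lemma unit_flip:
  assumes "y \<in> carrier R" "y' \<in> carrier R" "y \<otimes> y' = \<one>"
  shows "\<one> \<oplus> y = y \<otimes> (\<one> \<oplus> y')"
  using assms by (simp add: r_distr a_comm)

lemma mon_inverse: "nz x J \<Longrightarrow> mon x J e \<otimes> mon x J (\<lambda>k. - e k) = \<one>"
  using mon_uminus[of x J e] mon_closed(1)[of x J] by (simp add: m_comm)

lemma exch_fl:
  assumes "finite I" "nz x I" "b i i = 0"
  shows "exch x I b i = mon x (I - {i}) (\<lambda>k. max 0 (- b k i)) \<otimes> fl x I b i"
proof -
  have n: "nz x (I - {i})" using nz_mono[OF assms(2)] by auto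
  have m: "mon x (I - {i}) e \<in> carrier R" for e using mon_closed[OF n] by blast
  have e: "(\<lambda>k. max 0 (b k i)) = (\<lambda>k. max 0 (- b k i) + b k i)" by (rule ext) simp
  have "mon x I (\<lambda>k. max 0 (b k i)) = mon x (I - {i}) (\<lambda>k. max 0 (- b k i) + b k i)"
    using mon_drop[OF assms(1,2), of "\<lambda>k. max 0 (b k i)" i] assms(3) unfolding e by simp
  moreover have "mon x I (\<lambda>k. max 0 (- b k i)) = mon x (I - {i}) (\<lambda>k. max 0 (- b k i))"
    using mon_drop[OF assms(1,2), of "\<lambda>k. max 0 (- b k i)" i] assms(3) by simp
  ultimately show ?thesis unfolding exch_def fl_def mon_add[OF n] using m by (simp add: r_distr a_comm)
qed

lemma fl_closed:
  assumes "subring K R" "finite I" "nz x I"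
  shows "fl x I b j \<in> LP K x (I - {j})"
proof -
  have n: "nz x (I - {j})" using nz_mono[OF assms(3)] by auto
  note S = LP_subring[OF assms(1) n]
  show ?thesis unfolding fl_def
    using subring_closed(5)[OF S subring_closed(3)[OF S] mon_LP[OF assms(1) n]] assms(2) by simp
qed

lemma goodD:
  assumes "good K x I E b"
  shows "finite I" "E \<subseteq> I" "indep K x I" "skew E b" "cols_indep I E b" "nz x I"
  using assms indep_nz unfolding good_def by auto

lemma fl_nonzero:
  assumes "subring K R" "good K x I E b" "j \<in> E"
  shows "fl x I b j \<noteq> \<zero>"
proof
  note g = goodD[OF assms(2)]
  have n: "nz x (I - {j})" using nz_mono[OF g(6)] by auto
  assume "fl x I b j = \<zero>"
  then have "mon x (I - {j}) (\<lambda>k. b k j) \<oplus> \<one> = \<zero>"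
    unfolding fl_def using mon_closed(1)[OF n] by (simp add: a_comm)
  then have "mon x (I - {j}) (\<lambda>k. b k j) = \<ominus> \<one>"
    using minus_equality[OF _ one_closed mon_closed(1)[OF n]] by simp
  moreover obtain k where k: "k \<in> I" "b k j \<noteq> 0"
    using cols_indep_nonzero[OF g(5) assms(3) finite_subset[OF g(2,1)]] by blast
  moreover have "k \<noteq> j" using k skew_sign(1)[OF g(4) assms(3,3)] by auto
  ultimately show False
    using mon_not_const[OF assms(1) g(3), of "I - {j}" k "\<lambda>k. b k j" "\<ominus> \<one>"] g(1)
      subring_closed(7)[OF assms(1) subring_closed(3)[OF assms(1)]] by auto
qed

lemma exch_props:
  assumes "subring K R" "good K x I E b" "i \<in> E"
  shows "exch x I b i \<in> LP K x (I - {i})" "exch x I b i \<noteq> \<zero>"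
    and "exring (LP K x (I - {i})) (x i) (exch x I b i) = exring (LP K x (I - {i})) (x i) (fl x I b i)"
proof -
  note g = goodD[OF assms(2)]
  have n: "nz x (I - {i})" using nz_mono[OF g(6)] by auto
  note S = LP_subring[OF assms(1) n]
  have i: "i \<in> I" "x i \<in> carrier R" "x i \<noteq> \<zero>" using g(2) assms(3) nzD[OF g(6)] by auto
  have m: "mon x (I - {i}) e \<in> LP K x (I - {i})" for e using mon_LP[OF assms(1) n] g(1) by auto
  note e = exch_fl[of I x b i, OF g(1,6) skew_sign(1)[OF g(4) assms(3,3)]]
  note f = fl_closed[OF assms(1) g(1,6), of b i]
  show "exch x I b i \<in> LP K x (I - {i})" unfolding e using subring_closed(4)[OF S m f] .
  show "exch x I b i \<noteq> \<zero>"
    unfolding e using mon_closed[OF n] fl_nonzero[OF assms] subring_closed(1)[OF S f] by (simp add: integral_iff)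
  show "exring (LP K x (I - {i})) (x i) (exch x I b i) = exring (LP K x (I - {i})) (x i) (fl x I b i)"
    unfolding e using exring_unit[OF S i(2,3) f m m mon_inverse[OF n]] .
qed

section \<open>Mutation of the upper bound\<close>

text \<open>The new variable is a nonzero constant divided by the transcendental \<open>x i\<close>.
  For another \<open>j\<close>, its transcendence over a ring containing \<open>x j\<close> is
  turned around by \<open>trans_exchange\<close>.\<close>

lemma indep_mutx:
  assumes "subring K R" "good K x I E b" "i \<in> E"
  shows "indep K (mutx x I b i) I"
  unfolding indep_def
proof
  note g = goodD[OF assms(2)] note e = exch_props[OF assms]
  let ?x = "mutx x I b i"
  have i: "i \<in> I" using g(2) assms(3) by auto
  have nz: "nz x J" if "J \<subseteq> I" for J using nz_mono[OF g(6) that] .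
  have ti: "trans (LP K x (I - {i})) (?x i)"
    using trans_quot[OF LP_subring[OF assms(1) nz] indep_trans[OF assms(1) g(3) i] e(1,2)] by (simp add: mutx_def)
  fix j assume j: "j \<in> I"
  show "trans (LP K ?x (I - {j})) (?x j)"
  proof (cases "j = i")
    case True
    have "LP K ?x (I - {i}) = LP K x (I - {i})" by (rule LP_cong) (simp add: mutx_def)
    then show ?thesis using ti True by simp
  next
    case False
    let ?R = "LP K x (I - {j} - {i})"
    have nR: "nz x (I - {j} - {i})" by (rule nz) auto
    note RS = LP_subring[OF assms(1) nR]
    have nx: "nz ?x (I - {j})" unfolding nz_def
      using nzD[OF g(6)] transD(1,2)[OF ti] by (auto simp: mutx_def)
    have "LP K ?x (I - {j} - {i}) = ?R" by (rule LP_cong) (simp add: mutx_def)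
    then have L: "LP K ?x (I - {j}) = laur ?R (?x i)"
      using LP_remove[OF assms(1) nx, of i] i False by simp
    have tj: "trans ?R (x j)" using indep_trans[OF assms(1) g(3) j] by auto
    have nij: "nz x (I - {i})" by (rule nz) auto
    have "adj ?R (x j) \<subseteq> LP K x (I - {i})"
      by (rule adj_least[OF LP_subring[OF assms(1) nij]])
        (use LP_mono[OF assms(1) nij, of "I - {j} - {i}"] LP_mem(2)[OF assms(1) nij, of j] j False in auto)
    then have "trans (adj ?R (x j)) (?x i)" using trans_mono[OF ti] by blast
    then have "trans (adj ?R (?x i)) (x j)" using trans_exchange[OF RS tj] by blast
    then have "trans (laur ?R (?x i)) (x j)" using trans_laur[OF RS] transD(1,2)[OF ti] by blast
    then show ?thesis unfolding L using False by (simp add: mutx_def)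
  qed
qed

lemma good_mutate:
  assumes "subring K R" "good K x I E b" "i \<in> E"
  shows "good K (mutx x I b i) I E (mutate_mat i b)"
proof -
  note g = goodD[OF assms(2)]
  show ?thesis unfolding good_def
    using g(1,2) indep_mutx[OF assms] skew_mutate[OF g(4) assms(3)]
      cols_indep_mutate[OF g(5) assms(3) g(2) finite_subset[OF g(2,1)] skew_sign(1)[OF g(4) assms(3,3)]]
    by simp
qed

text \<open>The condition in direction \<open>j\<close> is carried back from the mutated seed, so
  the new variable \<open>p\<close> is given and \<open>x i = G/p\<close> is the target. If
  \<open>b i j = 0\<close>, the polynomial of \<open>j\<close> does not change and is coprime to
  \<open>G\<close>. Otherwise \<open>x i\<close> is congruent to a unit divided by \<open>p\<close>
  modulo \<open>x j\<close>, and \<open>exring_mutate_nonzero\<close> applies.\<close>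

lemma exring_mutate_other:
  assumes "subring K R" "good K x I E b" "i \<in> E" "j \<in> E" "j \<noteq> i"
    and z: "z \<in> exring (LP K (mutx x I b i) (I - {j})) (x j) (fl (mutx x I b i) I (mutate_mat i b) j)" "z \<in> LP K x I"
  shows "z \<in> exring (LP K x (I - {j})) (x j) (fl x I b j)"
proof -
  note g = goodD[OF assms(2)] note e = exch_props[OF assms(1-3)]
  define x' where "x' = mutx x I b i"
  define b' where "b' = mutate_mat i b"
  define G where "G = exch x I b i"
  note g' = goodD[OF good_mutate[OF assms(1-3)], folded x'_def b'_def]
  have ij: "i \<in> I" "j \<in> I" using g(2) assms(3,4) by auto
  let ?J = "I - {j} - {i}"
  have J: "finite ?J" "?J \<subseteq> I" "?J \<subseteq> I - {j}" using g(1) by auto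
  have nJ: "nz x ?J" "nz x (I - {j})" "nz x (I - {i})" by (rule nz_mono[OF g(6)], blast)+
  have nJ': "nz x' (I - {j})" by (rule nz_mono[OF g'(6)]) blast
  let ?R = "LP K x ?J"
  note RS = LP_subring[OF assms(1) nJ(1)] note Rc = subring_closed[OF RS]
  have eqx: "x' k = x k" if "k \<noteq> i" for k using that unfolding x'_def mutx_def by simp
  have LR: "LP K x' ?J = ?R" by (rule LP_cong) (simp add: eqx)
  define p where "p = x' i"
  define q where "q = x j"
  have pG: "p = G \<otimes> inv (x i)" unfolding p_def x'_def G_def mutx_def by simp
  have xi: "x i \<in> carrier R" "x i \<noteq> \<zero>" using nzD[OF g(6)] ij by auto
  have q: "q \<in> carrier R" "q \<noteq> \<zero>" unfolding q_def using nzD[OF g(6)] ij by auto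
  have p: "p \<in> carrier R" "p \<noteq> \<zero>" unfolding p_def using nzD[OF g'(6)] ij by auto
  have G: "G \<in> carrier R" "G \<noteq> \<zero>" unfolding G_def using e(1,2) subring_closed(1)[OF LP_subring[OF assms(1) nJ(3)]] by auto
  have xiG: "x i = G \<otimes> inv p" unfolding pG using inv_quot(3)[OF G xi] by simp
  have L: "LP K x (I - {j}) = laur ?R (x i)" using LP_remove[OF assms(1) nJ(2), of i] ij assms(5) by simp
  have L': "LP K x' (I - {j}) = laur ?R p" using LP_remove[OF assms(1) nJ', of i] ij assms(5) LR unfolding p_def by simp
  have LI: "LP K x I = laur (laur ?R (x i)) q" using LP_remove[OF assms(1) g(6) ij(2)] unfolding L q_def .
  have tp: "trans ?R p" using indep_trans[OF assms(1) g'(3) ij(1), of ?J] unfolding LR p_def by auto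
  have tq: "trans (laur ?R p) q"
    using indep_trans[OF assms(1) g'(3) ij(2), of "I - {j}"] unfolding L' q_def using eqx assms(5) by auto
  define M where "M = mon x ?J"
  have M: "M e \<in> ?R" "M e \<in> carrier R" "M e \<otimes> M (\<lambda>k. - e k) = \<one>" for e
    unfolding M_def using mon_LP[OF assms(1) nJ(1) J(1)] mon_closed[OF nJ(1)] mon_inverse[OF nJ(1)] by auto
  have Mc: "M e = M e'" if "\<And>k. k \<in> ?J \<Longrightarrow> e k = e' k" for e e'
    unfolding M_def by (rule mon_cong[OF nJ(1)]) (use that in auto)
  have Mp: "M e [^] (n::nat) = M (\<lambda>k. int n * e k)" for e n unfolding M_def using mon_pow[OF nJ(1)] .
  have Ma: "M e \<otimes> M e' = M (\<lambda>k. e k + e' k)" for e e' unfolding M_def using mon_add[OF nJ(1)] by simp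
  have fl': "fl x' I b' j = \<one> \<oplus> ipow p (b' i j) \<otimes> M (\<lambda>k. b' k j)"
  proof -
    have "mon x' (I - {j}) (\<lambda>k. b' k j) = ipow p (b' i j) \<otimes> mon x' ?J (\<lambda>k. b' k j)"
      using mon_remove[of "I - {j}" i x' "\<lambda>k. b' k j"] nJ' g(1) ij assms(5) unfolding p_def by auto
    also have "mon x' ?J (\<lambda>k. b' k j) = M (\<lambda>k. b' k j)"
      unfolding M_def by (rule mon_cong) (use nz_mono[OF nJ', of ?J] eqx in auto)
    finally show ?thesis unfolding fl_def by simp
  qed
  have fl: "fl x I b j = \<one> \<oplus> ipow (x i) (b i j) \<otimes> M (\<lambda>k. b k j)"
    using mon_remove[of "I - {j}" i x "\<lambda>k. b k j"] nJ g(1) ij assms(5) unfolding M_def fl_def by auto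
  have b'i: "b' i j = - b i j" unfolding b'_def mutate_mat_eq by simp
  have b'k: "b' k j = b k j + max 0 (b k i) * b i j + b k i * max 0 (- b i j)" if "k \<in> ?J" for k
    using that assms(5) unfolding b'_def mutate_mat_eq by auto
  have diag: "b i i = 0" "b j j = 0" using skew_sign(1)[OF g(4)] assms(3,4) by auto
  have Gdrop: "mon x I f = mon x (I - {i}) f" if "f i = 0" for f
    using mon_drop[OF g(1,6), of f i] that by simp
  have Jeq: "I - {i} - {j} = ?J" by auto
  have Gsplit: "mon x I f = ipow q (f j) \<otimes> M f" if "f i = 0" for f
    unfolding Gdrop[of f, OF that]
    using mon_remove[of "I - {i}" j x f] nJ(3) g(1) ij assms(5) unfolding Jeq M_def q_def by auto
  have zsrc: "z \<in> exring (laur ?R p) q (fl x' I b' j)"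
    using z(1) unfolding x'_def[symmetric] b'_def[symmetric] L' q_def .
  have zlaur: "z \<in> laur (laur ?R (x i)) q" using z(2) LI by simp
  note LS = laur_subring[OF RS p(1)] note LiS = laur_subring[OF RS xi(1)]
  have RL: "?R \<subseteq> laur ?R p" "?R \<subseteq> laur ?R (x i)" using laur_mem(3)[OF RS p] laur_mem(3)[OF RS xi] by auto
  show ?thesis
  proof (cases "b i j = 0")
    case True
    have ji: "b j i = 0" using skew_sign(3)[OF g(4) assms(3,4)] True by simp
    define f where "f = \<one> \<oplus> M (\<lambda>k. b k j)"
    have "fl x' I b' j = \<one> \<oplus> M (\<lambda>k. b' k j)" unfolding fl' b'i True using M(2) ipow_zero by simp
    also have "M (\<lambda>k. b' k j) = M (\<lambda>k. b k j)" by (rule Mc) (use b'k True in simp)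
    finally have f': "fl x' I b' j = f" unfolding f_def .
    have ff: "fl x I b j = f" unfolding fl True f_def using M(2) ipow_zero by simp
    have fR: "f \<in> ?R" unfolding f_def using Rc(5)[OF Rc(3) M(1)] .
    have f0: "f \<noteq> \<zero>" using fl_nonzero[OF assms(1,2,4)] ff by simp
    have Gf: "G = M (\<lambda>k. max 0 (- b k i)) \<otimes> (\<one> \<oplus> M (\<lambda>k. b k i))"
    proof -
      have "G = M (\<lambda>k. max 0 (b k i)) \<oplus> M (\<lambda>k. max 0 (- b k i))"
        unfolding G_def exch_def using Gsplit[of "\<lambda>k. max 0 (b k i)"] Gsplit[of "\<lambda>k. max 0 (- b k i)"] diag ji M(2) ipow_zero
        by simp
      also have "M (\<lambda>k. max 0 (b k i)) = M (\<lambda>k. max 0 (- b k i)) \<otimes> M (\<lambda>k. b k i)"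
        unfolding Ma by (rule Mc) auto
      finally show ?thesis using M(2) by (simp add: r_distr a_comm)
    qed
    have GR: "G \<in> ?R" unfolding Gf using Rc(4)[OF M(1) Rc(5)[OF Rc(3) M(1)]] .
    have cop: "dv ?R f a" if a: "a \<in> ?R" "dv ?R f (G \<otimes> a)" for a
    proof -
      obtain k l where kl: "k \<in> I" "b k j \<noteq> 0" "l \<in> I" "b k j * b l i \<noteq> b k i * b l j"
        using cols_indep_two[OF g(5) assms(3,4)] assms(5) finite_subset[OF g(2,1)] by metis
      \<comment> \<open>Rows \<open>i\<close> and \<open>j\<close> vanish in both columns, so the
        nonzero minor lies in the rows of \<open>?J\<close>.\<close>
      have kl': "k \<in> ?J" "l \<in> ?J" using kl True ji diag by auto
      have ac: "a \<in> carrier R" using a Rc(1) by blast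
      have "G \<otimes> a = M (\<lambda>k. max 0 (- b k i)) \<otimes> ((\<one> \<oplus> M (\<lambda>k. b k i)) \<otimes> a)"
        unfolding Gf using M(2) ac by (simp add: m_assoc)
      then have "dv ?R f ((\<one> \<oplus> M (\<lambda>k. b k i)) \<otimes> a)"
        using unit_cancel_dv[OF RS M(1) dvI[OF M(1) M(3)[symmetric]] fR, of "(\<one> \<oplus> M (\<lambda>k. b k i)) \<otimes> a"] a(2) M(2) ac
        by simp
      then show ?thesis
        using binomials_coprime[OF assms(1) g(3) J(1,2) kl', of "\<lambda>k. b k j" "\<lambda>k. b k i" a] kl a(1)
        unfolding f_def M_def by blast
    qed
    have "z \<in> exring (laur ?R (G \<otimes> inv p)) q f"
      by (rule exring_mutate_zero[OF RS tp tq fR f0 GR G(2)])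
        (use cop zsrc[unfolded f'] zlaur[unfolded xiG] in blast)+
    then show ?thesis unfolding ff L q_def[symmetric] xiG[symmetric] .
  next
    case False
    define B where "B = nat \<bar>b i j\<bar>"
    \<comment> \<open>The sign selects the monomial of \<open>G\<close> without \<open>x j\<close>,
      which becomes \<open>a\<close>; the other one is divisible by \<open>x j\<close>.\<close>
    define s where "s = (if b i j > 0 then 1 else - 1 :: int)"
    have sB: "b i j = s * int B" "s = 1 \<or> s = - 1" unfolding s_def B_def using False by auto
    define a where "a = M (\<lambda>k. max 0 (s * b k i))"
    define a' where "a' = M (\<lambda>k. - max 0 (s * b k i))"
    define C where "C = M (\<lambda>k. max 0 (- (s * b k i)))"
    define m where "m = M (\<lambda>k. - (s * b' k j))"
    have aR: "a \<in> ?R" "a' \<in> ?R" "a \<otimes> a' = \<one>" "C \<in> ?R" "m \<in> ?R" unfolding a_def a'_def C_def m_def using M by auto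
    have c: "a \<in> carrier R" "a' \<in> carrier R" "C \<in> carrier R" "m \<in> carrier R" using aR Rc(1) by auto
    have sji: "s * b j i < 0"
      using skew_sign(2)[OF g(4) assms(3,4)] skew_sign(2)[OF g(4) assms(4,3)] False
        skew_sign(3)[OF g(4) assms(3,4)] unfolding s_def by auto
    then have "- (s * b j i) > 0" by simp
    then obtain n where n: "- (s * b j i) = int (Suc n)" by (metis Suc_pred nat_0_le less_imp_le zero_less_nat_eq)
    have Gs: "G = mon x I (\<lambda>k. max 0 (s * b k i)) \<oplus> mon x I (\<lambda>k. max 0 (- (s * b k i)))"
      using sB(2) mon_closed[OF g(6)] unfolding G_def exch_def by (auto simp: a_comm)
    have Ga: "G = a \<oplus> q [^] Suc n \<otimes> C"
    proof -
      have "mon x I (\<lambda>k. max 0 (s * b k i)) = a"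
        using Gsplit[of "\<lambda>k. max 0 (s * b k i)"] diag sji M(2) ipow_zero unfolding a_def by (simp add: max_def)
      moreover have "mon x I (\<lambda>k. max 0 (- (s * b k i))) = q [^] Suc n \<otimes> C"
      proof -
        have "max 0 (- (s * b j i)) = int (Suc n)" using n by simp
        then show ?thesis
          using Gsplit[of "\<lambda>k. max 0 (- (s * b k i))"] diag ipow_nat[OF q, of "Suc n"] unfolding C_def by simp
      qed
      ultimately show ?thesis unfolding Gs by simp
    qed
    define e where "e = q [^] n \<otimes> (C \<otimes> inv p)"
    note AqS = adj_subring[OF LS q(1)]
    have CL: "C \<otimes> inv p \<in> laur ?R p" using subring_closed(4)[OF LS] RL(1) aR(4) laur_mem(2)[OF RS p] by blast
    have eA: "e \<in> adj (laur ?R p) q" unfolding e_def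
      using subring_closed(4)[OF AqS subring_closed(8)[OF AqS adj_mem[OF LS q(1)]] adj_incl[OF LS q(1) CL]] .
    have xe: "x i = a \<otimes> inv p \<oplus> q \<otimes> e"
      unfolding xiG Ga e_def nat_pow_Suc
      using c(1,3) q(1) inv_nonzero(1)[OF p] nat_pow_closed[OF q(1), of n] by algebra
    have pB: "p [^] B \<in> carrier R" "x i [^] B \<in> carrier R" using p xi by auto
    note ip = ipow_closed(1)[OF p] ipow_closed(1)[OF xi]
    have unitp: "ipow p (- int B) \<otimes> p [^] B = \<one>" "ipow (x i) (- int B) \<otimes> x i [^] B = \<one>"
      using ipow_uminus[OF p, of "int B"] ipow_uminus[OF xi, of "int B"] unfolding ipow_nat[OF p] ipow_nat[OF xi] by auto
    have ipL: "ipow p k \<in> laur ?R p" "ipow (x i) k \<in> laur ?R (x i)" for k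
      using ipow_mem[OF LS laur_mem(1,2)[OF RS p] p(2)] ipow_mem[OF LiS laur_mem(1,2)[OF RS xi] xi(2)] by auto
    have pL: "p [^] B \<in> laur ?R p" "x i [^] B \<in> laur ?R (x i)"
      using subring_closed(8)[OF LS laur_mem(1)[OF RS p]] subring_closed(8)[OF LiS laur_mem(1)[OF RS xi]] by auto
    have MR: "M f \<in> laur ?R p" "M f \<in> laur ?R (x i)" for f using M(1) RL by auto
    \<comment> \<open>Depending on \<open>s\<close>, the polynomial of the mutated seed equals
      \<open>1 + m p^B\<close> or is a unit times it.\<close>
    have src: "exring (laur ?R p) q (fl x' I b' j) = exring (laur ?R p) q (\<one> \<oplus> m \<otimes> p [^] B)"
    proof (cases "s = 1")
      case True
      define y where "y = ipow p (- int B) \<otimes> M (\<lambda>k. b' k j)"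
      have y: "y \<in> carrier R" "y \<in> laur ?R p" unfolding y_def using ip M(2) subring_closed(4)[OF LS ipL(1) MR(1)] by auto
      have mp: "m \<otimes> p [^] B \<in> carrier R" "m \<otimes> p [^] B \<in> laur ?R p"
        using c pB subring_closed(4)[OF LS _ pL(1)] RL aR by auto
      have "y \<otimes> (m \<otimes> p [^] B) = (ipow p (- int B) \<otimes> p [^] B) \<otimes> (M (\<lambda>k. b' k j) \<otimes> m)"
        unfolding y_def using ip(1) M(2) c pB by (simp add: m_ac)
      also have "\<dots> = \<one>" unfolding unitp m_def using M(3)[of "\<lambda>k. b' k j"] True by simp
      finally have yy: "y \<otimes> (m \<otimes> p [^] B) = \<one>" .
      have "fl x' I b' j = y \<otimes> (\<one> \<oplus> m \<otimes> p [^] B)"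
        unfolding fl' b'i sB(1) True using unit_flip[OF y(1) mp(1) yy] unfolding y_def by simp
      moreover have "\<one> \<oplus> m \<otimes> p [^] B \<in> laur ?R p" using subring_closed(3,5)[OF LS] mp(2) by blast
      ultimately show ?thesis using exring_unit[OF LS q _ y(2) mp(2) yy] by simp
    next
      case False
      then have s: "s = - 1" using sB(2) by simp
      have "fl x' I b' j = \<one> \<oplus> m \<otimes> p [^] B"
        unfolding fl' b'i sB(1) s m_def using ipow_nat[OF p, of B] M(2) pB by (simp add: m_comm)
      then show ?thesis by simp
    qed
    have "z \<in> exring (laur ?R (x i)) q (x i [^] B \<oplus> m \<otimes> a [^] B)"
      by (rule exring_mutate_nonzero[OF RS tp tq aR(1-3,5) eA xe xi(2) zsrc[unfolded src] zlaur])
    moreover have "exring (laur ?R (x i)) q (x i [^] B \<oplus> m \<otimes> a [^] B) = exring (laur ?R (x i)) q (fl x I b j)"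
    proof -
      have mx: "max 0 u * v + u * max 0 (- v) = s * (max 0 (s * u) * \<bar>v\<bar>)" if "v = s * int B" for u v
        using sB(2) that by (auto simp: max_def)
      \<comment> \<open>Here the rule of matrix mutation enters: passing from \<open>m\<close> to
        \<open>m a^B\<close> undoes it on the entries of column \<open>j\<close> in the rows of
        \<open>?J\<close>.\<close>
      have maB: "m \<otimes> a [^] B = M (\<lambda>k. - (s * b k j))"
        unfolding m_def a_def Mp Ma
      proof (rule Mc)
        fix k assume "k \<in> ?J"
        from b'k[OF this] have "b' k j = b k j + s * (max 0 (s * b k i) * int B)"
          using mx[OF sB(1), of "b k i"] sB by auto
        then show "- (s * b' k j) + int B * max 0 (s * b k i) = - (s * b k j)"
          using sB(2) by (auto simp: algebra_simps)
      qed
      define h where "h = x i [^] B \<oplus> M (\<lambda>k. - (s * b k j))"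
      have hL: "h \<in> laur ?R (x i)" unfolding h_def using subring_closed(5)[OF LiS pL(2) MR(2)] .
      show ?thesis
      proof (cases "s = 1")
        case True
        have "fl x I b j = M (\<lambda>k. b k j) \<otimes> h"
          unfolding fl sB(1) True h_def using ipow_nat[OF xi, of B] M(2) pB M(3)[of "\<lambda>k. b k j"]
          by (simp add: r_distr m_comm a_comm)
        then show ?thesis unfolding maB h_def[symmetric]
          using exring_unit[OF LiS q hL MR(2) MR(2) M(3)] by simp
      next
        case False
        then have s: "s = - 1" using sB(2) by simp
        have "fl x I b j = ipow (x i) (- int B) \<otimes> h"
          unfolding fl sB(1) s h_def using M(2) pB ip(2) unitp(2) by (simp add: r_distr)
        then show ?thesis unfolding maB h_def[symmetric]
          using exring_unit[OF LiS q hL ipL(2) pL(2) unitp(2)] by simp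
      qed
    qed
    ultimately show ?thesis unfolding L q_def by simp
  qed
qed

text \<open>In direction \<open>i\<close> both seeds have the same ring by
  \<open>exring_swap\<close>, since the sign change of column \<open>i\<close> alters the polynomial
  by a unit only. The other directions are \<open>exring_mutate_other\<close>.\<close>

lemma UB_mutate:
  assumes "subring K R" "good K x I E b" "i \<in> E"
  shows "UB K (mutx x I b i) I E (mutate_mat i b) \<subseteq> UB K x I E b"
proof
  note g = goodD[OF assms(2)] note e = exch_props[OF assms]
  let ?x = "mutx x I b i" let ?b = "mutate_mat i b" let ?C = "LP K x (I - {i})"
  fix z assume z: "z \<in> UB K ?x I E ?b"
  have i: "i \<in> I" "x i \<in> carrier R" "x i \<noteq> \<zero>" using g(2) assms(3) nzD[OF g(6)] by auto
  have n: "nz x (I - {i})" using nz_mono[OF g(6)] by auto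
  note S = LP_subring[OF assms(1) n]
  have m: "mon x (I - {i}) e \<in> ?C" for e using mon_LP[OF assms(1) n] g(1) by auto
  have Gc: "exch x I b i \<in> carrier R" using e(1) subring_closed(1)[OF S] by blast
  note p = inv_quot[OF Gc e(2) i(2,3)]
  have LC: "LP K ?x (I - {i}) = ?C" by (rule LP_cong) (simp add: mutx_def)
  have xi: "?x i = exch x I b i \<otimes> inv (x i)" by (simp add: mutx_def)
  have "fl ?x I ?b i = \<one> \<oplus> mon x (I - {i}) (\<lambda>k. - b k i)"
    unfolding fl_def by (subst mon_cong[of ?x "I - {i}" x _ "\<lambda>k. - b k i"])
      (use n in \<open>auto simp: mutx_def mutate_mat_eq nz_def\<close>)
  also have "\<dots> = mon x (I - {i}) (\<lambda>k. - b k i) \<otimes> fl x I b i"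
    unfolding binomial_flip[OF n, of "\<lambda>k. - b k i"] fl_def by simp
  finally have "exring ?C (?x i) (fl ?x I ?b i) = exring ?C (?x i) (fl x I b i)"
    using exring_unit[OF S p(1,2) fl_closed[OF assms(1) g(1,6)] m m mon_uminus[OF n]] xi by simp
  also have "\<dots> = exring ?C (?x i) (exch x I b i)"
    unfolding exch_fl[of I x b i, OF g(1,6) skew_sign(1)[OF g(4) assms(3,3)]] xi
    using exring_unit[OF S p(1,2) fl_closed[OF assms(1) g(1,6)] m m mon_inverse[OF n], symmetric]
    unfolding exch_fl[of I x b i, OF g(1,6) skew_sign(1)[OF g(4) assms(3,3)]] .
  also have "\<dots> = exring ?C (x i) (fl x I b i)"
    unfolding xi exring_swap[OF S i(2,3) e(1,2)] using e(3) .
  finally have ex: "exring ?C (?x i) (fl ?x I ?b i) = exring ?C (x i) (fl x I b i)" .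
  have "z \<in> exring (LP K ?x (I - {i})) (?x i) (fl ?x I ?b i)" using z assms(3) unfolding UB_def by blast
  then have "z \<in> exring ?C (x i) (fl x I b i)" unfolding LC ex .
  moreover from this have zI: "z \<in> LP K x I"
    using exring_laur[OF S i(2,3) fl_closed[OF assms(1) g(1,6)]] LP_remove[OF assms(1) g(6) i(1)] by auto
  moreover have "z \<in> exring (LP K x (I - {j})) (x j) (fl x I b j)" if "j \<in> E" "j \<noteq> i" for j
  proof (rule exring_mutate_other[OF assms that _ zI])
    have "?x j = x j" using that by (simp add: mutx_def)
    then show "z \<in> exring (LP K ?x (I - {j})) (x j) (fl ?x I ?b j)" using z that unfolding UB_def by auto
  qed
  ultimately show "z \<in> UB K x I E b" unfolding UB_def by blast
qed

subsection \<open>The lower bound\<close>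

lemma adj_absorb: "subring A R \<Longrightarrow> t \<in> A \<Longrightarrow> adj A t = A"
  using adj_least[of A A t] adj_incl[of A t] subring_closed(1)[of A t] by blast

text \<open>If \<open>w s\<close> and \<open>w t\<close> lie in \<open>A\<close>, so does
  \<open>w = u (w s) + v (w t)\<close>; the powers are lowered one factor at a time.\<close>

lemma comaximal_local:
  assumes "subring A R" "s \<in> A" "t \<in> A" "u \<in> A" "v \<in> A" "u \<otimes> s \<oplus> v \<otimes> t = \<one>" "z \<in> carrier R"
  shows "z \<otimes> s [^] (n::nat) \<in> A \<Longrightarrow> z \<otimes> t [^] (m::nat) \<in> A \<Longrightarrow> z \<in> A"
proof -
  note A = subring_closed[OF assms(1)]
  have c: "s \<in> carrier R" "t \<in> carrier R" "u \<in> carrier R" "v \<in> carrier R" using A(1) assms by auto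
  have one: "w \<in> A" if "w \<in> carrier R" "w \<otimes> s \<in> A" "w \<otimes> t \<in> A" for w
  proof -
    have "u \<otimes> (w \<otimes> s) \<oplus> v \<otimes> (w \<otimes> t) = (u \<otimes> s \<oplus> v \<otimes> t) \<otimes> w" using c that(1) by algebra
    then have "w = u \<otimes> (w \<otimes> s) \<oplus> v \<otimes> (w \<otimes> t)" using assms(6) that(1) by simp
    then show ?thesis using A(5)[OF A(4)[OF assms(4) that(2)] A(4)[OF assms(5) that(3)]] by simp
  qed
  have two: "w \<in> A" if "w \<in> carrier R" "w \<otimes> s \<in> A" "w \<otimes> t [^] (m::nat) \<in> A" for w m
    using that(3)
  proof (induct m)
    case (Suc m)
    have "(w \<otimes> t [^] m) \<otimes> s = (w \<otimes> s) \<otimes> t [^] m" using c that(1) by (simp add: m_ac)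
    then have 1: "(w \<otimes> t [^] m) \<otimes> s \<in> A" using A(4)[OF that(2) A(8)[OF assms(3)]] by simp
    have 2: "(w \<otimes> t [^] m) \<otimes> t \<in> A" using Suc(2) c that(1) by (simp add: m_assoc)
    show ?case using one[OF _ 1 2] c that(1) Suc(1) by simp
  qed (use that in simp)
  show "z \<otimes> s [^] n \<in> A \<Longrightarrow> z \<otimes> t [^] m \<in> A \<Longrightarrow> z \<in> A"
  proof (induct n)
    case (Suc n)
    have 1: "(z \<otimes> s [^] n) \<otimes> s \<in> A" using Suc(2) c(1) assms(7) by (simp add: m_assoc)
    have "(z \<otimes> s [^] n) \<otimes> t [^] m = (z \<otimes> t [^] m) \<otimes> s [^] n" using c assms(7) by (simp add: m_ac)
    then have 2: "(z \<otimes> s [^] n) \<otimes> t [^] m \<in> A" using A(4)[OF Suc(3) A(8)[OF assms(2)]] by simp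
    have "z \<otimes> s [^] n \<in> A" using two[OF _ 1 2] c assms(7) by simp
    then show ?case using Suc by blast
  qed (use assms(7) in simp)
qed

text \<open>As \<open>Q\<close> is a unit of \<open>S\<close>, division by \<open>P y + Q\<close>
  proceeds from the lowest coefficient up, dividing by \<open>Q\<close> only, so the coefficients
  stay in \<open>S\<close>. This supplies the hypothesis \<open>div\<close> of
  \<open>exring_restrict\<close>.\<close>

lemma laur_divide_linear:
  assumes "subring S R" "subring C R" "S \<subseteq> C" "trans C y" "P \<in> S" "Q \<in> S" "Q' \<in> S" "Q \<otimes> Q' = \<one>"
    and "g \<in> laur C y" "(P \<otimes> y \<oplus> Q) \<otimes> g \<in> laur S y"
  shows "g \<in> laur S y"
proof -
  note y = transD(1,2)[OF assms(4)]
  note AS = adj_subring[OF assms(1) y(1)] and AC = adj_subring[OF assms(2) y(1)]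
  note C = subring_closed[OF assms(2)] and S = subring_closed[OF assms(1)]
  have c: "P \<in> carrier R" "Q \<in> carrier R" "Q' \<in> carrier R" using assms(5-7) S(1) by auto
  have sub: "adj S y \<subseteq> adj C y" using adj_mono[OF assms(3)] .
  have main: "(P \<otimes> y \<oplus> Q) \<otimes> G \<in> adj S y \<Longrightarrow> G \<in> adj S y" if "G \<in> adj C y" for G
    using that
  proof (induct rule: simple_extension.induct)
    case zero
    show ?case by (rule simple_extension.zero)
  next
    case (lin q s)
    have cc: "q \<in> carrier R" "s \<in> carrier R"
      using lin(1) subring_closed(1)[OF AC] lin(3) C(1) by auto
    obtain d k where d: "d \<in> adj S y" "k \<in> S" "(P \<otimes> y \<oplus> Q) \<otimes> (q \<otimes> y \<oplus> s) = d \<otimes> y \<oplus> k"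
      using adj_cases[OF assms(1) y(1) lin(4)] by blast
    let ?w = "(P \<otimes> y \<oplus> Q) \<otimes> q \<oplus> P \<otimes> s"
    have "?w \<otimes> y \<oplus> Q \<otimes> s = (P \<otimes> y \<oplus> Q) \<otimes> (q \<otimes> y \<oplus> s)" using c(1,2) cc y(1) by algebra
    then have e: "?w \<otimes> y \<oplus> Q \<otimes> s = d \<otimes> y \<oplus> k" using d(3) by (rule trans)
    have PC: "P \<in> adj C y" "Q \<in> adj C y" "s \<in> adj C y"
      using adj_incl[OF assms(2) y(1)] assms(3,5,6) lin(3) by auto
    have fC: "P \<otimes> y \<oplus> Q \<in> adj C y"
      using subring_closed(5)[OF AC adj_lin[OF assms(2) y(1) PC(1)] PC(2)] .
    have w: "?w \<in> adj C y" using subring_closed(5)[OF AC subring_closed(4)[OF AC fC lin(1)] subring_closed(4)[OF AC PC(1,3)]] .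
    have "Q \<otimes> s \<in> C" using C(4) assms(3,6) lin(3) by blast
    note u = trans_unique[OF assms(2,4) w subsetD[OF sub d(1)] this subsetD[OF assms(3) d(2)] e]
    have "s = (Q \<otimes> Q') \<otimes> s" using assms(8) cc by simp
    also have "\<dots> = Q' \<otimes> (Q \<otimes> s)" using c cc by (simp add: m_ac)
    finally have sS: "s \<in> S" using u(2) S(4)[OF assms(7) d(2)] by simp
    have "(P \<otimes> y \<oplus> Q) \<otimes> q = d \<ominus> P \<otimes> s" unfolding u(1)[symmetric] using c cc y by algebra
    moreover have "d \<ominus> P \<otimes> s \<in> adj S y"
      using subring_closed(6)[OF AS d(1) adj_incl[OF assms(1) y(1) S(4)[OF assms(5) sS]]] .
    ultimately have "q \<in> adj S y" using lin(2) by simp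
    then show ?case using simple_extension.lin sS by blast
  qed
  obtain n :: nat where n: "g \<in> carrier R" "g \<otimes> y [^] n \<in> adj C y" using laurE[OF assms(9)] by blast
  obtain m :: nat where m: "((P \<otimes> y \<oplus> Q) \<otimes> g) \<otimes> y [^] m \<in> adj S y" using laurE[OF assms(10)] by blast
  have f: "P \<otimes> y \<oplus> Q \<in> carrier R" using c y by simp
  have 1: "g \<otimes> y [^] (n + m) \<in> adj C y" using adj_pow_raise[OF assms(2) y(1) n] by simp
  have "((P \<otimes> y \<oplus> Q) \<otimes> g) \<otimes> y [^] (n + m) \<in> adj S y"
    using adj_pow_raise[OF assms(1) y(1) _ m, of "n + m"] f n(1) by simp
  then have "(P \<otimes> y \<oplus> Q) \<otimes> (g \<otimes> y [^] (n + m)) \<in> adj S y" using f n(1) y by (simp add: m_assoc)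
  then have "g \<otimes> y [^] (n + m) \<in> adj S y" using main[OF 1] by blast
  then show ?thesis using laurI[OF n(1)] by blast
qed

lemma mon_restrict:
  assumes "finite J" "nz x J" "L \<subseteq> J" "\<And>k. k \<in> J - L \<Longrightarrow> e k = 0"
  shows "mon x J e = mon x L e"
proof -
  have "finite F \<Longrightarrow> \<lbrakk>\<forall>k\<in>F. e k = 0\<rbrakk> \<Longrightarrow> mon x J e = mon x (J - F) e" for F
  proof (induct F rule: finite_induct)
    case (insert k F)
    have "mon x ((J - F) - {k}) e = mon x (J - F) e"
      using assms(1) nz_mono[OF assms(2), of "J - F"] insert(4) by (intro mon_drop) auto
    moreover have "J - insert k F = (J - F) - {k}" by auto
    ultimately show ?case using insert by simp
  qed simp
  from this[of "J - L"] have "mon x J e = mon x (J - (J - L)) e" using assms(1,4) by blast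
  moreover have "J - (J - L) = L" using assms(3) by auto
  ultimately show ?thesis by simp
qed

lemma ipow_nonneg_mem:
  assumes "subring A R" "t \<in> A" "t \<noteq> \<zero>" "k \<ge> 0"
  shows "ipow t k \<in> A"
proof -
  have "ipow t k = t [^] nat k" using ipow_nat[of t "nat k"] assms subring_closed(1)[OF assms(1)] by simp
  then show ?thesis using subring_closed(8)[OF assms(1,2)] by simp
qed

text \<open>A partially localized lower bound: variables in \<open>J\<close> are invertible, and
  each direction in \<open>S\<close> contributes both variables of its exchange relation. Moving an
  index from \<open>S\<close> to \<open>J\<close> stays within the localization at its variable
  (\<open>LB_localize\<close>).\<close>

definition LB :: "'a set \<Rightarrow> (nat \<Rightarrow> 'a) \<Rightarrow> nat set \<Rightarrow> (nat \<Rightarrow> nat \<Rightarrow> int) \<Rightarrow> nat set \<Rightarrow> nat set \<Rightarrow> 'a set" where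
  "LB K x I b J S = generate_ring R (LP K x J \<union> x ` S \<union> (\<lambda>i. exch x I b i \<otimes> inv (x i)) ` S)"

lemma exch_closed: "nz x I \<Longrightarrow> exch x I b i \<in> carrier R"
  unfolding exch_def using mon_closed(1) by auto

lemma LB_mem:
  shows "LP K x J \<subseteq> LB K x I b J S"
    and "i \<in> S \<Longrightarrow> x i \<in> LB K x I b J S"
    and "i \<in> S \<Longrightarrow> exch x I b i \<otimes> inv (x i) \<in> LB K x I b J S"
  unfolding LB_def by (auto intro: generate_ring.incl)

context
  fixes K :: "'a set" and x :: "nat \<Rightarrow> 'a" and I :: "nat set"
  assumes K: "subring K R" and nz: "nz x I"
begin

lemma LB_incl:
  assumes "J \<subseteq> I" "S \<subseteq> I"
  shows "LP K x J \<union> x ` S \<union> (\<lambda>i. exch x I b i \<otimes> inv (x i)) ` S \<subseteq> carrier R"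
proof -
  have "x i \<in> carrier R" "exch x I b i \<otimes> inv (x i) \<in> carrier R" if "i \<in> S" for i
    using exch_closed[OF nz] nzD[OF nz] inv_nonzero(1)[of "x i"] that assms(2) by auto
  then show ?thesis using subring_closed(1)[OF LP_subring[OF K nz_mono[OF nz assms(1)]]] by blast
qed

lemma LB_subring: "J \<subseteq> I \<Longrightarrow> S \<subseteq> I \<Longrightarrow> subring (LB K x I b J S) R"
  unfolding LB_def using generate_ring_is_subring[OF LB_incl] by blast

lemma LB_least:
  assumes "J \<subseteq> I" "S \<subseteq> I" "subring B R" "LP K x J \<subseteq> B" "\<And>i. i \<in> S \<Longrightarrow> x i \<in> B"
    "\<And>i. i \<in> S \<Longrightarrow> exch x I b i \<otimes> inv (x i) \<in> B"
  shows "LB K x I b J S \<subseteq> B"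
  unfolding LB_def using generate_ring_min_subring1[OF LB_incl[OF assms(1,2)] assms(3)] assms(4-) by blast

lemma LB_localize:
  assumes "S \<subseteq> I" "i \<in> S"
  shows "LB K x I b (I - (S - {i})) (S - {i}) \<subseteq> laur (LB K x I b (I - S) S) (x i)"
proof -
  let ?A = "LB K x I b (I - S) S"
  have iI: "i \<in> I" using assms by auto
  note xi = nzD[OF nz iI]
  note AS = LB_subring[of "I - S" S b, OF _ assms(1)]
  have AS: "subring ?A R" using LB_subring assms(1) by auto
  note LS = laur_subring[OF AS xi(1)] and m = laur_mem[OF AS xi]
  have eq: "I - (S - {i}) = insert i (I - S)" using assms by auto
  have n: "nz x (I - (S - {i}))" using nz_mono[OF nz] by auto
  show ?thesis
  proof (rule LB_least[OF _ _ LS])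
    show "LP K x (I - (S - {i})) \<subseteq> laur ?A (x i)"
      unfolding eq LP_insert[OF K n[unfolded eq]]
      by (rule laur_mono[OF LB_mem(1)])
  qed (use m(3) LB_mem(2,3)[where b=b and J="I - S" and S=S] assms(1) in auto)
qed

end

text \<open>By \<open>source\<close>, the first monomial \<open>P\<close> of the exchange polynomial
  of \<open>i\<close> contains only invertible variables, so it is a unit, while the second contains
  \<open>x j\<close>. The exchange relation thus expresses 1 by \<open>x i\<close> and
  \<open>x j\<close>.\<close>

lemma LB_mutual:
  assumes K: "subring K R" and nz: "nz x I" and I: "finite I"
    and S: "S \<subseteq> I" "i \<in> S" "j \<in> S" "i \<noteq> j"
    and source: "\<And>k. k \<in> S \<Longrightarrow> b k i \<le> 0" and adj: "b j i < 0"
    and z: "z \<in> LB K x I b (I - (S - {i})) (S - {i})" "z \<in> LB K x I b (I - (S - {j})) (S - {j})"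
  shows "z \<in> LB K x I b (I - S) S"
proof -
  let ?A = "LB K x I b (I - S) S"
  have AS: "subring ?A R" using LB_subring[OF K nz] S by auto
  note A = subring_closed[OF AS]
  have nS: "nz x (I - S)" "nz x S" using nz_mono[OF nz] S by auto
  have ij: "i \<in> I" "j \<in> I" using S by auto
  note xi = nzD[OF nz ij(1)] and xj = nzD[OF nz ij(2)]
  have xA: "x k \<in> ?A" if "k \<in> I" for k
    using LP_mem(2)[OF K nS(1), of k] LB_mem(1)[of K x "I - S" I b S] LB_mem(2)[of k S x K I b "I - S"] that
    by (cases "k \<in> S") auto
  define P where "P = mon x (I - S) (\<lambda>k. max 0 (b k i))"
  define P' where "P' = mon x (I - S) (\<lambda>k. - max 0 (b k i))"
  have PA: "P \<in> ?A" "P' \<in> ?A" "P \<otimes> P' = \<one>"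
    unfolding P_def P'_def using mon_LP[OF K nS(1)] I LB_mem(1)[of K x "I - S" I b S] mon_inverse[OF nS(1)] by auto
  have P: "mon x I (\<lambda>k. max 0 (b k i)) = P" unfolding P_def
    by (rule mon_restrict[OF I nz]) (auto intro!: max.absorb1 source)
  have "- b j i > 0" using adj by simp
  then obtain n where n: "- b j i = int (Suc n)" by (metis Suc_pred nat_0_le less_imp_le zero_less_nat_eq)
  define Q where "Q = x j [^] n \<otimes> mon x (I - {j}) (\<lambda>k. max 0 (- b k i))"
  have nj: "nz x (I - {j})" using nz_mono[OF nz] by auto
  have QA: "Q \<in> ?A" unfolding Q_def
  proof (rule A(4)[OF A(8)[OF xA[OF ij(2)]] mon_mem_factors[OF AS nj]])
    show "ipow (x k) (max 0 (- b k i)) \<in> ?A" if "k \<in> I - {j}" for k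
      using ipow_nonneg_mem[OF AS xA[of k] nzD(2)[OF nz, of k], of "max 0 (- b k i)"] that by auto
  qed (use I in simp)
  have Q: "mon x I (\<lambda>k. max 0 (- b k i)) = x j \<otimes> Q"
  proof -
    have "max 0 (- b j i) = int (Suc n)" using n by simp
    then have "mon x I (\<lambda>k. max 0 (- b k i)) = x j [^] Suc n \<otimes> mon x (I - {j}) (\<lambda>k. max 0 (- b k i))"
      using mon_remove[OF I ij(2) nz, of "\<lambda>k. max 0 (- b k i)"] ipow_nat[OF xj, of "Suc n"] by simp
    then show ?thesis unfolding Q_def using xj mon_closed(1)[OF nj] by (simp add: m_ac)
  qed
  define y where "y = exch x I b i \<otimes> inv (x i)"
  have yA: "y \<in> ?A" unfolding y_def using LB_mem(3)[OF S(2)] .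
  have c: "P \<in> carrier R" "P' \<in> carrier R" "Q \<in> carrier R" "y \<in> carrier R" using PA QA yA A(1) by auto
  have yx: "y \<otimes> x i = P \<oplus> x j \<otimes> Q"
    unfolding y_def using exch_closed[OF nz, of b i] inv_nonzero[OF xi] xi
    by (simp add: m_assoc) (simp add: exch_def P Q)
  have "(P' \<otimes> y) \<otimes> x i \<oplus> (\<ominus> (P' \<otimes> Q)) \<otimes> x j = P' \<otimes> (y \<otimes> x i) \<ominus> P' \<otimes> Q \<otimes> x j"
    using c xi xj by algebra
  also have "\<dots> = P \<otimes> P'" unfolding yx using c xi xj by algebra
  finally have one: "(P' \<otimes> y) \<otimes> x i \<oplus> (\<ominus> (P' \<otimes> Q)) \<otimes> x j = \<one>" using PA(3) by simp
  have zl: "z \<in> laur ?A (x i)" "z \<in> laur ?A (x j)"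
    using LB_localize[OF K nz S(1,2), of b] LB_localize[OF K nz S(1,3), of b] z by auto
  obtain n :: nat where n: "z \<in> carrier R" "z \<otimes> x i [^] n \<in> adj ?A (x i)" using laurE[OF zl(1)] by blast
  obtain m :: nat where m: "z \<otimes> x j [^] m \<in> adj ?A (x j)" using laurE[OF zl(2)] by blast
  show ?thesis
    using comaximal_local[OF AS xA[OF ij(1)] xA[OF ij(2)] A(4)[OF PA(2) yA] A(7)[OF A(4)[OF PA(2) QA]] one n(1)]
      n(2) m adj_absorb[OF AS xA[OF ij(1)]] adj_absorb[OF AS xA[OF ij(2)]] by simp
qed

text \<open>As \<open>x\<^sub>m\<close> occurs in the exchange polynomial of \<open>i\<close> linearly and in no other one, that
  polynomial is a unit times a monic linear polynomial in \<open>x\<^sub>m\<close>.\<close>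

lemma LB_isolated:
  assumes K: "subring K R" and g: "good K x I E b" and S: "S \<subseteq> E" "i \<in> S"
    and iso: "\<And>k. k \<in> S \<Longrightarrow> b k i = 0" "\<And>k. k \<in> S \<Longrightarrow> b i k = 0"
    and m: "m \<in> I - E" "b m i = 1" "\<And>l. l \<in> E \<Longrightarrow> l \<noteq> i \<Longrightarrow> b m l = 0"
    and z: "z \<in> exring (LP K x (I - {i})) (x i) (fl x I b i)" "z \<in> LB K x I b (I - (S - {i})) (S - {i})"
  shows "z \<in> LB K x I b (I - S) S"
proof -
  note gd = goodD[OF g]
  have I: "finite I" "S \<subseteq> I" "i \<in> I" "i \<in> E" "m \<in> I" "m \<noteq> i" "m \<notin> S" using gd(1,2) S m by auto
  note nz = gd(6)
  have nzs: "nz x J" if "J \<subseteq> I" for J using nz_mono[OF nz that] .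
  note xi = nzD[OF nz I(3)] and xm = nzD[OF nz I(5)]
  note e = exch_props[OF K g I(4)]
  let ?C = "LP K x (I - {i})" let ?Cm = "LP K x (I - {i} - {m})"
  let ?T = "LB K x I b (I - S - {m}) (S - {i})" let ?Ty = "laur ?T (x m)"
  let ?A = "LB K x I b (I - S) S"
  have n0: "nz x (I - {i} - {m})" "nz x (I - S - {m})" "nz x (I - S)" "nz x (I - {i})" by (rule nzs, blast)+
  have C0S: "subring ?Cm R" using LP_subring[OF K n0(1)] .
  have S0S: "subring ?T R" by (rule LB_subring[OF K nz]) (use I in auto)
  have AS: "subring ?A R" by (rule LB_subring[OF K nz]) (use I in auto)
  have CS: "subring ?C R" using LP_subring[OF K n0(4)] .
  have C: "?C = laur ?Cm (x m)" using LP_remove[OF K n0(4)] I by auto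
  have tm: "trans ?Cm (x m)" by (rule indep_trans[OF K gd(3) I(5)]) blast
  have ti: "trans ?C (x i)" by (rule indep_trans[OF K gd(3) I(3)]) blast
  \<comment> \<open>\<open>?T\<close> holds coefficients free of \<open>x i\<close> and
    \<open>x m\<close>: neither variable occurs in the exchange polynomials of the other directions
    in \<open>S\<close>.\<close>
  have S0C0: "?T \<subseteq> ?Cm"
  proof (rule LB_least[OF K nz _ _ C0S])
    show "LP K x (I - S - {m}) \<subseteq> ?Cm" by (rule LP_mono[OF K n0(1)]) (use S in auto)
    fix l assume l: "l \<in> S - {i}"
    then show "x l \<in> ?Cm" using LP_mem(2)[OF K n0(1)] I by auto
    have lE: "l \<in> E" "l \<noteq> i" "l \<in> I" using l S I by auto
    have drop: "mon x I f \<in> ?Cm" if "f i = 0" "f m = 0" for f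
    proof -
      have "mon x I f = mon x (I - {i} - {m}) f"
        by (rule mon_restrict[OF I(1) nz]) (use that in auto)
      then show ?thesis using mon_LP[OF K n0(1)] I(1) by simp
    qed
    have "exch x I b l \<in> ?Cm" unfolding exch_def
      using subring_closed(5)[OF C0S drop drop] iso(2)[of l] m(3)[OF lE(1,2)] l by auto
    moreover have "inv (x l) \<in> ?Cm" using LP_mem(3)[OF K n0(1), of l] l I by auto
    ultimately show "exch x I b l \<otimes> inv (x l) \<in> ?Cm" using subring_closed(4)[OF C0S] by blast
  qed (use I in auto)
  have S1C: "?Ty \<subseteq> ?C" unfolding C using laur_mono[OF S0C0] .
  have S1S: "subring ?Ty R" using laur_subring[OF S0S xm(1)] .
  define P where "P = mon x (I - S - {m}) (\<lambda>k. max 0 (b k i))"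
  define Q where "Q = mon x (I - S - {m}) (\<lambda>k. max 0 (- b k i))"
  define Q' where "Q' = mon x (I - S - {m}) (\<lambda>k. - max 0 (- b k i))"
  have PQ: "P \<in> ?T" "Q \<in> ?T" "Q' \<in> ?T" "Q \<otimes> Q' = \<one>"
    unfolding P_def Q_def Q'_def using mon_LP[OF K n0(2)] I(1)
      LB_mem(1)[of K x "I - S - {m}" I b "S - {i}"] mon_inverse[OF n0(2)] by auto
  have G: "exch x I b i = P \<otimes> x m \<oplus> Q"
  proof -
    have mI: "m \<in> I - S" using I by auto
    have "mon x I (\<lambda>k. max 0 (b k i)) = mon x (I - S) (\<lambda>k. max 0 (b k i))"
      by (rule mon_restrict[OF I(1) nz]) (use iso(1) in auto)
    also have "\<dots> = x m \<otimes> P" unfolding P_def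
      using mon_remove[OF _ mI n0(3), of "\<lambda>k. max 0 (b k i)"] I(1) m(2) ipow_nat[OF xm, of 1] xm by simp
    finally have 1: "mon x I (\<lambda>k. max 0 (b k i)) = x m \<otimes> P" .
    have 2: "mon x I (\<lambda>k. max 0 (- b k i)) = Q" unfolding Q_def
      by (rule mon_restrict[OF I(1) nz]) (use iso(1) m(2) in auto)
    have "P \<in> carrier R" using PQ(1) subring_closed(1)[OF S0S] by blast
    then show ?thesis unfolding exch_def 1 2 using xm by (simp add: m_comm)
  qed
  have m1: "x m \<in> ?Ty" "inv (x m) \<in> ?Ty" "?T \<subseteq> ?Ty" using laur_mem[OF S0S xm] by auto
  have GS1: "exch x I b i \<in> ?Ty" unfolding G
    using subring_closed(5)[OF S1S subring_closed(4)[OF S1S subsetD[OF m1(3) PQ(1)] m1(1)] subsetD[OF m1(3) PQ(2)]] .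
  have Gc: "exch x I b i \<in> carrier R" using exch_closed[OF nz] .
  \<comment> \<open>Factors of the exchange polynomial are divided out one at a time; as a linear
    polynomial in \<open>x m\<close> its constant term \<open>Q\<close> is a unit of
    \<open>?T\<close>.\<close>
  have div: "h \<in> ?Ty" if "h \<in> ?C" "exch x I b i [^] (n::nat) \<otimes> h \<in> ?Ty" for h n
    using that(2)
  proof (induct n)
    case 0
    then show ?case using subring_closed(1)[OF CS \<open>h \<in> ?C\<close>] by simp
  next
    case (Suc n)
    have hc: "h \<in> carrier R" using subring_closed(1)[OF CS \<open>h \<in> ?C\<close>] .
    have nC: "exch x I b i [^] n \<otimes> h \<in> laur ?Cm (x m)"
      using subring_closed(4)[OF CS subring_closed(8)[OF CS e(1)] \<open>h \<in> ?C\<close>] unfolding C .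
    have "(P \<otimes> x m \<oplus> Q) \<otimes> (exch x I b i [^] n \<otimes> h) = exch x I b i [^] Suc n \<otimes> h"
      unfolding G[symmetric] using Gc hc by (simp add: m_ac)
    then have "exch x I b i [^] n \<otimes> h \<in> ?Ty"
      using laur_divide_linear[OF S0S C0S S0C0 tm PQ nC] Suc(2) by simp
    then show ?case by (rule Suc(1))
  qed
  have "z \<in> laur ?Ty (x i)"
  proof -
    note LS = laur_subring[OF S1S xi(1)] and ml = laur_mem[OF S1S xi]
    have "LB K x I b (I - (S - {i})) (S - {i}) \<subseteq> laur ?Ty (x i)"
    proof (rule LB_least[OF K nz _ _ LS])
      have eq: "I - (S - {i}) = insert i (insert m (I - S - {m}))" using I S by auto
      have nn: "nz x (insert i (insert m (I - S - {m})))" "nz x (insert m (I - S - {m}))" using nzs I by auto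
      show "LP K x (I - (S - {i})) \<subseteq> laur ?Ty (x i)"
        unfolding eq LP_insert[OF K nn(1)] LP_insert[OF K nn(2)]
        by (rule laur_mono[OF laur_mono[OF LB_mem(1)]])
      fix l assume l: "l \<in> S - {i}"
      have sub: "?T \<subseteq> laur ?Ty (x i)" using m1(3) ml(3) by blast
      show "x l \<in> laur ?Ty (x i)" using subsetD[OF sub LB_mem(2)[OF l]] .
      show "exch x I b l \<otimes> inv (x l) \<in> laur ?Ty (x i)" using subsetD[OF sub LB_mem(3)[OF l]] .
    qed (use I in auto)
    then show ?thesis using z(2) by blast
  qed
  then obtain n :: nat where n: "z \<in> carrier R" "z \<otimes> x i [^] n \<in> adj ?Ty (x i)" using laurE by blast
  have "z \<in> exring ?Ty (x i) (exch x I b i)"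
  proof (rule exring_restrict[OF S1S CS S1C ti GS1 _ _ n(2)])
    show "z \<in> exring ?C (x i) (exch x I b i)" using z(1) unfolding e(3) .
  qed (rule div)
  moreover have "exring ?Ty (x i) (exch x I b i) \<subseteq> ?A"
  proof (rule exring_least[OF AS _ LB_mem(2)[OF S(2)] LB_mem(3)[OF S(2)]])
    have mI: "m \<in> I - S" using I by auto
    have LA: "LP K x (I - S) \<subseteq> ?A" by (rule LB_mem(1))
    have "?T \<subseteq> ?A"
      by (rule LB_least[OF K nz _ _ AS])
        (use I LA LP_mono[OF K n0(3), of "I - S - {m}"] LB_mem(2,3)[where b=b and J="I - S" and S=S] in auto)
    then show "?Ty \<subseteq> ?A"
      by (rule laur_least[OF AS]) (use LA LP_mem(2,3)[OF K n0(3) mI] xm in auto)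
  qed
  ultimately show ?thesis by blast
qed

definition principal_part :: "nat set \<Rightarrow> nat set \<Rightarrow> (nat \<Rightarrow> nat) \<Rightarrow> (nat \<Rightarrow> nat \<Rightarrow> int) \<Rightarrow> bool" where
  "principal_part I E \<phi> b \<longleftrightarrow> (\<forall>i\<in>E. \<phi> i \<in> I - E \<and> b (\<phi> i) i = 1 \<and> (\<forall>l\<in>E. l \<noteq> i \<longrightarrow> b (\<phi> i) l = 0))"

lemma UB_subset_LB:
  assumes K: "subring K R" and g: "good K x I E b" and "principal_part I E \<phi> b"
    and ac: "acyclic {(i, j). i \<in> E \<and> j \<in> E \<and> b i j > 0}"
  shows "S \<subseteq> E \<Longrightarrow> UB K x I S b \<subseteq> LB K x I b (I - S) S"
proof (induct "card S" arbitrary: S rule: less_induct)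
  case less
  note gd = goodD[OF g]
  have fE: "finite E" using finite_subset gd(1,2) by blast
  have fS: "finite S" "S \<subseteq> I" using fE less(2) finite_subset gd(2) by auto
  show ?case
  proof (cases "S = {}")
    case True
    then show ?thesis using LB_mem(1)[of K x I I b "{}"]
      unfolding UB_def by auto
  next
    case False
    define r where "r = {(i, j). i \<in> E \<and> j \<in> E \<and> b i j > 0}"
    have "finite r" unfolding r_def by (rule finite_subset[of _ "E \<times> E"]) (use fE in auto)
    then have "wf r" using finite_acyclic_wf ac unfolding r_def by blast
    \<comment> \<open>A minimal element is a source relative to \<open>S\<close> only; edges from
      outside \<open>S\<close> do no harm, since the variables there are invertible.\<close>
    then obtain i where i: "i \<in> S" "\<And>k. (k, i) \<in> r \<Longrightarrow> k \<notin> S" using wfE_min' False by metis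
    have iE: "i \<in> E" using i less(2) by auto
    have source: "b k i \<le> 0" if "k \<in> S" for k
      using i(2)[of k] that less(2) iE unfolding r_def by fastforce
    have sub: "UB K x I S b \<subseteq> LB K x I b (I - (S - {k})) (S - {k})" if "k \<in> S" for k
    proof -
      have "card (S - {k}) < card S" using that fS by (meson card_Diff1_less)
      then have "UB K x I (S - {k}) b \<subseteq> LB K x I b (I - (S - {k})) (S - {k})" using less by auto
      moreover have "UB K x I S b \<subseteq> UB K x I (S - {k}) b" unfolding UB_def by auto
      ultimately show ?thesis by blast
    qed
    show ?thesis
    proof (cases "\<exists>j\<in>S. b j i \<noteq> 0")
      case True
      then obtain j where j: "j \<in> S" "b j i < 0" using source by force
      have ij: "i \<noteq> j" using j skew_sign(1)[OF gd(4) iE iE] by auto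
      show ?thesis
        using LB_mutual[of K x I S i j b, OF K gd(6,1) fS(2) i(1) j(1) ij source j(2)] sub[OF i(1)] sub[OF j(1)] by blast
    next
      case False
      have iso: "b k i = 0" "b i k = 0" if "k \<in> S" for k
        using False that skew_sign(3)[OF gd(4), of k i] less(2) iE by auto
      have m: "\<phi> i \<in> I - E" "b (\<phi> i) i = 1" "\<And>l. l \<in> E \<Longrightarrow> l \<noteq> i \<Longrightarrow> b (\<phi> i) l = 0"
        using assms(3) iE unfolding principal_part_def by auto
      show ?thesis
      proof
        fix z assume z: "z \<in> UB K x I S b"
        have 1: "z \<in> exring (LP K x (I - {i})) (x i) (fl x I b i)" using z i(1) unfolding UB_def by blast
        have 2: "z \<in> LB K x I b (I - (S - {i})) (S - {i})" using z sub[OF i(1)] by blast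
        show "z \<in> LB K x I b (I - S) S" using LB_isolated[OF K g less(2) i(1) iso m 1 2] .
      qed
    qed
  qed
qed

subsection \<open>Factoriality of the upper bound\<close>

lemma prd_replicate: "t \<in> carrier R \<Longrightarrow> prd (replicate n t) = t [^] n"
  by (induct n) (simp_all add: m_comm)

text \<open>Writing \<open>u = f/t\<close>, an element divisible by \<open>t\<^sup>n\<close> in \<open>A[t, f/t]\<close> becomes, after clearing
  powers of \<open>u\<close>, a polynomial in \<open>u\<close> all of whose coefficients are divisible by \<open>f\<^sup>n\<close>.\<close>

lemma exring_finite_order:
  assumes "ufd A" "trans A t" "prm A f" "a \<in> exring A t f" "a \<noteq> \<zero>"
  shows "\<exists>N. \<forall>n. dv (exring A t f) (t [^] (n::nat)) a \<longrightarrow> n \<le> N"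
proof -
  have A: "subring A R" using assms(1) unfolding ufd_def by auto
  note t = transD(1,2)[OF assms(2)] note f = prmD(1,2)[OF assms(3)]
  have fc: "f \<in> carrier R" using f subring_closed(1)[OF A] by auto
  define u where "u = f \<otimes> inv t"
  have u: "u \<in> carrier R" "u \<noteq> \<zero>" "u \<otimes> t = f" unfolding u_def using inv_quot[OF fc f(2) t] by auto
  have tu: "trans A u" unfolding u_def using trans_quot[OF A assms(2) f] .
  have D: "exring A t f = exring A u f" unfolding u_def using exring_swap[OF A t f] by simp
  have Dl: "exring A t f \<subseteq> laur A u" unfolding D using exring_laur[OF A u(1,2) f(1)] .
  note PS = adj_subring[OF A u(1)]
  obtain M :: nat where M: "a \<in> carrier R" "a \<otimes> u [^] M \<in> adj A u" using assms(4) Dl laurE by blast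
  define a1 where "a1 = a \<otimes> u [^] M"
  have a1: "a1 \<in> adj A u" "a1 \<noteq> \<zero>" "a1 \<in> carrier R"
    unfolding a1_def using M assms(5) pow_nonzero[OF u(1,2)] u(1) by (auto simp: integral_iff)
  \<comment> \<open>A nonzero coefficient \<open>c\<close> inherits divisibility by powers of
    \<open>f\<close>; the number of primes in a factorization of \<open>c\<close> bounds their
    exponents.\<close>
  obtain c where c: "c \<in> A" "c \<noteq> \<zero>" "\<forall>h\<in>A. dv (adj A u) h a1 \<longrightarrow> dv A h c"
    using adj_nonzero_coeff[OF A tu a1(1,2)] by blast
  obtain N where N: "\<And>ss. (\<forall>s\<in>set ss. prm A s) \<and> dv A (prd ss) c \<Longrightarrow> length ss \<le> N"
    using ufd_length_bound[OF assms(1) c(1,2)] by blast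
  have shift: "dv (adj A u) h (q \<otimes> u [^] k) \<Longrightarrow> dv (adj A u) h q" if "h \<in> A" "q \<in> adj A u" for h q and k :: nat
  proof (induct k)
    case 0
    then show ?case using subring_closed(1)[OF PS that(2)] by simp
  next
    case (Suc k)
    have "q \<otimes> u [^] k \<in> adj A u"
      using subring_closed(4)[OF PS that(2) subring_closed(8)[OF PS adj_mem[OF A u(1)]]] .
    moreover have "q \<otimes> u [^] Suc k = (q \<otimes> u [^] k) \<otimes> u"
      using subring_closed(1)[OF PS that(2)] u by (simp add: m_assoc)
    ultimately show ?case using Suc dv_adj_shift[OF A tu that(1)] by simp
  qed
  have "n \<le> N" if n: "dv (exring A t f) (t [^] n) a" for n
  proof -
    obtain d where d: "d \<in> exring A t f" "a = t [^] n \<otimes> d" using n unfolding dv_def by auto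
    obtain k :: nat where k: "d \<in> carrier R" "d \<otimes> u [^] k \<in> adj A u" using d(1) Dl laurE by blast
    have fn: "f [^] n = u [^] n \<otimes> t [^] n" unfolding u(3)[symmetric] using nat_pow_distrib[OF u(1) t(1)] .
    have "a1 \<otimes> u [^] (n + k) = f [^] n \<otimes> ((d \<otimes> u [^] k) \<otimes> u [^] M)"
      unfolding a1_def d(2) fn nat_pow_mult[OF u(1), symmetric] using k(1) u(1) t(1) by (simp add: m_ac)
    moreover have "(d \<otimes> u [^] k) \<otimes> u [^] M \<in> adj A u"
      using subring_closed(4)[OF PS k(2) subring_closed(8)[OF PS adj_mem[OF A u(1)]]] .
    ultimately have "dv (adj A u) (f [^] n) (a1 \<otimes> u [^] (n + k))" using dvI by blast
    then have "dv (adj A u) (f [^] n) a1" using shift[OF subring_closed(8)[OF A f(1)] a1(1)] by blast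
    then have "dv A (prd (replicate n f)) c"
      using c(3) subring_closed(8)[OF A f(1)] prd_replicate[OF fc] by auto
    then have "length (replicate n f) \<le> N" using N[of "replicate n f"] assms(3) by auto
    then show ?thesis by simp
  qed
  then show ?thesis by blast
qed

lemma fl_prime:
  assumes "subring K R" "good K x I E b" "principal_part I E \<phi> b" "j \<in> E"
  shows "prm (LP K x (I - {j})) (fl x I b j)"
proof -
  note K = assms(1) note gd = goodD[OF assms(2)]
  define m where "m = \<phi> j"
  have m: "m \<in> I - {j}" "b m j = 1" "m \<in> I" using assms(3,4) unfolding principal_part_def m_def by auto
  have n: "nz x (I - {j})" "nz x (I - {j} - {m})" by (rule nz_mono[OF gd(6)], blast)+
  note xm = nzD[OF gd(6) m(3)]
  let ?C = "LP K x (I - {j})" let ?Cm = "LP K x (I - {j} - {m})"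
  note CS = LP_subring[OF K n(1)] and C0S = LP_subring[OF K n(2)]
  have C: "?C = laur ?Cm (x m)" using LP_remove[OF K n(1) m(1)] .
  have tm: "trans ?Cm (x m)" by (rule indep_trans[OF K gd(3) m(3)]) blast
  define u where "u = mon x (I - {j} - {m}) (\<lambda>k. b k j)"
  define v where "v = mon x (I - {j} - {m}) (\<lambda>k. - b k j)"
  have uv: "u \<in> ?Cm" "v \<in> ?Cm" "u \<otimes> v = \<one>" "v \<noteq> \<zero>" unfolding u_def v_def
    using mon_LP[OF K n(2)] gd(1) mon_inverse[OF n(2)] mon_closed(2)[OF n(2)] by auto
  have c: "u \<in> carrier R" "v \<in> carrier R" using uv subring_closed(1)[OF C0S] by auto
  \<comment> \<open>The exponent at \<open>x m\<close> is 1, so up to the unit \<open>u\<close> the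
    polynomial is \<open>x m \<oplus> v\<close>, written as a difference to fit
    \<open>prm_linear\<close>.\<close>
  have f: "fl x I b j = u \<otimes> (x m \<ominus> \<ominus> v)"
  proof -
    have "mon x (I - {j}) (\<lambda>k. b k j) = x m \<otimes> u"
      unfolding u_def using mon_remove[OF _ m(1) n(1), of "\<lambda>k. b k j"] gd(1) m(2) ipow_nat[OF xm, of 1] xm by simp
    moreover have "u \<otimes> (x m \<ominus> \<ominus> v) = u \<otimes> v \<oplus> x m \<otimes> u" using c xm(1) by algebra
    ultimately show ?thesis unfolding fl_def using uv(3) by simp
  qed
  have "\<ominus> v \<noteq> \<zero>" using uv(4) c by (metis minus_minus minus_zero)
  then have "prm ?C (x m \<ominus> \<ominus> v)" unfolding C using prm_linear[OF C0S tm subring_closed(7)[OF C0S uv(2)]] by blast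
  moreover have "u \<in> ?C" "v \<in> ?C" unfolding C using laur_mem(3)[OF C0S xm] uv by auto
  ultimately show ?thesis unfolding f using prm_assoc[OF CS] dvI[OF _ uv(3)[symmetric]] by blast
qed

lemma UB_subring:
  assumes "subring K R" "good K x I E b" "S \<subseteq> E"
  shows "subring (UB K x I S b) R"
proof -
  note gd = goodD[OF assms(2)]
  let ?D = "\<lambda>j. exring (LP K x (I - {j})) (x j) (fl x I b j)"
  have "subring (?D j) R" if "j \<in> S" for j
  proof -
    have "nz x (I - {j})" "j \<in> I" using nz_mono[OF gd(6)] that assms(3) gd(2) by auto
    then show ?thesis using exring_subring[OF LP_subring[OF assms(1)] nzD[OF gd(6)] fl_closed[OF assms(1) gd(1,6)]] by blast
  qed
  then have "subring (\<Inter>(insert (LP K x I) (?D ` S))) R"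
    using LP_subring[OF assms(1) gd(6)] by (intro subring_Inter) auto
  moreover have "UB K x I S b = \<Inter>(insert (LP K x I) (?D ` S))" unfolding UB_def by auto
  ultimately show ?thesis by simp
qed

lemma UB_ufd:
  assumes "ufd K" "good K x I E b" "principal_part I E \<phi> b" "S \<subseteq> E"
  shows "ufd (UB K x I S b)"
proof -
  have K: "subring K R" using assms(1) unfolding ufd_def by auto
  note gd = goodD[OF assms(2)]
  have "finite S" using finite_subset[OF assms(4) finite_subset[OF gd(2,1)]] .
  then show ?thesis using assms(4)
  proof (induct S)
    case empty
    have "UB K x I {} b = LP K x I" unfolding UB_def by simp
    then show ?case using LP_ufd[OF assms(1) gd(3,1)] by simp
  next
    case (insert j S)
    let ?A = "UB K x I (insert j S) b" let ?B = "UB K x I S b" let ?C = "LP K x (I - {j})"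
    have SE: "S \<subseteq> E" "j \<in> E" "j \<in> I" using insert gd(2) by auto
    note AS = UB_subring[OF K assms(2) insert(4)] and BS = UB_subring[OF K assms(2) SE(1)]
    have n: "nz x (I - {k})" for k by (rule nz_mono[OF gd(6)]) blast
    note xj = nzD[OF gd(6) SE(3)]
    note CS = LP_subring[OF K n]
    let ?D = "exring ?C (x j) (fl x I b j)"
    note f = fl_closed[OF K gd(1,6)]
    have fc: "fl x I b j \<in> carrier R" using f subring_closed(1)[OF CS] by blast
    have f0: "fl x I b j \<noteq> \<zero>" using fl_nonzero[OF K assms(2) SE(2)] .
    note DS = exring_subring[OF CS xj f]
    have tj: "trans ?C (x j)" using indep_trans[OF K gd(3) SE(3)] by auto
    have fp: "prm ?C (fl x I b j)" using fl_prime[OF K assms(2,3) SE(2)] .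
    have xC: "x j \<in> LP K x (I - {k})" "inv (x j) \<in> LP K x (I - {k})" if "k \<in> S" for k
      using LP_mem(2,3)[OF K n, of j k] that insert(2) SE(3) by auto
    have CD: "LP K x (I - {k}) \<subseteq> exring (LP K x (I - {k})) (x k) (fl x I b k)" if "k \<in> E" for k
      using exring_mem(2)[OF CS nzD[OF gd(6)] f] that gd(2) by blast
    have xB: "x j \<in> ?B" "inv (x j) \<in> ?B"
      unfolding UB_def using LP_mem(2,3)[OF K gd(6) SE(3)] xC CD SE(1) by blast+
    have xA: "x j \<in> ?A" using xB(1) exring_mem(3)[OF CS xj f] unfolding UB_def by blast
    have AB: "?A \<subseteq> ?B" and AD: "?A \<subseteq> ?D" unfolding UB_def by auto
    have ABD: "z \<in> ?A" if "z \<in> ?B" "z \<in> ?D" for z using that unfolding UB_def by auto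
    \<comment> \<open>\<open>prm_exring\<close> makes \<open>f/u\<close> prime; for
      \<open>u = f/x_j\<close> this quotient is \<open>x j\<close>, and \<open>exring_swap\<close>
      identifies the rings.\<close>
    have Dp: "prm ?D (x j)"
    proof -
      have "prm (exring ?C (fl x I b j \<otimes> inv (x j)) (fl x I b j)) (fl x I b j \<otimes> inv (fl x I b j \<otimes> inv (x j)))"
        using prm_exring[OF CS trans_quot[OF CS tj f f0] fp] .
      then show ?thesis unfolding exring_swap[OF CS xj f f0] inv_quot(3)[OF fc f0 xj] .
    qed
    \<comment> \<open>\<open>x j\<close> is invertible in \<open>?B\<close>, so the quotient taken
      in \<open>?D\<close> also lies in \<open>?B\<close>, hence in the intersection
      \<open>?A\<close>.\<close>
    have dvA: "dv ?A (x j) a" if "a \<in> ?A" "dv ?D (x j) a" for a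
    proof -
      obtain d where d: "d \<in> ?D" "a = x j \<otimes> d" using \<open>dv ?D (x j) a\<close> unfolding dv_def by auto
      have dc: "d \<in> carrier R" using d subring_closed(1)[OF DS] by blast
      have "d = (x j \<otimes> d) \<otimes> inv (x j)" using dc xj inv_nonzero[OF xj] by (simp add: m_ac)
      then have "d = a \<otimes> inv (x j)" using d(2) by simp
      then have "d \<in> ?B" using subring_closed(4)[OF BS subsetD[OF AB \<open>a \<in> ?A\<close>] xB(2)] by simp
      then show ?thesis using ABD d dvI by blast
    qed
    have dvD: "dv ?A h a \<Longrightarrow> dv ?D h a" for h a using AD unfolding dv_def by blast
    have Ap: "prm ?A (x j)" unfolding prm_def
    proof (intro conjI ballI impI)
      show "x j \<in> ?A" by (rule xA)
      show "x j \<noteq> \<zero>" by (rule xj(2))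
      show "\<not> dv ?A (x j) \<one>" using prmD(3)[OF Dp] dvD by blast
      fix a c assume "a \<in> ?A" "c \<in> ?A" "dv ?A (x j) (a \<otimes> c)"
      then show "dv ?A (x j) a \<or> dv ?A (x j) c" using prmD(4)[OF Dp] dvD dvA AD by blast
    qed
    have rep: "set ss \<subseteq> {x j} \<Longrightarrow> prd ss = x j [^] length ss" for ss
    proof -
      assume "set ss \<subseteq> {x j}"
      then have "replicate (length ss) (x j) = ss" by (simp add: replicate_length_same subset_iff)
      then show ?thesis using prd_replicate[OF xj(1), of "length ss"] by simp
    qed
    show ?case
    proof (rule nagata[OF AS BS AB, of "{x j}"])
      show "prm ?A s" if "s \<in> {x j}" for s using Ap that by simp
      show "dv ?B s \<one>" if "s \<in> {x j}" for s using that xB(2) inv_nonzero(2)[OF xj] by (auto intro!: dvI)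
      show "ufd ?B" using insert(3) SE(1) by blast
      fix a
      show "\<exists>ss. set ss \<subseteq> {x j} \<and> prd ss \<otimes> a \<in> ?A" if a: "a \<in> ?B"
      proof -
        have "a \<in> laur ?C (x j)" using a LP_remove[OF K gd(6) SE(3)] unfolding UB_def by auto
        then obtain n :: nat where n: "a \<in> carrier R" "a \<otimes> x j [^] n \<in> adj ?C (x j)" using laurE by blast
        have "a \<otimes> x j [^] n \<in> ?B" using subring_closed(4)[OF BS a subring_closed(8)[OF BS xB(1)]] .
        moreover have "a \<otimes> x j [^] n \<in> ?D" using n(2) exring_mem(1)[OF CS xj f] by blast
        ultimately have "a \<otimes> x j [^] n \<in> ?A" by (rule ABD)
        moreover have "prd (replicate n (x j)) \<otimes> a = a \<otimes> x j [^] n"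
          unfolding prd_replicate[OF xj(1)] using n(1) xj by (simp add: m_comm)
        ultimately have "prd (replicate n (x j)) \<otimes> a \<in> ?A" by (simp only:)
        then show ?thesis by (intro exI[of _ "replicate n (x j)"]) auto
      qed
      show "\<exists>N::nat. \<forall>ss. set ss \<subseteq> {x j} \<and> dv ?A (prd ss) a \<longrightarrow> length ss \<le> N" if a: "a \<in> ?A" "a \<noteq> \<zero>"
      proof -
        have Cu: "ufd ?C" using LP_ufd[OF assms(1) gd(3), of "I - {j}"] gd(1) by auto
        obtain N where N: "\<And>n::nat. dv ?D (x j [^] n) a \<Longrightarrow> n \<le> N"
          using exring_finite_order[OF Cu tj fp subsetD[OF AD a(1)] a(2)] by blast
        show ?thesis using N dvD rep by (intro exI[of _ N]) metis
      qed
    qed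
  qed
qed

subsection \<open>Cluster algebras\<close>

definition pmon :: "('i \<Rightarrow> 'a) \<Rightarrow> 'i set \<Rightarrow> ('i \<Rightarrow> nat) \<Rightarrow> 'a" where
  "pmon x I \<alpha> = (\<Otimes>i\<in>I. x i [^] \<alpha> i)"

text \<open>The predicate \<open>P\<close> on exponent vectors records whether a given variable
  occurs, so that two sets of monomials can be seen to be disjoint.\<close>

inductive_set pspan :: "'a set \<Rightarrow> ('i \<Rightarrow> 'a) \<Rightarrow> 'i set \<Rightarrow> (('i \<Rightarrow> nat) \<Rightarrow> bool) \<Rightarrow> 'a set"
  for K x I P where
  zero: "\<zero> \<in> pspan K x I P"
| lin: "k \<in> K \<Longrightarrow> \<alpha> \<in> I \<rightarrow>\<^sub>E UNIV \<Longrightarrow> P \<alpha> \<Longrightarrow> z \<in> pspan K x I P \<Longrightarrow> k \<otimes> pmon x I \<alpha> \<oplus> z \<in> pspan K x I P"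

context
  fixes K :: "'a set" and x :: "'i \<Rightarrow> 'a" and I :: "'i set"
  assumes K: "subring K R" and x: "x \<in> I \<rightarrow> carrier R" and I: "finite I"
begin

lemma pmon_closed: "pmon x I \<alpha> \<in> carrier R"
  unfolding pmon_def by (rule finprod_closed) (use x in auto)

lemma pmon_mult: "pmon x I \<alpha> \<otimes> pmon x I \<beta> = pmon x I (\<lambda>i\<in>I. \<alpha> i + \<beta> i)"
proof -
  have "pmon x I (\<lambda>i\<in>I. \<alpha> i + \<beta> i) = (\<Otimes>i\<in>I. x i [^] \<alpha> i \<otimes> x i [^] \<beta> i)"
    unfolding pmon_def by (rule finprod_cong') (use x in \<open>auto simp: nat_pow_mult Pi_iff\<close>)
  also have "\<dots> = pmon x I \<alpha> \<otimes> pmon x I \<beta>"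
    unfolding pmon_def by (rule finprod_multf) (use x in auto)
  finally show ?thesis by simp
qed

lemma pmon_zero: "pmon x I (\<lambda>i\<in>I. 0) = \<one>"
  unfolding pmon_def by (rule finprod_one_eqI) simp

lemma pmon_single:
  assumes "j \<in> I"
  shows "pmon x I (\<lambda>i\<in>I. if j = i then 1 else 0) = x j"
proof -
  have "pmon x I (\<lambda>i\<in>I. if j = i then 1 else 0) = (\<Otimes>i\<in>I. if j = i then x i else \<one>)"
    unfolding pmon_def by (rule finprod_cong') (use x in \<open>auto simp: Pi_iff\<close>)
  then show ?thesis using finprod_singleton[OF assms I x] by simp
qed

lemma pspan_carrier: "z \<in> pspan K x I P \<Longrightarrow> z \<in> carrier R"
  by (induct rule: pspan.induct) (auto simp: subring_closed(1)[OF K] pmon_closed)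

lemma pspan_mon:
  assumes "k \<in> K" "\<alpha> \<in> I \<rightarrow>\<^sub>E UNIV" "P \<alpha>"
  shows "k \<otimes> pmon x I \<alpha> \<in> pspan K x I P"
  using pspan.lin[where P=P and x=x, OF assms pspan.zero] pmon_closed[of \<alpha>]
    subring_closed(1)[OF K assms(1)] by simp

lemma pspan_add: "z \<in> pspan K x I P \<Longrightarrow> w \<in> pspan K x I P \<Longrightarrow> z \<oplus> w \<in> pspan K x I P"
proof (induct rule: pspan.induct)
  case (lin k \<alpha> z)
  then have "(k \<otimes> pmon x I \<alpha> \<oplus> z) \<oplus> w = k \<otimes> pmon x I \<alpha> \<oplus> (z \<oplus> w)"
    using pmon_closed subring_closed(1)[OF K] pspan_carrier by (simp add: a_assoc)
  then show ?case using pspan.lin[where P=P, OF lin(1-3)] lin(5,6) by simp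
qed (simp add: pspan_carrier)

lemma pspan_mult:
  assumes sum: "\<And>\<alpha> \<beta>. P \<alpha> \<Longrightarrow> Q \<beta> \<Longrightarrow> T (\<lambda>i\<in>I. \<alpha> i + \<beta> i)"
    and z: "z \<in> pspan K x I P" and w: "w \<in> pspan K x I Q"
  shows "z \<otimes> w \<in> pspan K x I T"
  using z
proof (induct rule: pspan.induct)
  case zero
  then show ?case using pspan.zero pspan_carrier[OF w] by simp
next
  case (lin k \<alpha> z)
  note k = subring_closed(1)[OF K lin(1)]
  have "(k \<otimes> pmon x I \<alpha>) \<otimes> w \<in> pspan K x I T" using w
  proof (induct rule: pspan.induct)
    case zero
    then show ?case using pspan.zero k pmon_closed by simp
  next
    case (lin l \<beta> w)
    note l = subring_closed(1)[OF K lin(1)]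
    have "(k \<otimes> pmon x I \<alpha>) \<otimes> (l \<otimes> pmon x I \<beta> \<oplus> w) =
        (k \<otimes> l) \<otimes> (pmon x I \<alpha> \<otimes> pmon x I \<beta>) \<oplus> (k \<otimes> pmon x I \<alpha>) \<otimes> w"
      using k l pmon_closed pspan_carrier[OF lin(4)] by (simp add: r_distr m_ac)
    moreover have "k \<otimes> l \<in> K" using subring_closed(4)[OF K \<open>k \<in> K\<close> lin(1)] .
    ultimately show ?case
      using pspan.lin[where P=T, OF _ restrict_PiE[THEN iffD2] sum[OF \<open>P \<alpha>\<close> lin(3)] lin(5)] pmon_mult by simp
  qed
  then show ?case
    using pspan_add lin(5) k pmon_closed pspan_carrier[OF lin(4)] pspan_carrier[OF w] by (simp add: l_distr)
qed

lemma pspan_subring: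
  assumes "\<And>\<alpha> \<beta>. P \<alpha> \<Longrightarrow> P \<beta> \<Longrightarrow> P (\<lambda>i\<in>I. \<alpha> i + \<beta> i)" "P (\<lambda>i\<in>I. 0)"
  shows "subring (pspan K x I P) R" "K \<subseteq> pspan K x I P"
proof -
  have k: "k \<in> pspan K x I P" if "k \<in> K" for k
    using pspan_mon[where P=P, OF that _ assms(2)] pmon_zero subring_closed(1)[OF K that] by simp
  then show "K \<subseteq> pspan K x I P" by blast
  have m: "z \<otimes> w \<in> pspan K x I P" if "z \<in> pspan K x I P" "w \<in> pspan K x I P" for z w
    using pspan_mult[of P P P, OF assms(1) that] by blast
  show "subring (pspan K x I P) R"
  proof (rule subringI)
    show "\<one> \<in> pspan K x I P" using k subring_closed(3)[OF K] by blast
    show "\<ominus> z \<in> pspan K x I P" if "z \<in> pspan K x I P" for z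
    proof -
      have "\<ominus> z = (\<ominus> \<one>) \<otimes> z" using pspan_carrier[OF that] by (simp add: l_minus)
      then show ?thesis using m[OF k that] subring_closed(7)[OF K subring_closed(3)[OF K]] by simp
    qed
  qed (use pspan_carrier pspan_add m in auto)
qed

lemma pspan_var:
  assumes "j \<in> I" "P (\<lambda>i\<in>I. if j = i then 1 else 0)"
  shows "x j \<in> pspan K x I P"
proof -
  have "x j \<in> carrier R" using assms x by auto
  then show ?thesis
    using pspan_mon[where P=P, OF subring_closed(3)[OF K] _ assms(2)] pmon_single[OF assms(1)] by simp
qed

lemma pspan_finsum:
  "z \<in> pspan K x I P \<Longrightarrow> \<exists>S c. finite S \<and> S \<subseteq> {\<alpha> \<in> I \<rightarrow>\<^sub>E UNIV. P \<alpha>} \<and> c \<in> S \<rightarrow> K \<and>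
     z = (\<Oplus>\<alpha>\<in>S. c \<alpha> \<otimes> pmon x I \<alpha>)"
proof (induct rule: pspan.induct)
  case zero
  show ?case by (intro exI[of _ "{}"]) auto
next
  case (lin k \<alpha> z)
  then obtain S c where S: "finite S" "S \<subseteq> {\<alpha> \<in> I \<rightarrow>\<^sub>E UNIV. P \<alpha>}" "c \<in> S \<rightarrow> K"
    "z = (\<Oplus>\<alpha>\<in>S. c \<alpha> \<otimes> pmon x I \<alpha>)" by blast
  \<comment> \<open>A monomial that occurs already receives the sum of both coefficients; zero is
    the default for a new one.\<close>
  let ?d = "c(\<alpha> := k \<oplus> (if \<alpha> \<in> S then c \<alpha> else \<zero>))"
  let ?r = "\<Oplus>\<beta>\<in>S - {\<alpha>}. c \<beta> \<otimes> pmon x I \<beta>"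
  have K': "k \<in> carrier R" "\<And>\<beta>. \<beta> \<in> S \<Longrightarrow> c \<beta> \<in> carrier R" using lin(1) S(3) subring_closed(1)[OF K] by auto
  have d: "?d \<alpha> \<in> K" using lin(1) S(3) subring_closed(2,5)[OF K] by (auto simp: Pi_iff)
  have r: "?r \<in> carrier R" by (rule finsum_closed) (use K' pmon_closed in auto)
  have dk: "?d \<alpha> \<in> carrier R" using d subring_closed(1)[OF K] by blast
  have "(\<Oplus>\<beta>\<in>insert \<alpha> (S - {\<alpha>}). ?d \<beta> \<otimes> pmon x I \<beta>) = ?d \<alpha> \<otimes> pmon x I \<alpha> \<oplus> (\<Oplus>\<beta>\<in>S - {\<alpha>}. ?d \<beta> \<otimes> pmon x I \<beta>)"
    by (rule finsum_insert) (use S(1) K' dk pmon_closed in auto)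
  also have "(\<Oplus>\<beta>\<in>S - {\<alpha>}. ?d \<beta> \<otimes> pmon x I \<beta>) = ?r"
    by (rule finsum_cong') (use K' pmon_closed in auto)
  also have "?d \<alpha> \<otimes> pmon x I \<alpha> \<oplus> ?r = k \<otimes> pmon x I \<alpha> \<oplus> z"
  proof (cases "\<alpha> \<in> S")
    case True
    have "(\<Oplus>\<beta>\<in>insert \<alpha> (S - {\<alpha>}). c \<beta> \<otimes> pmon x I \<beta>) = c \<alpha> \<otimes> pmon x I \<alpha> \<oplus> ?r"
      by (rule finsum_insert) (use S(1) True K' pmon_closed in auto)
    then have "z = c \<alpha> \<otimes> pmon x I \<alpha> \<oplus> ?r" using True S(4) by (simp add: insert_absorb)
    then show ?thesis using True K' r pmon_closed by (simp add: l_distr a_assoc)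
  next
    case False
    then show ?thesis using S(4) K' by simp
  qed
  finally have e: "k \<otimes> pmon x I \<alpha> \<oplus> z = (\<Oplus>\<beta>\<in>insert \<alpha> S. ?d \<beta> \<otimes> pmon x I \<beta>)" by simp
  have "?d \<in> insert \<alpha> S \<rightarrow> K" using d S(3) by (auto simp: Pi_iff)
  then show ?case using e S(1,2) lin(2,3)
    by (intro exI[of _ "insert \<alpha> S"] exI[of _ ?d]) auto
qed

text \<open>Algebraic independence speaks of polynomials only. It gives transcendence over the
  polynomial ring in the other variables, which \<open>trans_frac\<close> extends to their Laurent
  ring, a subring of the fraction field.\<close>

lemma alg_independent_indep:
  assumes ai: "alg_independent R K I x"
  shows "indep K x I"
proof -
  have ai': "(\<Oplus>\<alpha>\<in>S. c \<alpha> \<otimes> pmon x I \<alpha>) = \<zero> \<Longrightarrow> \<alpha> \<in> S \<Longrightarrow> c \<alpha> = \<zero>"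
    if "finite S" "S \<subseteq> I \<rightarrow>\<^sub>E UNIV" "c \<in> S \<rightarrow> K" for S c \<alpha>
    using ai[unfolded alg_independent_def, rule_format, OF that] unfolding pmon_def by blast
  have nonzero: "x i \<noteq> \<zero>" if i: "i \<in> I" for i
  proof
    assume "x i = \<zero>"
    \<comment> \<open>The single monomial \<open>x i\<close> with coefficient 1 would be a
      relation.\<close>
    let ?\<alpha> = "\<lambda>j\<in>I. if i = j then 1 else 0 :: nat"
    have "(\<Oplus>\<alpha>\<in>{?\<alpha>}. \<one> \<otimes> pmon x I \<alpha>) = \<one> \<otimes> pmon x I ?\<alpha> \<oplus> (\<Oplus>\<alpha>\<in>{}. \<one> \<otimes> pmon x I \<alpha>)"
      by (rule finsum_insert) (use pmon_closed in auto)
    then have "(\<Oplus>\<alpha>\<in>{?\<alpha>}. \<one> \<otimes> pmon x I \<alpha>) = \<zero>" unfolding pmon_single[OF i] \<open>x i = \<zero>\<close> by simp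
    from ai'[of "{?\<alpha>}" "\<lambda>_. \<one>", OF _ _ _ this] have "\<one> = \<zero>" using subring_closed(3)[OF K] by auto
    then show False by simp
  qed
  have "trans (LP K x (I - {i})) (x i)" if i: "i \<in> I" for i
  proof -
    have xi: "x i \<in> carrier R" using x i by auto
    let ?G = "generate_ring R (K \<union> x ` (I - {i}))"
    have Gc: "K \<union> x ` (I - {i}) \<subseteq> carrier R" using subring_closed(1)[OF K] x by auto
    note GS = generate_ring_is_subring[OF Gc]
    note S0 = pspan_subring[of "\<lambda>\<alpha>. \<alpha> i = 0"] and SS = pspan_subring[of "\<lambda>_. True"]
    have v: "x j \<in> pspan K x I (\<lambda>\<alpha>. \<alpha> i = 0)" if "j \<in> I - {i}" for j
      by (rule pspan_var) (use i that in auto)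
    have G0: "?G \<subseteq> pspan K x I (\<lambda>\<alpha>. \<alpha> i = 0)"
      by (rule generate_ring_min_subring1[OF Gc S0(1)]) (use i S0(2) v in auto)
    have "?G \<subseteq> pspan K x I (\<lambda>_. True)"
      by (rule generate_ring_min_subring1[OF Gc SS(1)]) (use i SS(2) pspan_var in auto)
    then have G1: "adj ?G (x i) \<subseteq> pspan K x I (\<lambda>_. True)"
      using adj_least[OF SS(1)] pspan_var[OF i, of "\<lambda>_. True"] by blast
    \<comment> \<open>the monomials of \<open>p x\<^sub>i\<close> and those of \<open>r\<close> have disjoint supports\<close>
    have tG: "trans ?G (x i)" unfolding trans_def
    proof (intro conjI ballI impI)
      fix r p assume r: "r \<in> ?G" and p: "p \<in> adj ?G (x i)" and e: "p \<otimes> x i \<oplus> r = \<zero>"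
      have "p \<otimes> x i \<in> pspan K x I (\<lambda>\<alpha>. \<alpha> i \<noteq> 0)"
        by (rule pspan_mult[of "\<lambda>_. True" "\<lambda>\<alpha>. \<alpha> i \<noteq> 0"]) (use G1 p i pspan_var in auto)
      from pspan_finsum[OF this] obtain S c where S: "finite S" "S \<subseteq> {\<alpha> \<in> I \<rightarrow>\<^sub>E UNIV. \<alpha> i \<noteq> 0}" "c \<in> S \<rightarrow> K"
        "p \<otimes> x i = (\<Oplus>\<alpha>\<in>S. c \<alpha> \<otimes> pmon x I \<alpha>)" by blast
      from pspan_finsum[OF subsetD[OF G0 r]] obtain T d where
        T: "finite T" "T \<subseteq> {\<alpha> \<in> I \<rightarrow>\<^sub>E UNIV. \<alpha> i = 0}" "d \<in> T \<rightarrow> K" "r = (\<Oplus>\<alpha>\<in>T. d \<alpha> \<otimes> pmon x I \<alpha>)" by blast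
      have disj: "S \<inter> T = {}" using S(2) T(2) by blast
      define f where "f = (\<lambda>\<alpha>. if \<alpha> \<in> S then c \<alpha> else d \<alpha>)"
      have fK: "f \<in> S \<union> T \<rightarrow> K" using S(3) T(3) unfolding f_def by auto
      then have fc: "(\<lambda>\<alpha>. f \<alpha> \<otimes> pmon x I \<alpha>) \<in> S \<union> T \<rightarrow> carrier R"
        using subring_closed(1)[OF K] pmon_closed by (auto simp: Pi_iff)
      have "(\<Oplus>\<alpha>\<in>S. f \<alpha> \<otimes> pmon x I \<alpha>) = p \<otimes> x i" unfolding S(4)
        by (rule finsum_cong') (use S(3) subring_closed(1)[OF K] pmon_closed in \<open>auto simp: f_def Pi_iff\<close>)
      moreover have "(\<Oplus>\<alpha>\<in>T. f \<alpha> \<otimes> pmon x I \<alpha>) = r" unfolding T(4)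
        by (rule finsum_cong') (use T(3) disj subring_closed(1)[OF K] pmon_closed in \<open>auto simp: f_def Pi_iff\<close>)
      ultimately have "(\<Oplus>\<alpha>\<in>S \<union> T. f \<alpha> \<otimes> pmon x I \<alpha>) = \<zero>"
        using finsum_Un_disjoint[OF S(1) T(1) disj, of "\<lambda>\<alpha>. f \<alpha> \<otimes> pmon x I \<alpha>"] fc e by (simp add: Pi_iff)
      then have "f \<alpha> = \<zero>" if "\<alpha> \<in> T" for \<alpha> using ai'[of "S \<union> T" f \<alpha>] S(1,2) T(1,2) fK that by auto
      then have "d \<alpha> = \<zero>" if "\<alpha> \<in> T" for \<alpha> using that disj unfolding f_def by (metis disjoint_iff)
      then show "r = \<zero>" unfolding T(4) using pmon_closed by (intro add.finprod_one_eqI) simp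
    qed (use xi nonzero[OF i] in auto)
    note Fs = frac_subfield[OF GS] and sub = frac_subset[OF GS]
    have nz: "nz x (I - {i})" using nonzero x unfolding nz_def by auto
    have gen: "K \<subseteq> ?G" "x ` (I - {i}) \<subseteq> ?G" by (auto intro: generate_ring.incl)
    have "LP K x (I - {i}) \<subseteq> frac ?G"
    proof (rule LP_least[OF K nz subfieldE(1)[OF Fs]])
      fix j assume j: "j \<in> I - {i}"
      then show "x j \<in> frac ?G" using gen sub by blast
      then show "inv (x j) \<in> frac ?G" using subfield_m_inv(1)[OF Fs, of "x j"] nonzero j by auto
    qed (use gen sub in auto)
    then show ?thesis using trans_mono[OF trans_frac[OF GS tG]] by blast
  qed
  then show ?thesis unfolding indep_def by blast
qed

end

section \<open>Seeds and the cluster algebra\<close>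

lemma base_ring_ufd:
  assumes "base_ring R K"
  shows "ufd K"
  using assms int_image_ufd field_ufd unfolding base_ring_def by blast

lemma mon_pos:
  assumes "finite J" "nz x J"
  shows "mon x J (\<lambda>k. max 0 (e k)) = (\<Otimes>k\<in>{k \<in> J. e k > 0}. x k [^] nat (e k))"
proof -
  let ?L = "{k \<in> J. e k > 0}"
  have x: "x k \<in> carrier R" "x k \<noteq> \<zero>" if "k \<in> ?L" for k using nzD[OF assms(2)] that by auto
  have "mon x J (\<lambda>k. max 0 (e k)) = mon x ?L (\<lambda>k. max 0 (e k))"
    by (rule mon_restrict[OF assms]) auto
  also have "\<dots> = (\<Otimes>k\<in>?L. ipow (x k) (max 0 (e k)))"
    unfolding mon_def by (rule finprod_units_of[symmetric]) (use assms(1) x ipow_closed field_Units in auto)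
  also have "\<dots> = (\<Otimes>k\<in>?L. x k [^] nat (e k))"
  proof (rule finprod_cong')
    show "ipow (x k) (max 0 (e k)) = x k [^] nat (e k)" if "k \<in> ?L" for k
      using ipow_nat[OF x[OF that], of "nat (e k)"] that by simp
  qed (use x in auto)
  finally show ?thesis .
qed

lemma exchange_poly_exch:
  assumes "nz (xvar \<Sigma>) (all_idx \<Sigma>)"
  shows "exchange_poly R \<Sigma> i = exch (xvar \<Sigma>) (all_idx \<Sigma>) (bmat \<Sigma>) i"
proof -
  have "finite (all_idx \<Sigma>)" by (simp add: all_idx_def)
  note m = mon_pos[OF this assms]
  show ?thesis unfolding exchange_poly_def exch_def
    using m[of "\<lambda>k. bmat \<Sigma> k i"] m[of "\<lambda>k. - bmat \<Sigma> k i"] by simp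
qed

definition good_seed :: "'a set \<Rightarrow> 'a seed \<Rightarrow> bool" where
  "good_seed K \<Sigma> \<longleftrightarrow> good K (xvar \<Sigma>) (all_idx \<Sigma>) (exch_idx \<Sigma>) (bmat \<Sigma>)"

definition upper_bound :: "'a set \<Rightarrow> 'a seed \<Rightarrow> 'a set" where
  "upper_bound K \<Sigma> = UB K (xvar \<Sigma>) (all_idx \<Sigma>) (exch_idx \<Sigma>) (bmat \<Sigma>)"

lemma principal_cols_indep:
  assumes "principal_coefficients \<Sigma>"
  shows "cols_indep (all_idx \<Sigma>) (exch_idx \<Sigma>) (bmat \<Sigma>)"
  unfolding cols_indep_def
proof (intro allI impI ballI)
  let ?n = "n_exch \<Sigma>"
  fix c j assume c: "\<forall>k\<in>all_idx \<Sigma>. (\<Sum>l\<in>exch_idx \<Sigma>. c l * bmat \<Sigma> k l) = 0" and j: "j \<in> exch_idx \<Sigma>"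
  have "?n + j \<in> all_idx \<Sigma>" using assms j unfolding principal_coefficients_def all_idx_def exch_idx_def by auto
  then have "(\<Sum>l\<in>exch_idx \<Sigma>. c l * bmat \<Sigma> (?n + j) l) = 0" using c by blast
  also have "(\<Sum>l\<in>exch_idx \<Sigma>. c l * bmat \<Sigma> (?n + j) l) = (\<Sum>l\<in>exch_idx \<Sigma>. if l = j then c l else 0)"
    by (rule sum.cong) (use assms j in \<open>auto simp: principal_coefficients_def exch_idx_def\<close>)
  finally show "c j = 0" using j by (simp add: exch_idx_def)
qed

lemma principal_part_seed:
  assumes "principal_coefficients \<Sigma>"
  shows "principal_part (all_idx \<Sigma>) (exch_idx \<Sigma>) (\<lambda>i. n_exch \<Sigma> + i) (bmat \<Sigma>)"
  using assms unfolding principal_part_def principal_coefficients_def all_idx_def exch_idx_def by auto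

lemma initial_good:
  assumes "subring K R" "is_seed R K \<Sigma>" "principal_coefficients \<Sigma>"
  shows "good_seed K \<Sigma>"
  using alg_independent_indep[OF assms(1), of "xvar \<Sigma>" "all_idx \<Sigma>"] assms(2) principal_cols_indep[OF assms(3)]
  unfolding good_seed_def good_def is_seed_def skew_symmetrizable_def skew_def
  by (auto simp: exch_idx_def all_idx_def)

lemma mutation_class_upper_bound:
  assumes K: "subring K R" and g: "good_seed K \<Sigma>" and "\<Sigma>' \<in> mutation_class R \<Sigma>"
  shows "n_exch \<Sigma>' = n_exch \<Sigma> \<and> good_seed K \<Sigma>' \<and> upper_bound K \<Sigma>' \<subseteq> upper_bound K \<Sigma>"
  using assms(3)
proof (induct rule: mutation_class.induct)
  case (mutation \<Sigma>' i)
  let ?x = "xvar \<Sigma>'" and ?I = "all_idx \<Sigma>'" and ?E = "exch_idx \<Sigma>'" and ?b = "bmat \<Sigma>'"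
  have g: "good K ?x ?I ?E ?b" using mutation unfolding good_seed_def by simp
  have eq: "xvar (mutate R i \<Sigma>') = mutx ?x ?I ?b i" "bmat (mutate R i \<Sigma>') = mutate_mat i ?b"
    "n_exch (mutate R i \<Sigma>') = n_exch \<Sigma>'" "all_idx (mutate R i \<Sigma>') = ?I" "exch_idx (mutate R i \<Sigma>') = ?E"
    unfolding mutate_def mutx_def exchange_poly_exch[OF goodD(6)[OF g]] by (simp_all add: all_idx_def exch_idx_def)
  show ?case
    using mutation(2) good_mutate[OF K g mutation(3)] UB_mutate[OF K g mutation(3)]
    unfolding good_seed_def upper_bound_def eq by blast
qed (use g in simp)

lemma UB_var:
  assumes K: "subring K R" and g: "good K x I E b" and i: "i \<in> I"
  shows "x i \<in> UB K x I E b"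
  unfolding UB_def
proof (intro CollectI conjI ballI)
  note gd = goodD[OF g]
  show "x i \<in> LP K x I" using LP_mem(2)[OF K gd(6) i] .
  fix j assume j: "j \<in> E"
  have n: "nz x (I - {j})" using nz_mono[OF gd(6)] by auto
  have jI: "j \<in> I" using j gd(2) by auto
  note m = exring_mem[OF LP_subring[OF K n] nzD[OF gd(6) jI] fl_closed[OF K gd(1,6), of b j]]
  show "x i \<in> exring (LP K x (I - {j})) (x j) (fl x I b j)"
  proof (cases "i = j")
    case True
    then show ?thesis using m(3) by simp
  next
    case False
    then show ?thesis using LP_mem(2)[OF K n, of i] m(2) i by auto
  qed
qed

lemma UB_LP:
  assumes K: "subring K R" and g: "good K x I E b"
  shows "LP K x (I - E) \<subseteq> UB K x I E b"
proof
  note gd = goodD[OF g]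
  fix z assume z: "z \<in> LP K x (I - E)"
  have "z \<in> exring (LP K x (I - {j})) (x j) (fl x I b j)" if j: "j \<in> E" for j
  proof -
    have n: "nz x (I - {j})" using nz_mono[OF gd(6)] by auto
    have jI: "j \<in> I" using j gd(2) by auto
    have "z \<in> LP K x (I - {j})" using z LP_mono[OF K n, of "I - E"] j by auto
    then show ?thesis
      using exring_mem(2)[OF LP_subring[OF K n] nzD[OF gd(6) jI] fl_closed[OF K gd(1,6), of b j]] by blast
  qed
  then show "z \<in> UB K x I E b" unfolding UB_def using z LP_mono[OF K gd(6), of "I - E"] by auto
qed

text \<open>Checked on generators: those of the algebra lie in the upper bound, while those of the
  lower bound are constants, frozen variables with their inverses, and cluster variables of the
  initial seed and its neighbours.\<close>

lemma cluster_algebra_carrier: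
  assumes K: "subring K R" and g: "good_seed K \<Sigma>" and ac: "acyclic_seed \<Sigma>" and pc: "principal_coefficients \<Sigma>"
  shows "cluster_algebra R K \<Sigma> = R\<lparr>carrier := upper_bound K \<Sigma>\<rparr>"
proof -
  let ?x = "xvar \<Sigma>" and ?I = "all_idx \<Sigma>" and ?E = "exch_idx \<Sigma>" and ?b = "bmat \<Sigma>"
  let ?X = "K \<union> cluster_variables R \<Sigma> \<union> frozen_variables \<Sigma> \<union> (\<lambda>y. inv y) ` frozen_variables \<Sigma>"
  have g': "good K ?x ?I ?E ?b" using g unfolding good_seed_def .
  note gd = goodD[OF g']
  have fr: "frozen_idx \<Sigma> = ?I - ?E" unfolding frozen_idx_def all_idx_def exch_idx_def by auto
  have nF: "nz ?x (?I - ?E)" using nz_mono[OF gd(6)] by auto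
  have US: "subring (upper_bound K \<Sigma>) R" unfolding upper_bound_def using UB_subring[OF K g'] by blast
  have cv: "cluster_variables R \<Sigma> \<subseteq> upper_bound K \<Sigma>"
  proof
    fix z assume "z \<in> cluster_variables R \<Sigma>"
    then obtain \<Sigma>' i where s: "\<Sigma>' \<in> mutation_class R \<Sigma>" "i \<in> exch_idx \<Sigma>'" "z = xvar \<Sigma>' i"
      unfolding cluster_variables_def by auto
    note m = mutation_class_upper_bound[OF K g s(1)]
    have "i \<in> all_idx \<Sigma>'" using s(2) unfolding exch_idx_def all_idx_def by auto
    then have "z \<in> upper_bound K \<Sigma>'" unfolding s(3) upper_bound_def
      using UB_var[OF K] m unfolding good_seed_def by blast
    then show "z \<in> upper_bound K \<Sigma>" using m by blast
  qed
  have X: "?X \<subseteq> upper_bound K \<Sigma>"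
    using cv subset_trans[OF LP_mem(1)[OF K nF] UB_LP[OF K g']] LP_mem(2,3)[OF K nF] UB_LP[OF K g']
    unfolding upper_bound_def frozen_variables_def fr by blast
  have Xc: "?X \<subseteq> carrier R" using X subring_closed(1)[OF US] by blast
  note GS = generate_ring_is_subring[OF Xc]
  have in_cv: "?x i \<in> cluster_variables R \<Sigma>" "exch ?x ?I ?b i \<otimes> inv (?x i) \<in> cluster_variables R \<Sigma>"
    if i: "i \<in> ?E" for i
  proof -
    show "?x i \<in> cluster_variables R \<Sigma>"
      unfolding cluster_variables_def using mutation_class.initial i by fast
    have "xvar (mutate R i \<Sigma>) i = exch ?x ?I ?b i \<otimes> inv (?x i)"
      unfolding mutate_def exchange_poly_exch[OF gd(6)] by simp
    moreover have "i \<in> exch_idx (mutate R i \<Sigma>)" using i by (simp add: mutate_def exch_idx_def)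
    ultimately show "exch ?x ?I ?b i \<otimes> inv (?x i) \<in> cluster_variables R \<Sigma>"
      unfolding cluster_variables_def
      using mutation_class.mutation[OF mutation_class.initial i, of R] by force
  qed
  have "upper_bound K \<Sigma> \<subseteq> LB K ?x ?I ?b (?I - ?E) ?E"
    unfolding upper_bound_def using UB_subset_LB[OF K g' principal_part_seed[OF pc]] ac unfolding acyclic_seed_def by blast
  also have "\<dots> \<subseteq> generate_ring R ?X"
  proof (rule LB_least[OF K gd(6) _ gd(2) GS])
    show "LP K ?x (?I - ?E) \<subseteq> generate_ring R ?X"
      by (rule LP_least[OF K nF GS])
        (auto intro!: generate_ring.incl simp: frozen_variables_def fr)
  qed (use in_cv in \<open>auto intro!: generate_ring.incl\<close>)
  finally have "generate_ring R ?X = upper_bound K \<Sigma>"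
    using generate_ring_min_subring1[OF Xc US X] by blast
  then show ?thesis unfolding cluster_algebra_def by simp
qed

lemma cluster_algebra_factorial:
  assumes "base_ring R K" "is_seed R K \<Sigma>" "acyclic_seed \<Sigma>" "principal_coefficients \<Sigma>"
  shows "factorial_domain (cluster_algebra R K \<Sigma>)"
proof -
  note K = base_ring_ufd[OF assms(1)]
  have KS: "subring K R" using K unfolding ufd_def by auto
  note g = initial_good[OF KS assms(2,4)]
  from UB_ufd[OF K g[unfolded good_seed_def] principal_part_seed[OF assms(4)] subset_refl]
  have "ufd (upper_bound K \<Sigma>)" unfolding upper_bound_def .
  from ufd_imp_factorial[OF this] show ?thesis
    unfolding cluster_algebra_carrier[OF KS g assms(3,4)] .
qed

end

theorem corollary5p3:
  fixes F :: "('a, 'b) ring_scheme" and K :: "'a set" and \<Sigma> :: "'a seed"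
  assumes "field F"
    and "base_ring F K"
    and "is_seed F K \<Sigma>"
    and "ambient_field F K \<Sigma>"
    and "acyclic_seed \<Sigma>"
    and "principal_coefficients \<Sigma>"
  shows "factorial_domain (cluster_algebra F K \<Sigma>)"
proof -
  interpret field F by (rule assms(1))
  show ?thesis using cluster_algebra_factorial assms(2,3,5,6) .
qed

end
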